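(* Let $q=r^3$, where $r$ is a prime power which is not a square. There are exactly $r(r^5+r^4+r^3+r^2+r+1)$ extremal Peisert-type graphs defined over $\mathbb{F}_{q^2}$. Moreover, if $X$ is such an extremal graph, then $X$ is unique up to isomorphism (any two such graphs are isomorphic), and $X$ has exactly $r^2+1$ canonical cliques containing $0$ and exactly $r^2+r+1$ non-canonical (maximum) cliques containing $0$.
   Context: For an abelian group $G$ and $S\subseteq G\setminus\{0\}$ with $S=-S$, $\operatorname{Cay}(G,S)$ is the graph on $G$ with $g\sim h$ iff $g-h\in S$. A Peisert-type graph of type $(m,q)$ (defined over $\mathbb{F}_{q^2}$) is $\operatorname{Cay}(\mathbb{F}_{q^2}^+,S)$ with $S=c_1\mathbb{F}_q^*\cup\cdots\cup c_m\mathbb{F}_q^*$ a union of $m\le q$ distinct cosets of $\mathbb{F}_q^*$ in $\mathbb{F}_{q^2}^*$. Its clique number is $q$; maximum cliques have size $q$. Canonical cliques are the sets $x+c_i\mathbb{F}_q$ ($x\in\mathbb{F}_{q^2}$); a non-canonical clique is a maximum clique that is not canonical. The strict-EKR property means all maximum cliques are canonical. A Peisert-type graph of type $(m,q)$ is extremal if it lacks the strict-EKR property while all Peisert-type graphs of type $(m-1,q)$ have it. *)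

theory Defs
  imports
    "HOL-Library.Cardinality"
    "HOL-Computational_Algebra.Nth_Powers"
    "HOL-Number_Theory.Prime_Powers"
    "Graph_Theory.Graph_Theory"
begin

definition is_subfield :: "'a::field set \<Rightarrow> bool" where
  "is_subfield K \<longleftrightarrow> 0 \<in> K \<and> 1 \<in> K \<and>
     (\<forall>x\<in>K. \<forall>y\<in>K. x - y \<in> K \<and> x * y \<in> K) \<and> (\<forall>x\<in>K. inverse x \<in> K)"

(* The graph is simple and undirected, i.e. a pair_graph, when 0 is not in S and S = -S. *)
definition cayley_graph :: "'a::ab_group_add set \<Rightarrow> 'a pair_pre_digraph" where
  "cayley_graph S = \<lparr>pverts = UNIV, parcs = {(g, h). g - h \<in> S}\<rparr>"

definition unit_coset :: "'a::field set \<Rightarrow> 'a \<Rightarrow> 'a set" where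
  "unit_coset K c = (\<lambda>k. c * k) ` (K - {0})"

(* Peisert-type graphs of type (m, card K) are represented by their connection sets;
   cayley_graph turns these into graphs, and S is the neighbourhood of 0 in cayley_graph S. *)
definition peisert_type :: "'a::{field,finite} set \<Rightarrow> nat \<Rightarrow> 'a set \<Rightarrow> bool" where
  "peisert_type K m S \<longleftrightarrow> 1 \<le> m \<and> m \<le> card K \<and>
     (\<exists>C. C \<subseteq> unit_coset K ` (- {0}) \<and> card C = m \<and> S = \<Union>C)"

definition clique :: "'a pair_pre_digraph \<Rightarrow> 'a set \<Rightarrow> bool" where
  "clique G A \<longleftrightarrow> A \<subseteq> pverts G \<and> (\<forall>x\<in>A. \<forall>y\<in>A. x \<noteq> y \<longrightarrow> (x, y) \<in> parcs G)"

(* Largest cardinality, not merely inclusion-maximal; used for finite graphs only. *)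
definition maximum_clique :: "'a pair_pre_digraph \<Rightarrow> 'a set \<Rightarrow> bool" where
  "maximum_clique G A \<longleftrightarrow> clique G A \<and> (\<forall>B. clique G B \<longrightarrow> card B \<le> card A)"

(* For S a union of cosets c_1 K^*, ..., c_m K^*, the cosets c K^* contained in S
   are exactly the c_i K^*. *)
definition canonical_clique :: "'a::{field,finite} set \<Rightarrow> 'a set \<Rightarrow> 'a set \<Rightarrow> bool" where
  "canonical_clique K S A \<longleftrightarrow>
     (\<exists>x c. c \<noteq> 0 \<and> unit_coset K c \<subseteq> S \<and> A = (\<lambda>k. x + c * k) ` K)"

definition noncanonical_clique :: "'a::{field,finite} set \<Rightarrow> 'a set \<Rightarrow> 'a set \<Rightarrow> bool" where
  "noncanonical_clique K S A \<longleftrightarrow>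
     maximum_clique (cayley_graph S) A \<and> \<not> canonical_clique K S A"

definition strict_EKR :: "'a::{field,finite} set \<Rightarrow> 'a set \<Rightarrow> bool" where
  "strict_EKR K S \<longleftrightarrow>
     (\<forall>A. maximum_clique (cayley_graph S) A \<longrightarrow> canonical_clique K S A)"

(* For m = 1 the second condition is vacuous, there being no graphs of type (0, q). *)
definition extremal_of_type :: "'a::{field,finite} set \<Rightarrow> nat \<Rightarrow> 'a set \<Rightarrow> bool" where
  "extremal_of_type K m S \<longleftrightarrow> peisert_type K m S \<and> \<not> strict_EKR K S \<and>
     (\<forall>T. peisert_type K (m - 1) T \<longrightarrow> strict_EKR K T)"

definition extremal :: "'a::{field,finite} set \<Rightarrow> 'a set \<Rightarrow> bool" where
  "extremal K S \<longleftrightarrow> (\<exists>m. extremal_of_type K m S)"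

end

(*
  Identify the field of order q^2 with the affine plane over K. A non-canonical maximum clique is a
  set U of q points, not a line, determining at most m directions. If m <= r^2 + 1, the Redei
  polynomial of U specialises in every determined direction z to a fully reducible polynomial
  X^q + h with deg h <= r^2. Redei's argument on such lacunary polynomials shows that all lines in
  determined directions meet U in a multiple of r points. Hence the X-derivative of the bivariate
  Redei polynomial is free of X, so that the lines in direction z that meet U all meet it in the same
  number n_z of points. As r is not a square, the least n_z is r, which forces m = r^2 + 1, and the
  projections of U in the directions with n_z = r are zero sets of linearised polynomials. There
  are enough of these directions to make U a subspace over the field F of order r.

  Such a U has exactly one direction with n_z > r, so up to a choice of basis (v, u) it is
  W v + F u, where W is the set of elements of trace zero: its directions form a club with head v.
  All three claims of the theorem now follow by counting the bases that give the same club.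
*)
theory Submission
  imports
    Defs
    "HOL-Computational_Algebra.Polynomial"
    "HOL-Library.Product_Plus"
begin

text \<open>The bound \<open>r ^ 2 + 1\<close> fits from both sides because
  \<open>q / r = r ^ 2\<close>. A tail of degree at most \<open>r ^ 2\<close> is short enough for
  the common power of the characteristic dividing all multiplicities to be raised step by step up to
  \<open>r\<close>; conversely, constant multiplicity \<open>r\<close> forces the tail to have
  degree exactly \<open>r ^ 2\<close>, hence at least \<open>r ^ 2 + 1\<close> directions. If all
  weights exceeded \<open>r\<close>, the least one \<open>s\<close> would satisfy
  \<open>q = s ^ 2\<close>, as for an affine Baer subplane, which has only \<open>s + 1\<close>
  directions; this is what the non-square hypothesis excludes. The heavy direction is unique because
  the weights exceed \<open>r\<close> by \<open>r ^ 2 - r\<close> in total, while a weight above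
  \<open>r\<close> of a subspace over \<open>F\<close> is at least \<open>r ^ 2\<close>. All planes
  over \<open>F\<close> inside \<open>K\<close> are multiples of the trace kernel, so a
  \<open>K\<close>-basis is the only freedom left in a club. There are
  \<open>(q^2 - 1) (q^2 - q)\<close> bases, and each club comes from
  \<open>(q - 1) (r - 1) r^2\<close> of them. Non-canonical cliques through \<open>0\<close> are the
  \<open>K\<close>-multiples of one club space, up to factors from \<open>F\<close>, whence
  \<open>(q - 1) / (r - 1) = r^2 + r + 1\<close>.\<close>

lemma card_eq_card_image_times_fibre:
  assumes "finite A" and "\<And>x. x \<in> A \<Longrightarrow> card {y \<in> A. f y = f x} = n"
  shows "card A = card (f ` A) * n"
proof -
  have "card A = (\<Sum>b\<in>f ` A. card {y \<in> A. f y = b})"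
    using sum.image_gen[OF assms(1), of "\<lambda>_. 1::nat" f] by simp
  also have "\<dots> = (\<Sum>b\<in>f ` A. n)"
    by (rule sum.cong) (use assms(2) in auto)
  finally show ?thesis by simp
qed

lemma card_additive_image:
  fixes f :: "'a::ab_group_add \<Rightarrow> 'b::ab_group_add"
  assumes "finite A" and diff: "\<And>x y. x \<in> A \<Longrightarrow> y \<in> A \<Longrightarrow> x - y \<in> A"
    and f: "\<And>x y. x \<in> A \<Longrightarrow> y \<in> A \<Longrightarrow> f (x - y) = f x - f y"
  shows "card A = card (f ` A) * card {x \<in> A. f x = 0}"
proof (rule card_eq_card_image_times_fibre[OF assms(1)])
  fix x assume x: "x \<in> A"
  have plus: "y + x \<in> A" if "y \<in> A" for y
  proof -
    have "x - x \<in> A" using diff x by blast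
    then have "0 - x \<in> A" using diff[of 0 x] x by simp
    then show ?thesis using diff[of y "0 - x"] that by simp
  qed
  have fplus: "f (y + x) = f y + f x" if "y \<in> A" for y
    using f[of "y + x" x] plus[OF that] x by (simp add: algebra_simps)
  have "bij_betw (\<lambda>y. y - x) {y \<in> A. f y = f x} {x \<in> A. f x = 0}"
    by (rule bij_betwI[where g = "\<lambda>y. y + x"]) (use x diff f plus fplus in auto)
  then show "card {y \<in> A. f y = f x} = card {x \<in> A. f x = 0}"
    by (rule bij_betw_same_card)
qed

lemma prime_CHAR_finite: "prime CHAR('a::{field,finite})"
  by (rule prime_CHAR_semidom) (simp add: finite_imp_CHAR_pos)

text \<open>Translation by \<open>1\<close> permutes the field, so summing \<open>x + 1\<close> and
  \<open>x\<close> over it gives the same value; the difference is the order of the field times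
  \<open>1\<close>.\<close>

lemma CHAR_dvd_card_UNIV: "CHAR('a::{field,finite}) dvd CARD('a)"
proof -
  have "(\<Sum>x\<in>UNIV. x + 1 :: 'a) = (\<Sum>x\<in>UNIV. x)"
    by (rule sum.reindex_bij_witness[of _ "\<lambda>x. x - 1" "\<lambda>x. x + 1"]) auto
  then have "of_nat CARD('a) = (0 :: 'a)" by (simp add: sum.distrib)
  then show ?thesis by (simp add: of_nat_eq_0_iff_char_dvd)
qed

lemma frobenius_diff:
  fixes x y :: "'a::comm_ring_1"
  assumes "prime CHAR('a)" "n = CHAR('a) ^ k"
  shows "(x - y) ^ n = x ^ n - y ^ n"
  using freshmans_dream'[OF assms, of "x - y" y] by (simp add: algebra_simps)

lemma prime_power_of_primepow_dvd:
  assumes "primepow (r::nat)" "prime p" "p dvd r ^ n"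
  shows "\<exists>k>0. r = p ^ k"
proof -
  obtain p' k where pk: "prime p'" "k > 0" "r = p' ^ k"
    using assms(1) by (auto simp: primepow_def)
  then have "p = p'"
    using assms(2,3) prime_dvd_power primes_dvd_imp_eq by metis
  then show ?thesis using pk by auto
qed

text \<open>On nonzero elements this is a homomorphism whose kernel is the multiplicative group of
  the subfield of order \<open>q\<close>, so its values label the cosets of that group.\<close>

definition dir :: "nat \<Rightarrow> 'a::field \<Rightarrow> 'a" where
  "dir q u = u ^ (q - 1)"

section \<open>The tower of fields of order r, r^3 and r^6\<close>

locale cubic_field =
  fixes K :: "'a::{field,finite} set" and q r :: nat
  assumes primepow_r: "primepow r" and not_square_r: "\<not> is_square r" and q_eq: "q = r ^ 3"
    and card_UNIV: "CARD('a) = q ^ 2" and subfield_K: "is_subfield K" and card_K: "card K = q"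
begin

definition F :: "'a set" where "F = {x. x ^ r = x}"

definition subspace_F :: "'a set \<Rightarrow> bool" where
  "subspace_F A \<longleftrightarrow> 0 \<in> A \<and> (\<forall>x\<in>A. \<forall>y\<in>A. x + y \<in> A) \<and> (\<forall>a\<in>F. \<forall>x\<in>A. a * x \<in> A)"

text \<open>The expression is the trace of the cubic extension \<open>K\<close> of
  \<open>F\<close>.\<close>

definition trace_zero :: "'a set" where
  "trace_zero = {x \<in> K. x + x ^ r + x ^ (r ^ 2) = 0}"

lemma r_gt_1: "r > 1"
  using primepow_gt_Suc_0[OF primepow_r] by simp

lemma q_gt_1: "q > 1"
  using one_less_power[OF r_gt_1, of 3] q_eq by simp

lemma r_prime_power: "\<exists>k>0. r = CHAR('a) ^ k"
proof (rule prime_power_of_primepow_dvd[OF primepow_r prime_CHAR_finite])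
  show "CHAR('a) dvd r ^ 6"
    using CHAR_dvd_card_UNIV[where 'a = 'a] card_UNIV q_eq by (simp flip: power_mult)
qed

lemma power_card_UNIV: "x ^ (q ^ 2) = (x::'a)"
proof (cases "x = 0")
  case True then show ?thesis using q_gt_1 by simp
next
  case False
  have "(\<Prod>y\<in>UNIV-{0}. x * y) = (\<Prod>y\<in>UNIV-{0}. y)"
    by (rule prod.reindex_bij_witness[of _ "\<lambda>y. y / x" "\<lambda>y. x * y"]) (use False in auto)
  then have "x ^ (q^2 - 1) = 1"
    by (simp add: prod.distrib card_UNIV card_Diff_subset)
  then have "x * x ^ (q^2 - 1) = x" by simp
  moreover have "Suc (q ^ 2 - 1) = q ^ 2" using q_gt_1 by simp
  ultimately show ?thesis by (metis power_Suc)
qed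

lemma K_closed:
  shows zero_in_K [simp]: "0 \<in> K" and one_in_K [simp]: "1 \<in> K"
    and K_diff: "x \<in> K \<Longrightarrow> y \<in> K \<Longrightarrow> x - y \<in> K"
    and K_mult: "x \<in> K \<Longrightarrow> y \<in> K \<Longrightarrow> x * y \<in> K"
    and K_inverse: "x \<in> K \<Longrightarrow> inverse x \<in> K"
  using subfield_K by (auto simp: is_subfield_def)

lemma K_add: "x \<in> K \<Longrightarrow> y \<in> K \<Longrightarrow> x + y \<in> K"
  using K_diff[of x "0 - y"] K_diff[of 0 y] by simp

lemma K_uminus: "x \<in> K \<Longrightarrow> - x \<in> K"
  using K_diff[of 0 x] by simp

lemma K_divide: "x \<in> K \<Longrightarrow> y \<in> K \<Longrightarrow> x / y \<in> K"
  using K_mult K_inverse by (simp add: divide_inverse)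

lemma card_roots_le:
  fixes f :: "'a poly"
  assumes "f \<noteq> 0" "\<And>x. x \<in> A \<Longrightarrow> poly f x = 0"
  shows "card A \<le> degree f"
proof -
  have "card A \<le> card {x. poly f x = 0}"
    by (rule card_mono) (use assms in auto)
  also have "\<dots> \<le> degree f" by (rule card_poly_roots_bound[OF assms(1)])
  finally show ?thesis .
qed

lemma card_power_eq_self_le: "n > 1 \<Longrightarrow> card {x::'a. x ^ n = x} \<le> n"
proof -
  assume n: "n > 1"
  define f :: "'a poly" where "f = monom 1 n - monom 1 1"
  have "coeff f n = 1" using n by (simp add: f_def)
  then have "f \<noteq> 0" by auto
  moreover have "degree f \<le> n"
    using n unfolding f_def by (intro degree_diff_le) (auto simp: degree_monom_eq)
  ultimately show ?thesis
    using card_roots_le[of f "{x::'a. x ^ n = x}"] by (auto simp: f_def poly_monom)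
qed

text \<open>Multiplication by a nonzero element permutes the nonzero part of \<open>K\<close>, which
  puts \<open>K\<close> among the roots of \<open>X^q - X\<close>; there are at most
  \<open>q\<close> of those.\<close>

lemma K_iff: "x \<in> K \<longleftrightarrow> x ^ q = x"
proof -
  have "K \<subseteq> {x. x ^ q = x}"
  proof safe
    fix x assume x: "x \<in> K"
    show "x ^ q = x"
    proof (cases "x = 0")
      case True then show ?thesis using q_gt_1 by simp
    next
      case False
      have "(\<Prod>y\<in>K-{0}. x * y) = (\<Prod>y\<in>K-{0}. y)"
        by (rule prod.reindex_bij_witness[of _ "\<lambda>y. y / x" "\<lambda>y. x * y"])
           (use False x K_mult K_divide in auto)
      then have "x ^ (q - 1) = 1"
        by (simp add: prod.distrib card_K card_Diff_subset)
      then have "x * x ^ (q - 1) = x" by simp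
      moreover have "Suc (q - 1) = q" using q_gt_1 by simp
      ultimately show ?thesis by (metis power_Suc)
    qed
  qed
  moreover have "card {x::'a. x ^ q = x} \<le> card K"
    using card_power_eq_self_le[OF q_gt_1] card_K by simp
  ultimately have "K = {x. x ^ q = x}"
    by (intro card_seteq) auto
  then show ?thesis by auto
qed

lemma power_r_diff: "(x - y :: 'a) ^ r = x ^ r - y ^ r"
  using r_prime_power frobenius_diff[OF prime_CHAR_finite] by metis

lemma power_r_add: "(x + y :: 'a) ^ r = x ^ r + y ^ r"
  using r_prime_power freshmans_dream'[OF prime_CHAR_finite] by metis

lemma power_r2: "x ^ (r ^ 2) = ((x::'a) ^ r) ^ r"
  by (simp add: power2_eq_square power_mult)

lemma power_q: "x ^ q = (((x::'a) ^ r) ^ r) ^ r"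
  by (simp add: q_eq power3_eq_cube power_mult)

lemma power_q_diff: "(x - y :: 'a) ^ q = x ^ q - y ^ q"
  by (simp add: power_q power_r_diff)

lemma power_q_add: "(x + y :: 'a) ^ q = x ^ q + y ^ q"
  by (simp add: power_q power_r_add)

lemma power_q_q: "(x ^ q) ^ q = (x::'a)"
  using power_card_UNIV[of x] by (simp add: power2_eq_square power_mult)

lemma F_closed:
  shows zero_in_F [simp]: "0 \<in> F" and one_in_F [simp]: "1 \<in> F"
    and F_diff: "x \<in> F \<Longrightarrow> y \<in> F \<Longrightarrow> x - y \<in> F"
    and F_add: "x \<in> F \<Longrightarrow> y \<in> F \<Longrightarrow> x + y \<in> F"
    and F_mult: "x \<in> F \<Longrightarrow> y \<in> F \<Longrightarrow> x * y \<in> F"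
    and F_inverse: "x \<in> F \<Longrightarrow> inverse x \<in> F"
  using r_gt_1 by (auto simp: F_def power_r_diff power_r_add power_mult_distrib power_inverse)

lemma F_divide: "x \<in> F \<Longrightarrow> y \<in> F \<Longrightarrow> x / y \<in> F"
  using F_mult F_inverse by (simp add: divide_inverse)

lemma F_uminus: "x \<in> F \<Longrightarrow> - x \<in> F"
  using F_diff[of 0 x] by simp

lemma F_subset_K: "F \<subseteq> K"
  by (auto simp: F_def K_iff power_q)

text \<open>The trace of \<open>a x\<close> is a polynomial in \<open>x\<close> of degree
  \<open>r ^ 2\<close>. The case \<open>a = 1\<close> serves to compute \<open>card F\<close>;
  general \<open>a\<close> is what identifies an arbitrary plane with a scaled trace kernel.\<close>

lemma card_trace_zero_le:
  assumes "a \<noteq> 0"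
  shows "card {x::'a. a * x + (a * x) ^ r + (a * x) ^ (r ^ 2) = 0} \<le> r ^ 2"
proof -
  define f :: "'a poly" where "f = monom (a ^ r ^ 2) (r ^ 2) + monom (a ^ r) r + monom a 1"
  have r2: "r < r ^ 2" using r_gt_1 by (simp add: power2_eq_square)
  then have "coeff f (r ^ 2) = a ^ r ^ 2" using r_gt_1 by (auto simp: f_def)
  then have "f \<noteq> 0" using assms by auto
  moreover have "degree f \<le> r ^ 2"
    using r2 r_gt_1 unfolding f_def
    by (intro degree_add_le) (auto intro: order.trans[OF degree_monom_le])
  ultimately show ?thesis
    using card_roots_le[of f "{x::'a. a * x + (a * x) ^ r + (a * x) ^ (r ^ 2) = 0}"]
    by (auto simp: f_def poly_monom power_mult_distrib algebra_simps)
qed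

text \<open>The lower bound is the easy half of additive Hilbert 90: on \<open>K\<close> the map
  \<open>x ^ r - x\<close> has kernel \<open>F\<close> and values of trace zero, so its image has at
  most \<open>r ^ 2\<close> elements and its kernel at least \<open>q / r ^ 2 = r\<close>.\<close>

lemma card_F: "card F = r"
proof (rule antisym)
  show "card F \<le> r" unfolding F_def by (rule card_power_eq_self_le[OF r_gt_1])
  have "card K = card ((\<lambda>x. x ^ r - x) ` K) * card {x \<in> K. x ^ r - x = 0}"
    by (rule card_additive_image) (auto intro: K_diff simp: power_r_diff)
  also have "{x \<in> K. x ^ r - x = 0} = F"
    using F_subset_K by (auto simp: F_def)
  also have "card ((\<lambda>x. x ^ r - x) ` K) \<le> r ^ 2"
  proof (rule order.trans[OF card_mono card_trace_zero_le[of 1]])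
    show "(\<lambda>x. x ^ r - x) ` K \<subseteq> {x. 1 * x + (1 * x) ^ r + (1 * x) ^ (r ^ 2) = 0}"
      by (auto simp: K_iff power_q power_r2 power_r_diff)
  qed auto
  finally have "r ^ 2 * r \<le> r ^ 2 * card F"
    by (simp add: card_K q_eq power2_eq_square power3_eq_cube)
  then show "r \<le> card F" using r_gt_1 by simp
qed

text \<open>An element of \<open>K\<close> outside \<open>F\<close> has three conjugates.\<close>

lemma quadratic_independent:
  assumes "t \<in> K" "t \<notin> F" "a \<in> F" "b \<in> F" "c \<in> F" and eq: "a + b * t + c * t ^ 2 = 0"
  shows "a = 0 \<and> b = 0 \<and> c = 0"
proof (rule ccontr)
  assume ne: "\<not> ?thesis"
  define f where "f = [:a, b, c:]"
  have "f \<noteq> 0" using ne by (auto simp: f_def)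
  have conj: "poly f (x ^ r) = 0" if "poly f x = 0" for x
  proof -
    have "(poly f x) ^ r = 0" using that r_gt_1 by simp
    then show ?thesis
      using assms(3-5) by (simp add: f_def F_def power_r_add power_mult_distrib)
  qed
  have "poly f t = 0" using eq by (simp add: f_def power2_eq_square algebra_simps)
  then have "card {t, t ^ r, (t ^ r) ^ r} \<le> degree f"
    using conj \<open>f \<noteq> 0\<close> by (intro card_roots_le) auto
  also have "degree f \<le> 2" by (simp add: f_def)
  finally have le: "card {t, t ^ r, (t ^ r) ^ r} \<le> 2" .
  have tq: "((t ^ r) ^ r) ^ r = t" using assms(1) by (simp add: K_iff power_q)
  have "t ^ r \<noteq> t" using assms(2) by (simp add: F_def)
  moreover have "(t ^ r) ^ r \<noteq> t ^ r"
    using \<open>t ^ r \<noteq> t\<close> tq by metis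
  moreover have "(t ^ r) ^ r \<noteq> t"
    using \<open>t ^ r \<noteq> t\<close> tq by metis
  ultimately show False using le by auto
qed

section \<open>Subspaces over \<open>F\<close> and planes in \<open>K\<close>\<close>

lemma subspace_FD:
  assumes "subspace_F A"
  shows "0 \<in> A" "x \<in> A \<Longrightarrow> y \<in> A \<Longrightarrow> x + y \<in> A" "x \<in> A \<Longrightarrow> y \<in> A \<Longrightarrow> x - y \<in> A"
    "a \<in> F \<Longrightarrow> x \<in> A \<Longrightarrow> a * x \<in> A"
proof -
  show 0: "0 \<in> A" and add: "x \<in> A \<Longrightarrow> y \<in> A \<Longrightarrow> x + y \<in> A"
    and sc: "a \<in> F \<Longrightarrow> x \<in> A \<Longrightarrow> a * x \<in> A" for x y a
    using assms by (auto simp: subspace_F_def)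
  show "x - y \<in> A" if "x \<in> A" "y \<in> A"
    using add[OF that(1) sc[of "-1" y]] that F_uminus[of 1] by simp
qed

lemma card_span2:
  assumes "x \<noteq> 0" "y \<notin> (\<lambda>a. a * x) ` F"
  shows "card ((\<lambda>(a, b). a * x + b * y) ` (F \<times> F)) = r ^ 2"
proof -
  have "inj_on (\<lambda>(a, b). a * x + b * y) (F \<times> F)"
  proof (rule inj_onI, clarsimp)
    fix a b a' b' assume F: "a \<in> F" "b \<in> F" "a' \<in> F" "b' \<in> F" and eq: "a * x + b * y = a' * x + b' * y"
    have "b = b'"
    proof (rule ccontr)
      assume "b \<noteq> b'"
      then have "y = ((a' - a) / (b - b')) * x" using eq by (simp add: field_simps)
      then show False using assms(2) F F_divide F_diff by blast
    qed
    then show "a = a' \<and> b = b'" using eq assms(1) by simp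
  qed
  then show ?thesis by (simp add: card_image card_cartesian_product card_F power2_eq_square)
qed

lemma card_line_F: "x \<noteq> 0 \<Longrightarrow> card ((\<lambda>a. a * x) ` F) = r"
  by (simp add: card_image inj_on_def card_F)

lemma subspace_F_span2_subset:
  assumes "subspace_F A" "x \<in> A" "y \<in> A"
  shows "(\<lambda>(a, b). a * x + b * y) ` (F \<times> F) \<subseteq> A"
  using assms subspace_FD by auto

lemma subspace_F_card_gt:
  assumes "subspace_F A" "card A > r"
  shows "\<exists>x\<in>A. \<exists>y\<in>A. x \<noteq> 0 \<and> y \<notin> (\<lambda>a. a * x) ` F"
proof -
  have "\<exists>x\<in>A. x \<noteq> 0"
  proof (rule ccontr)
    assume "\<not> ?thesis"
    then have "A \<subseteq> {0}" by auto
    then have "card A \<le> 1" using card_mono[of "{0}" A] by simp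
    then show False using assms r_gt_1 by simp
  qed
  then obtain x where x: "x \<in> A" "x \<noteq> 0" by auto
  have "\<not> A \<subseteq> (\<lambda>a. a * x) ` F"
    using card_mono[of "(\<lambda>a. a * x) ` F" A] card_line_F[OF x(2)] assms(2) by auto
  then show ?thesis using x by auto
qed

text \<open>Replaces dimension theory: more than \<open>r\<close> elements yield two independent
  vectors, whose span has \<open>r ^ 2\<close> elements.\<close>

lemma subspace_F_card_ge:
  assumes "subspace_F A" "card A > r"
  shows "card A \<ge> r ^ 2"
  using subspace_F_card_gt[OF assms] subspace_F_span2_subset[OF assms(1)] card_span2
    card_mono[of A] finite[of A] by metis

lemma subspace_F_plane_eq:
  assumes "subspace_F A" "card A = r ^ 2" "x \<in> A" "y \<in> A" "x \<noteq> 0" "y \<notin> (\<lambda>a. a * x) ` F"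
  shows "A = (\<lambda>(a, b). a * x + b * y) ` (F \<times> F)"
  using card_subset_eq[of A "(\<lambda>(a, b). a * x + b * y) ` (F \<times> F)"] subspace_F_span2_subset[of A x y]
    card_span2[of x y] assms by auto

lemma r_less_r2: "r < r ^ 2"
  using r_gt_1 by (simp add: power2_eq_square)

lemma plane_obtain:
  assumes "subspace_F W" "card W = r ^ 2"
  obtains x y where "x \<in> W" "y \<in> W" "x \<noteq> 0" "y \<notin> (\<lambda>a. a * x) ` F"
    "W = (\<lambda>(a, b). a * x + b * y) ` (F \<times> F)"
  using subspace_F_card_gt[OF assms(1)] subspace_F_plane_eq[OF assms] assms(2) r_less_r2 by metis

lemma subspace_F_trace_zero: "subspace_F trace_zero"
  unfolding subspace_F_def
proof (intro conjI ballI)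
  show "0 \<in> trace_zero" using r_gt_1 by (simp add: trace_zero_def power_0_left)
next
  fix x y assume "x \<in> trace_zero" "y \<in> trace_zero"
  then have K: "x \<in> K" "y \<in> K" and eq: "x + x ^ r + (x ^ r) ^ r = 0" "y + y ^ r + (y ^ r) ^ r = 0"
    by (auto simp: trace_zero_def power_r2)
  have "(x + y) + (x + y) ^ r + ((x + y) ^ r) ^ r = (x + x ^ r + (x ^ r) ^ r) + (y + y ^ r + (y ^ r) ^ r)"
    by (simp only: power_r_add ac_simps)
  then show "x + y \<in> trace_zero" unfolding trace_zero_def power_r2 using K_add K eq by simp
next
  fix a x assume "a \<in> F" "x \<in> trace_zero"
  then have K: "a \<in> K" "x \<in> K" and a: "a ^ r = a" and eq: "x + x ^ r + (x ^ r) ^ r = 0"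
    using F_subset_K by (auto simp: trace_zero_def power_r2 F_def)
  have "a * x + (a * x) ^ r + ((a * x) ^ r) ^ r = a * (x + x ^ r + (x ^ r) ^ r)"
    by (simp only: power_mult_distrib a distrib_left)
  then show "a * x \<in> trace_zero" unfolding trace_zero_def power_r2 using K_mult K eq by simp
qed

text \<open>By counting, the \<open>F\<close>-linear map sending \<open>a\<close> to the traces of \<open>a x\<close> and \<open>a y\<close>
  has a nontrivial kernel.\<close>

lemma plane_eq_scaled_trace_zero:
  assumes W: "subspace_F W" "W \<subseteq> K" "card W = r ^ 2"
  shows "\<exists>a\<in>K - {0}. W = (\<lambda>x. a * x) ` trace_zero"
proof -
  obtain x y where xy: "x \<in> W" "y \<in> W" "W = (\<lambda>(a, b). a * x + b * y) ` (F \<times> F)"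
    by (rule plane_obtain[OF W(1,3)])
  define T where "T = (\<lambda>x::'a. x + x ^ r + x ^ (r ^ 2))"
  have T_diff: "T (a - b) = T a - T b" for a b
    by (simp add: T_def power_r2 power_r_diff)
  have T_add: "T (a + b) = T a + T b" for a b
    by (simp add: T_def power_r2 power_r_add)
  have T_F: "T a \<in> F" if "a \<in> K" for a
    using that by (simp add: T_def F_def K_iff power_q power_r2 power_r_add)
  have T_scale: "T (a * b) = a * T b" if "a \<in> F" for a b
    using that by (simp add: T_def F_def power_r2 power_mult_distrib distrib_left)
  define g where "g = (\<lambda>a. (T (a * x), T (a * y)))"
  have "card K = card (g ` K) * card {a \<in> K. g a = 0}"
    by (rule card_additive_image) (auto intro: K_diff simp: g_def left_diff_distrib T_diff)
  moreover have "card (g ` K) \<le> card (F \<times> F)"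
  proof (rule card_mono)
    have "x \<in> K" "y \<in> K" using xy(1,2) W(2) by blast+
    then show "g ` K \<subseteq> F \<times> F" by (auto simp: g_def intro!: T_F K_mult)
  qed auto
  moreover have "card (F \<times> F) = r ^ 2" by (simp add: card_cartesian_product card_F power2_eq_square)
  ultimately have "card {a \<in> K. g a = 0} > 1"
  proof -
    assume 1: "card K = card (g ` K) * card {a \<in> K. g a = 0}"
      and 2: "card (g ` K) \<le> card (F \<times> F)" "card (F \<times> F) = r ^ 2"
    have "card (g ` K) * card {a \<in> K. g a = 0} \<le> r ^ 2 * card {a \<in> K. g a = 0}"
      using 2 by simp
    then have "r ^ 3 \<le> r ^ 2 * card {a \<in> K. g a = 0}" unfolding 1[symmetric] card_K q_eq .
    then have "r \<le> card {a \<in> K. g a = 0}"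
      using r_gt_1 by (simp add: power2_eq_square power3_eq_cube)
    then show ?thesis using r_gt_1 by simp
  qed
  then have "\<not> {a \<in> K. g a = 0} \<subseteq> {0}"
    using card_mono[of "{0::'a}" "{a \<in> K. g a = 0}"] by auto
  then obtain a where a: "a \<in> K" "a \<noteq> 0" "T (a * x) = 0" "T (a * y) = 0"
    by (auto simp: g_def zero_prod_def)
  have Wsub: "W \<subseteq> {w. T (a * w) = 0}"
  proof
    fix w assume "w \<in> W"
    then obtain b c where "b \<in> F" "c \<in> F" "w = b * x + c * y" using xy(3) by auto
    then have "a * w = b * (a * x) + c * (a * y)" and "b \<in> F" "c \<in> F"
      by (simp_all add: algebra_simps)
    then have "T (a * w) = b * T (a * x) + c * T (a * y)"
      by (simp add: T_scale T_add)
    then show "w \<in> {w. T (a * w) = 0}" using a by simp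
  qed
  have "card {w. T (a * w) = 0} \<le> r ^ 2"
    using card_trace_zero_le[OF a(2)] by (simp add: T_def)
  \<comment> \<open>\<open>W\<close> already fills the zero set of the scaled trace, so the
    inclusion is an equality.\<close>
  then have Weq: "W = {w. T (a * w) = 0}"
    by (intro card_seteq) (use Wsub W(3) in auto)
  have "W = (\<lambda>x. inverse a * x) ` trace_zero"
  proof
    show "W \<subseteq> (\<lambda>x. inverse a * x) ` trace_zero"
    proof
      fix w assume w: "w \<in> W"
      then have "a * w \<in> trace_zero"
        using Weq subsetD[OF W(2) w] a(1) K_mult by (simp add: trace_zero_def T_def)
      then show "w \<in> (\<lambda>x. inverse a * x) ` trace_zero"
        using a(2) by (intro image_eqI[of _ _ "a * w"]) auto
    qed
    show "(\<lambda>x. inverse a * x) ` trace_zero \<subseteq> W"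
      using a(2) unfolding Weq by (auto simp: trace_zero_def T_def simp flip: mult.assoc)
  qed
  moreover have "inverse a \<in> K - {0}" using a K_inverse by simp
  ultimately show ?thesis by blast
qed

text \<open>It suffices to exhibit one plane in \<open>K\<close>, since every such plane is a
  nonzero multiple of \<open>trace_zero\<close>. The span of \<open>1\<close> and any
  \<open>t\<close> in \<open>K\<close> outside \<open>F\<close> serves.\<close>

lemma card_trace_zero: "card trace_zero = r ^ 2"
proof -
  have "\<exists>t\<in>K. t \<notin> F"
  proof (rule ccontr)
    assume "\<not> ?thesis"
    then have "K = F" using F_subset_K by auto
    then have "r ^ 3 = r ^ 1" using card_K card_F q_eq by simp
    then show False using r_gt_1 power_inject_exp[of r 3 1] by simp
  qed
  then obtain t where t: "t \<in> K" "t \<notin> F" by auto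
  define W where "W = (\<lambda>(a, b). a * 1 + b * t) ` (F \<times> F)"
  have "subspace_F W"
    unfolding subspace_F_def
  proof (intro conjI ballI)
    show "0 \<in> W" unfolding W_def by (rule image_eqI[of _ _ "(0, 0)"]) auto
  next
    fix x y assume "x \<in> W" "y \<in> W"
    then obtain a b c d where *: "a \<in> F" "b \<in> F" "c \<in> F" "d \<in> F" "x = a + b * t" "y = c + d * t"
      by (auto simp: W_def)
    then have "x + y = (a + c) * 1 + (b + d) * t" by (simp add: algebra_simps)
    then show "x + y \<in> W" unfolding W_def
      by (intro image_eqI[of _ _ "(a + c, b + d)"]) (use * F_add in auto)
  next
    fix x e assume "x \<in> W" and e: "e \<in> F"
    then obtain a b where *: "a \<in> F" "b \<in> F" "x = a + b * t"
      by (auto simp: W_def)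
    then have "e * x = (e * a) * 1 + (e * b) * t" by (simp add: algebra_simps)
    then show "e * x \<in> W" unfolding W_def
      by (intro image_eqI[of _ _ "(e * a, e * b)"]) (use * e F_mult in auto)
  qed
  moreover have "W \<subseteq> K" using t F_subset_K by (auto simp: W_def intro!: K_add K_mult)
  moreover have "card W = r ^ 2" unfolding W_def by (rule card_span2) (use t in auto)
  ultimately obtain a where a: "a \<noteq> 0" "W = (\<lambda>x. a * x) ` trace_zero"
    using plane_eq_scaled_trace_zero by blast
  then have "card W = card trace_zero" by (simp add: card_image inj_on_def)
  then show ?thesis using \<open>card W = r ^ 2\<close> by simp
qed

text \<open>For \<open>m\<close> outside \<open>F\<close> and nonzero \<open>x\<close> in
  \<open>W\<close>, the plane is spanned by \<open>x\<close> and \<open>m x\<close>; as it also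
  contains \<open>m^2 x\<close>, the element \<open>m\<close> would satisfy a quadratic equation
  over \<open>F\<close>, although it has degree three.\<close>

lemma plane_stabilizer:
  assumes W: "subspace_F W" "card W = r ^ 2" and m: "m \<in> K" "(\<lambda>x. m * x) ` W \<subseteq> W"
  shows "m \<in> F"
proof (rule ccontr)
  assume "m \<notin> F"
  obtain x y where x: "x \<in> W" "x \<noteq> 0" by (rule plane_obtain[OF W])
  have "m * x \<notin> (\<lambda>a. a * x) ` F" using x \<open>m \<notin> F\<close> by auto
  then have "W = (\<lambda>(a, b). a * x + b * (m * x)) ` (F \<times> F)"
    by (intro subspace_F_plane_eq[OF W]) (use x m in auto)
  moreover have "m * (m * x) \<in> W" using x m by auto
  ultimately obtain a b where ab: "a \<in> F" "b \<in> F" "m * (m * x) = a * x + b * (m * x)"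
    by auto
  then have "(- a + (- b) * m + 1 * m ^ 2) * x = 0" by (simp add: algebra_simps power2_eq_square)
  then have "- a + (- b) * m + 1 * m ^ 2 = 0" using x by simp
  then show False
    using quadratic_independent[OF m(1) \<open>m \<notin> F\<close>, of "- a" "- b" 1] ab F_uminus by auto
qed

text \<open>If \<open>t \<notin> F\<close> then \<open>1\<close>, \<open>1 / t\<close> and \<open>1 / (1 + t)\<close> are linearly independent over \<open>F\<close>.\<close>

lemma plane_not_inverse_closed:
  assumes W: "subspace_F W" "W \<subseteq> K" "card W = r ^ 2" and m: "m \<noteq> 0"
  shows "\<exists>w\<in>W - {0}. m / w \<notin> W"
proof (rule ccontr)
  assume "\<not> ?thesis"
  then have inv: "m / w \<in> W" if "w \<in> W" "w \<noteq> 0" for w using that by auto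
  obtain x y where xy: "x \<in> W" "y \<in> W" "x \<noteq> 0" "y \<notin> (\<lambda>a. a * x) ` F"
    by (rule plane_obtain[OF W(1,3)])
  define t where "t = y / x"
  have y: "y = t * x" using xy by (simp add: t_def)
  have tF: "t \<notin> F" using xy y by auto
  have tK: "t \<in> K" using xy W(2) K_divide[of y x] by (auto simp: t_def)
  have t1: "1 + t \<noteq> 0"
  proof
    assume "1 + t = 0"
    then have "t = - 1" by (simp add: eq_neg_iff_add_eq_0 add.commute)
    then show False using tF F_uminus[of 1] by simp
  qed
  have "t \<noteq> 0" using tF by auto
  have "W = (\<lambda>(a, b). a * (m / x) + b * (m / y)) ` (F \<times> F)"
  proof (rule subspace_F_plane_eq[OF W(1,3)])
    show "m / x \<in> W" "m / y \<in> W" using inv xy \<open>t \<noteq> 0\<close> y by auto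
    show "m / x \<noteq> 0" using m xy by simp
    show "m / y \<notin> (\<lambda>a. a * (m / x)) ` F"
    proof
      assume "m / y \<in> (\<lambda>a. a * (m / x)) ` F"
      then obtain a where a: "a \<in> F" "m / y = a * (m / x)" by auto
      then have "inverse t = a" using m xy y \<open>t \<noteq> 0\<close> by (simp add: field_simps)
      then show False using tF a F_inverse[of a] by auto
    qed
  qed
  moreover have "m / (x + y) \<in> W"
  proof (rule inv)
    show "x + y \<in> W" using W(1) xy subspace_FD by blast
    have "x + y = (1 + t) * x" using y by (simp add: algebra_simps)
    then show "x + y \<noteq> 0" using t1 xy by simp
  qed
  ultimately obtain a b where ab: "a \<in> F" "b \<in> F" "m / (x + y) = a * (m / x) + b * (m / y)"
    by auto
  have "x + y = (1 + t) * x" using y by (simp add: algebra_simps)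
  then have "m / (x + y) = (m / x) * (1 / (1 + t))" by simp
  moreover have "a * (m / x) + b * (m / y) = (m / x) * (a + b / t)"
    by (simp add: y algebra_simps)
  ultimately have "(m / x) * (1 / (1 + t)) = (m / x) * (a + b / t)"
    using ab(3) by metis
  then have "1 / (1 + t) = a + b / t"
    using m xy(3) by (simp only: mult_cancel_left) simp
  \<comment> \<open>Multiplication by \<open>t (1 + t)\<close>. The coefficients cannot all vanish,
    since \<open>a = b = 0\<close> contradicts \<open>a + b = 1\<close>.\<close>
  then have "b + (a + b - 1) * t + a * t ^ 2 = 0"
    using t1 \<open>t \<noteq> 0\<close> by (simp add: field_simps power2_eq_square)
  then have "b = 0 \<and> a + b - 1 = 0 \<and> a = 0"
    by (intro quadratic_independent[OF tK tF]) (use ab F_add F_diff in auto)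
  then show False by auto
qed

end

section \<open>Fully reducible lacunary polynomials\<close>

lemma prod_linear_dvd:
  fixes P :: "'a::field poly"
  assumes "finite A" "\<And>a. a \<in> A \<Longrightarrow> poly P a = 0"
  shows "(\<Prod>a\<in>A. [:- a, 1:]) dvd P"
  using assms
proof (induction A)
  case (insert a A)
  then obtain Q where Q: "P = (\<Prod>a\<in>A. [:- a, 1:]) * Q" by (auto elim: dvdE)
  have "poly (\<Prod>a\<in>A. [:- a, 1:]) a \<noteq> 0"
    using insert.hyps by (auto simp: poly_prod)
  then have "poly Q a = 0" using insert.prems[of a] Q by simp
  then have "[:- a, 1:] dvd Q" by (simp add: poly_eq_0_iff_dvd)
  then have "[:- a, 1:] * (\<Prod>a\<in>A. [:- a, 1:]) dvd Q * (\<Prod>a\<in>A. [:- a, 1:])"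
    by (intro mult_dvd_mono) auto
  then show ?case using insert.hyps Q by (simp add: mult.commute del: mult_pCons_left mult_pCons_right)
qed simp

text \<open>Differentiation lowers the multiplicity of each root by at most one, and one factor from
  the radical restores it.\<close>

lemma prod_linear_powers_dvd_pderiv:
  fixes m :: "'a::idom \<Rightarrow> nat"
  assumes "finite A"
  shows "(\<Prod>a\<in>A. [:- a, 1:] ^ m a) dvd (\<Prod>a\<in>A. [:- a, 1:]) * pderiv (\<Prod>a\<in>A. [:- a, 1:] ^ m a)"
  using assms
proof (induction A)
  case (insert a A)
  define f where "f = (\<Prod>a\<in>A. [:- a, 1:] ^ m a)"
  define g where "g = (\<Prod>a\<in>A. [:- a, 1:])"
  define l where "l = [:- a, 1:]"
  have "l ^ m a dvd l * pderiv (l ^ m a)"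
  proof (cases "m a")
    case (Suc n)
    have "pderiv l = 1" by (simp add: l_def pderiv_pCons)
    then have "l * pderiv (l ^ m a) = smult (of_nat (Suc n)) (l ^ m a)"
      by (simp add: Suc pderiv_power_Suc del: of_nat_Suc power_Suc) simp
    then show ?thesis by (simp add: dvd_smult)
  qed simp
  then have "l ^ m a * f dvd (l * pderiv (l ^ m a)) * (f * g)"
    by (intro mult_dvd_mono) auto
  moreover have "l ^ m a * f dvd (l * l ^ m a) * (g * pderiv f)"
    using insert.IH by (intro mult_dvd_mono) (auto simp: f_def g_def)
  ultimately have "l ^ m a * f dvd (l * pderiv (l ^ m a)) * (f * g) + (l * l ^ m a) * (g * pderiv f)"
    by (rule dvd_add)
  also have "\<dots> = (l * g) * pderiv (l ^ m a * f)"
    by (simp add: pderiv_mult algebra_simps)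
  finally show ?case using insert.hyps
    by (simp add: f_def g_def l_def del: mult_pCons_left mult_pCons_right)
qed simp

text \<open>Dividing the derivative by \<open>X - a\<close> to the power \<open>m a - 1\<close> and
  evaluating at \<open>a\<close> leaves \<open>m a\<close> times a nonzero value.\<close>

lemma prod_linear_powers_pderiv_0:
  fixes m :: "'a::idom \<Rightarrow> nat"
  assumes "finite A" "a \<in> A" and "pderiv (\<Prod>a\<in>A. [:- a, 1:] ^ m a) = 0"
  shows "CHAR('a) dvd m a"
proof (cases "m a")
  case (Suc n)
  define f where "f = (\<Prod>a\<in>A - {a}. [:- a, 1:] ^ m a)"
  define l where "l = [:- a, 1:]"
  have "(\<Prod>a\<in>A. [:- a, 1:] ^ m a) = l ^ Suc n * f"
    using assms(1,2) Suc by (simp add: f_def l_def prod.remove)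
  then have "0 = l ^ n * (smult (of_nat (Suc n)) f + l * pderiv f)"
  proof -
    have "pderiv l = 1" by (simp add: l_def pderiv_pCons)
    then have "pderiv (l ^ Suc n * f) = l ^ n * (smult (of_nat (Suc n)) f + l * pderiv f)"
      unfolding pderiv_mult pderiv_power_Suc by (simp add: algebra_simps smult_add_left del: of_nat_Suc)
    then show ?thesis using assms(3) \<open>_ = l ^ Suc n * f\<close> by simp
  qed
  then have "smult (of_nat (Suc n)) f + l * pderiv f = 0"
    by (simp add: l_def)
  then have "poly (smult (of_nat (Suc n)) f + l * pderiv f) a = 0" by simp
  then have "of_nat (Suc n) * poly f a = 0" by (simp add: l_def del: of_nat_Suc)
  moreover have "poly f a \<noteq> 0" using assms(1) by (auto simp: f_def poly_prod)
  ultimately show ?thesis using Suc of_nat_eq_0_iff_char_dvd by fastforce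
qed simp

lemma coeff_power_CHAR_power:
  fixes f :: "'a::comm_semiring_1 poly"
  assumes "prime CHAR('a)" "n = CHAR('a) ^ k"
  shows "coeff (f ^ n) j = (if n dvd j then coeff f (j div n) ^ n else 0)"
proof -
  have n: "n > 0" using assms prime_gt_0_nat by simp
  have "f ^ n = (\<Sum>i\<le>degree f. monom (coeff f i) i) ^ n" by (simp add: poly_as_sum_of_monoms)
  also have "\<dots> = (\<Sum>i\<le>degree f. monom (coeff f i) i ^ n)"
    using assms by (intro freshmans_dream_sum') auto
  finally have "coeff (f ^ n) j = (\<Sum>i\<le>degree f. if i * n = j then coeff f i ^ n else 0)"
    by (simp add: coeff_sum monom_power mult.commute)
  also have "\<dots> = (if n dvd j then coeff f (j div n) ^ n else 0)"
  proof (cases "n dvd j")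
    case True
    then have "(i * n = j) = (i = j div n)" for i using n by auto
    then show ?thesis using True n by (auto simp: coeff_eq_0 not_le power_0_left)
  next
    case False
    then show ?thesis by (auto intro!: sum.neutral)
  qed
  finally show ?thesis .
qed

text \<open>In the application \<open>q\<close> is the order of the subfield and \<open>{a. a\<^sup>q = c a}\<close> a line over it.\<close>

locale lacunary_split =
  fixes A :: "'a::{field,finite} set" and m :: "'a \<Rightarrow> nat" and c :: 'a and q e :: nat and h :: "'a poly"
  assumes q_def: "q = CHAR('a) ^ e" and m_pos: "\<And>a. a \<in> A \<Longrightarrow> m a > 0"
    and prod_eq: "(\<Prod>a\<in>A. [:- a, 1:] ^ m a) = monom 1 q + h"
    and degree_h: "degree h < q" and c_nonzero: "c \<noteq> 0"
    and root: "\<And>a. a \<in> A \<Longrightarrow> a ^ q = c * a"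
begin

text \<open>Meaningful when \<open>s\<close> is a power of the characteristic that divides every
  multiplicity: it is then the \<open>s\<close>-th root of the split polynomial, and
  \<open>rest s\<close> is the \<open>s\<close>-th root of \<open>h\<close>.\<close>

definition root_poly :: "nat \<Rightarrow> 'a poly" where
  "root_poly s = (\<Prod>a\<in>A. [:- a, 1:] ^ (m a div s))"

definition rest :: "nat \<Rightarrow> 'a poly" where
  "rest s = root_poly s - monom 1 (q div s)"

lemma prime_p: "prime CHAR('a)" and prime_p_poly: "prime CHAR('a poly)"
  by (simp_all add: prime_CHAR_finite)

lemma p_gt_1: "CHAR('a) > 1"
  using prime_p prime_gt_1_nat by auto

lemma rest_power:
  assumes s: "s = CHAR('a) ^ i" "i \<le> e" and dvd: "\<And>a. a \<in> A \<Longrightarrow> s dvd m a"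
  shows "rest s ^ s = h"
proof -
  have sq: "s dvd q" using s q_def by (simp add: le_imp_power_dvd)
  have "root_poly s ^ s = (\<Prod>a\<in>A. [:- a, 1:] ^ m a)"
    unfolding root_poly_def using dvd
    by (auto simp: prod_power_distrib simp flip: power_mult intro!: prod.cong)
  moreover have "rest s ^ s = root_poly s ^ s - monom 1 (q div s) ^ s"
    unfolding rest_def using frobenius_diff[where 'a = "'a poly"] prime_p_poly s(1) by simp
  ultimately show ?thesis using sq by (simp add: prod_eq monom_power)
qed

lemma degree_rest:
  assumes "s = CHAR('a) ^ i" "i \<le> e" "\<And>a. a \<in> A \<Longrightarrow> s dvd m a"
  shows "s * degree (rest s) = degree h"
  using rest_power[OF assms] by (cases "rest s = 0") (auto simp: degree_power_eq power_0_left)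

lemma root_poly_eq: "root_poly s = monom 1 (q div s) + rest s"
  by (simp add: rest_def)

text \<open>Redei's key observation: a root satisfies both \<open>a^q + h(a) = 0\<close> and
  \<open>a^q = c a\<close>, hence it is also a root of the low-degree polynomial
  \<open>h + c X\<close>. Here \<open>h\<close> appears as \<open>rest s ^ s\<close>.\<close>

lemma radical_dvd:
  assumes "s = CHAR('a) ^ i" "i \<le> e" "\<And>a. a \<in> A \<Longrightarrow> s dvd m a"
  shows "(\<Prod>a\<in>A. [:- a, 1:]) dvd rest s ^ s + [:0, c:]"
proof (rule prod_linear_dvd)
  fix a assume a: "a \<in> A"
  have "poly (\<Prod>a\<in>A. [:- a, 1:] ^ m a) a = 0"
    using a m_pos[OF a] by (auto simp: poly_prod intro!: bexI[of _ a])
  then have "a ^ q + poly h a = 0" by (simp add: prod_eq poly_monom)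
  then show "poly (rest s ^ s + [:0, c:]) a = 0"
    using root[OF a] rest_power[OF assms] by (simp add: add.commute mult.commute)
qed simp

lemma pderiv_monom_q:
  assumes "s = CHAR('a) ^ i" "i < e"
  shows "pderiv (monom 1 (q div s)) = (0 :: 'a poly)"
proof -
  have "q div s = CHAR('a) ^ (e - i)"
    using assms q_def p_gt_1 by (simp add: power_diff)
  then have "CHAR('a) dvd q div s" using assms by simp
  then have "of_nat (q div s) = (0 :: 'a)" by (simp add: of_nat_eq_0_iff_char_dvd)
  then show ?thesis by (simp add: pderiv_monom)
qed

lemma degree_root_poly:
  assumes "s = CHAR('a) ^ i" "i \<le> e" "\<And>a. a \<in> A \<Longrightarrow> s dvd m a"
  shows "degree (root_poly s) = q div s" and "degree (rest s) < q div s"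
proof -
  have "s dvd q" "s > 0" using assms q_def p_gt_1 by (auto simp: le_imp_power_dvd)
  then have "s * (q div s) = q" by simp
  then have "s * degree (rest s) < s * (q div s)" using degree_rest[OF assms] degree_h by simp
  then show lt: "degree (rest s) < q div s" by simp
  show "degree (root_poly s) = q div s"
    unfolding root_poly_eq using lt by (subst degree_add_eq_left) (auto simp: degree_monom_eq)
qed

lemma pderiv_root_poly:
  assumes "s = CHAR('a) ^ i" "i < e"
  shows "pderiv (root_poly s) = pderiv (rest s)"
  using pderiv_monom_q[OF assms] by (simp add: root_poly_eq pderiv_add)

lemma degree_pderiv_le: "degree (pderiv f) \<le> degree f - 1" for f :: "'a poly"
  by (rule degree_le) (auto simp: coeff_pderiv coeff_eq_0)

text \<open>Let \<open>f = root_poly s\<close> and \<open>g = rest s\<close>. Then \<open>f\<close>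
  divides its radical times \<open>f'\<close>, the radical divides \<open>h + c X\<close>, and
  \<open>f' = g'\<close> because \<open>X^(q/s)\<close> has derivative zero. So \<open>f\<close>, of
  degree \<open>q / s\<close>, divides \<open>(h + c X) g'\<close>, whose degree is smaller by
  \<open>deg\<close>. Hence \<open>g' = f' = 0\<close>, and the characteristic divides all
  multiplicities of \<open>f\<close>.\<close>

lemma multiplicity_step:
  assumes s: "s = CHAR('a) ^ i" "i < e" and dvd: "\<And>a. a \<in> A \<Longrightarrow> s dvd m a"
    and h: "h \<noteq> - [:0, c:]" and deg: "degree h + degree h div s \<le> q div s"
    and a: "a \<in> A"
  shows "s * CHAR('a) dvd m a"
proof -
  note s' = s(1) less_imp_le[OF s(2)] dvd
  have s0: "s > 0" using s p_gt_1 by simp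
  have "root_poly s dvd (\<Prod>a\<in>A. [:- a, 1:]) * pderiv (root_poly s)"
    unfolding root_poly_def by (rule prod_linear_powers_dvd_pderiv) simp
  also have "\<dots> dvd (h + [:0, c:]) * pderiv (rest s)"
    using radical_dvd[OF s'] rest_power[OF s'] pderiv_root_poly[OF s] by (auto intro: mult_dvd_mono)
  finally have fdvd: "root_poly s dvd (h + [:0, c:]) * pderiv (rest s)" .
  have "pderiv (rest s) = 0"
  proof (rule ccontr)
    assume nz: "pderiv (rest s) \<noteq> 0"
    then have deg1: "degree (rest s) \<ge> 1"
      by (metis degree_eq_zeroE not_one_le_zero less_one not_le pderiv_singleton)
    have "h + [:0, c:] \<noteq> 0" using h by (metis eq_neg_iff_add_eq_0)
    then have "q div s \<le> degree ((h + [:0, c:]) * pderiv (rest s))"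
      using dvd_imp_degree_le[OF fdvd] nz degree_root_poly(1)[OF s'] by simp
    also have "\<dots> \<le> degree (h + [:0, c:]) + degree (pderiv (rest s))"
      by (rule degree_mult_le)
    also have "degree (h + [:0, c:]) \<le> degree h"
    proof (rule degree_add_le)
      have "1 \<le> s * degree (rest s)" using deg1 s0 by (simp add: Suc_le_eq)
      then show "degree [:0, c:] \<le> degree h" using c_nonzero degree_rest[OF s'] by simp
    qed simp
    also have "degree (pderiv (rest s)) \<le> degree (rest s) - 1"
      by (rule degree_pderiv_le)
    also have "degree (rest s) = degree h div s"
      using degree_rest[OF s'] s0 by (metis nonzero_mult_div_cancel_left not_less_zero)
    finally show False using deg deg1 \<open>degree (rest s) = degree h div s\<close> by linarith
  qed
  then have "pderiv (root_poly s) = 0" using pderiv_root_poly[OF s] by simp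
  then have "CHAR('a) dvd m a div s"
    unfolding root_poly_def using prod_linear_powers_pderiv_0[of A a] a by simp
  then show ?thesis using dvd[OF a] s0 by (auto elim!: dvdE simp: mult.assoc)
qed

text \<open>The excluded case of \<open>multiplicity_step\<close>: the polynomial is
  \<open>X^q - c X\<close>, which is separable since its derivative is the constant
  \<open>- c\<close>.\<close>

lemma multiplicity_one:
  assumes "h = - [:0, c:]" "a \<in> A" "e > 0"
  shows "m a = 1"
proof (rule ccontr)
  assume "m a \<noteq> 1"
  then have "2 \<le> m a" using m_pos[OF assms(2)] by simp
  then have "[:- a, 1:] ^ 2 dvd [:- a, 1:] ^ m a" by (rule le_imp_power_dvd)
  also have "\<dots> dvd monom 1 q + h" using assms(2) by (auto simp flip: prod_eq)
  finally obtain Q where Q: "monom 1 q + h = [:- a, 1:] ^ 2 * Q" by (elim dvdE)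
  have "pderiv (monom 1 q + h) = - [:c:]"
    using pderiv_monom_q[of 1 0] assms by (simp add: pderiv_add pderiv_minus pderiv_pCons)
  moreover have "poly (pderiv ([:- a, 1:] ^ 2 * Q)) a = 0"
    unfolding power2_eq_square mult.assoc pderiv_mult by simp
  ultimately show False using Q c_nonzero by simp
qed

lemma multiplicity_dvd:
  assumes r: "r = CHAR('a) ^ k" "k > 0" "q = r ^ 3" and h: "h \<noteq> - [:0, c:]" "degree h \<le> r ^ 2" and a: "a \<in> A"
  shows "r dvd m a"
proof -
  have r1: "r > 1" using r one_less_power[OF p_gt_1, of k] by simp
  have "q = CHAR('a) ^ (k * 3)" using r by (simp add: power_mult)
  then have e: "e = k * 3" using q_def p_gt_1 by (simp add: power_inject_exp)
  have "\<forall>a\<in>A. CHAR('a) ^ i dvd m a" if "i \<le> k" for i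
    using that
  proof (induction i)
    case (Suc i)
    define s where "s = CHAR('a) ^ i"
    have "i < k" "i < e" using Suc.prems e by auto
    define t where "t = CHAR('a) ^ (k - i)"
    have rst: "r = s * t" using \<open>i < k\<close> r by (simp add: s_def t_def flip: power_add)
    have t: "t \<ge> 2" using \<open>i < k\<close> p_gt_1 one_less_power[of "CHAR('a)" "k - i"] by (simp add: t_def)
    have s0: "s > 0" using p_gt_1 by (simp add: s_def)
    \<comment> \<open>As long as \<open>s < r\<close>, the factor \<open>t = r / s\<close> is at
      least \<open>2\<close>, so \<open>q / s\<close> is at least \<open>2 r^2\<close> and bounds
      \<open>degree h + degree h div s\<close>. This is why the climb reaches
      \<open>r\<close>.\<close>
    have "q div s = t * r ^ 2" using rst r(3) s0 by (simp add: power2_eq_square power3_eq_cube)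
    moreover have "degree h div s \<le> r ^ 2 div s" using h(2) by (rule div_le_mono)
    moreover have "r ^ 2 div s \<le> r ^ 2" by (rule div_le_dividend)
    moreover have "2 * r ^ 2 \<le> t * r ^ 2" using t by simp
    ultimately have "degree h + degree h div s \<le> q div s" using h(2) by linarith
    then have "s * CHAR('a) dvd m a" if "a \<in> A" for a
      using multiplicity_step[OF s_def \<open>i < e\<close>] Suc h(1) that by (auto simp: s_def)
    then show ?case by (simp add: s_def mult.commute)
  qed simp
  then show ?thesis using a r by simp
qed

section \<open>Split polynomials whose roots all have the same multiplicity \<open>s\<close>\<close>

context
  fixes s i :: nat
  assumes s_def: "s = CHAR('a) ^ i" and i_pos: "0 < i" and i_less: "i < e" and m_eq: "\<And>a. a \<in> A \<Longrightarrow> m a = s"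
begin

lemma s_facts: "s > 1" "s dvd q" "s * (q div s) = q" "q div s > 1"
proof -
  show s1: "s > 1" using s_def i_pos one_less_power[OF p_gt_1, of i] by simp
  show "s dvd q" using s_def i_less q_def by (simp add: le_imp_power_dvd)
  then show "s * (q div s) = q" by simp
  have "q div s = CHAR('a) ^ (e - i)"
    using s_def i_less q_def p_gt_1 by (simp add: power_diff)
  then show "q div s > 1" using i_less one_less_power[OF p_gt_1, of "e - i"] by simp
qed

lemma dvd_m: "a \<in> A \<Longrightarrow> s dvd m a"
  using m_eq by simp

lemmas s_props = s_def less_imp_le[OF i_less] dvd_m

lemma root_poly_s: "root_poly s = (\<Prod>a\<in>A. [:- a, 1:])"
  unfolding root_poly_def using m_eq s_facts(1) by (auto intro: prod.cong)

text \<open>With constant multiplicity the radical is \<open>root_poly s\<close> itself, so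
  \<open>radical_dvd\<close> becomes an equation between \<open>rest s\<close> and its own
  \<open>s\<close>-th power. The cofactor is nonzero: \<open>rest s ^ s\<close> has only exponents
  divisible by \<open>s\<close>, so the coefficient of \<open>X\<close> on the left is
  \<open>c\<close>.\<close>

lemma quotient_exists: "\<exists>k. k \<noteq> 0 \<and> rest s ^ s + [:0, c:] = k * (monom 1 (q div s) + rest s)"
proof -
  obtain k where k: "rest s ^ s + [:0, c:] = root_poly s * k"
    using radical_dvd[OF s_props] root_poly_s by (auto elim: dvdE)
  moreover have "k \<noteq> 0"
  proof
    assume "k = 0"
    then have "coeff (rest s ^ s + [:0, c:]) 1 = 0" using k by simp
    moreover have "coeff (rest s ^ s) 1 = 0"
      using s_facts(1) by (simp add: coeff_power_CHAR_power[OF prime_p s_def])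
    ultimately show False using c_nonzero by simp
  qed
  ultimately show ?thesis by (auto simp: root_poly_eq mult.commute)
qed

text \<open>The right-hand side has degree above \<open>1\<close>, so the degree on the left comes
  from \<open>rest s ^ s = h\<close> and not from \<open>c X\<close>. In particular
  \<open>degree h\<close> is at least \<open>q div s\<close>.\<close>

lemma quotient_degree:
  assumes "k \<noteq> 0" "rest s ^ s + [:0, c:] = k * (monom 1 (q div s) + rest s)"
  shows "degree h = q div s + degree k"
proof -
  have "degree (rest s ^ s + [:0, c:]) = degree k + q div s"
  proof -
    have "root_poly s \<noteq> 0" using degree_root_poly(1)[OF s_props] s_facts(4) by auto
    then show ?thesis
      using assms degree_root_poly(1)[OF s_props] degree_mult_eq[of k "root_poly s"]
      by (simp add: root_poly_eq)
  qed
  moreover have "rest s ^ s = h" by (rule rest_power[OF s_props])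
  ultimately have eq: "degree (h + [:0, c:]) = degree k + q div s" by simp
  then have "degree (h + [:0, c:]) > degree [:0, c:]" using s_facts(4) c_nonzero by simp
  then have "degree h > degree [:0, c:]"
    by (metis degree_add_le not_le order_refl le_cases)
  then have "degree (h + [:0, c:]) = degree h" by (rule degree_add_eq_left)
  then show ?thesis using eq by simp
qed

text \<open>At such an exponent neither \<open>rest s ^ s\<close>, nor \<open>c X\<close>, nor
  \<open>X^(q/s)\<close> contributes, so the constant cofactor times the coefficient of
  \<open>rest s\<close> must vanish.\<close>

lemma coeff_rest:
  assumes k: "k \<noteq> 0" "rest s ^ s + [:0, c:] = [:k:] * (monom 1 (q div s) + rest s)"
    and j: "j < q div s" "\<not> s dvd j"
  shows "j \<noteq> 1 \<Longrightarrow> coeff (rest s) j = 0"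
proof -
  assume j1: "j \<noteq> 1"
  have "coeff (rest s ^ s + [:0, c:]) j = coeff ([:k:] * (monom 1 (q div s) + rest s)) j"
    using k by simp
  moreover have "coeff (rest s ^ s) j = 0"
    using j by (simp add: coeff_power_CHAR_power[OF prime_p s_def])
  moreover have "coeff [:0, c:] j = 0" using j j1 by (cases j) (auto simp: coeff_pCons split: nat.split)
  ultimately show ?thesis using j k(1) by simp
qed

text \<open>The degree bound makes the cofactor constant, so \<open>degree h = s ^ 2\<close> and
  \<open>rest s\<close> has degree \<open>s\<close>. By \<open>coeff_rest\<close> only the exponents
  \<open>0\<close>, \<open>1\<close> and \<open>s\<close> survive: the radical is an affine
  linearised polynomial.\<close>

lemma additive_of_small_degree:
  assumes deg: "degree h \<le> q div s" and sq: "q div s = s ^ 2"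
  shows "degree h = s ^ 2"
    and "\<exists>x y z. (\<Prod>a\<in>A. [:- a, 1:]) = monom 1 (s ^ 2) + monom x s + [:z, y:]"
proof -
  obtain k where k: "k \<noteq> 0" "rest s ^ s + [:0, c:] = k * (monom 1 (q div s) + rest s)"
    using quotient_exists by auto
  have "degree k = 0" and h: "degree h = q div s" using quotient_degree[OF k] deg by auto
  then obtain k' where k': "k = [:k':]" "k' \<noteq> 0" using k(1) degree_eq_zeroE by (metis pCons_0_0)
  show "degree h = s ^ 2" using h sq by simp
  have "s * degree (rest s) = s * s" using degree_rest[OF s_props] h sq by (simp add: power2_eq_square)
  then have ds: "degree (rest s) = s" using s_facts(1) by simp
  have "s < s ^ 2" using s_facts(1) by (simp add: power2_eq_square)
  have "rest s = monom (coeff (rest s) s) s + [:coeff (rest s) 0, coeff (rest s) 1:]"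
  proof (rule poly_eqI)
    fix j
    consider "j = 0" | "j = 1" | "j = s" | "j > s" | "1 < j" "j < s" by linarith
    then show "coeff (rest s) j = coeff (monom (coeff (rest s) s) s + [:coeff (rest s) 0, coeff (rest s) 1:]) j"
    proof cases
      case 5
      then have "\<not> s dvd j" by (auto dest: dvd_imp_le)
      then have "coeff (rest s) j = 0"
        using 5 coeff_rest[OF k'(2), of j] k k'(1) sq \<open>s < s ^ 2\<close> by auto
      then show ?thesis using 5 by (auto simp: coeff_pCons split: nat.split)
    qed (use s_facts(1) ds in \<open>auto simp: coeff_pCons coeff_eq_0 split: nat.split\<close>)
  qed
  then show "\<exists>x y z. (\<Prod>a\<in>A. [:- a, 1:]) = monom 1 (s ^ 2) + monom x s + [:z, y:]"
    using root_poly_s root_poly_eq[of s] sq by (metis add.assoc)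
qed

text \<open>Comparing derivatives, the cofactor \<open>k\<close> has to be constant.\<close>

lemma square_of_few_directions:
  assumes s3: "s \<ge> 3" and deg: "degree h * (s - 1) \<le> q - s" and cube: "q < s ^ 3"
  shows "q = s ^ 2"
proof -
  obtain k where k: "k \<noteq> 0" "rest s ^ s + [:0, c:] = k * (monom 1 (q div s) + rest s)"
    using quotient_exists by auto
  define g where "g = rest s"
  define t where "t = q div s"
  have st: "s * t = q" "t > 1" using s_facts by (auto simp: t_def)
  have dh: "degree h = t + degree k" using quotient_degree[OF k] by (simp add: t_def)
  have dg: "s * degree g = degree h" using degree_rest[OF s_props] by (simp add: g_def)
  have "pderiv (g ^ s) = 0"
  proof -
    have "CHAR('a) dvd s" using s_def i_pos by simp
    then have "of_nat s = (0::'a)" by (simp add: of_nat_eq_0_iff_char_dvd)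
    then show ?thesis by (simp add: pderiv_power)
  qed
  then have "[:c:] = pderiv (g ^ s + [:0, c:])" by (simp add: pderiv_add pderiv_pCons)
  also have "\<dots> = pderiv (k * monom 1 t) + pderiv (k * g)"
    using k(2) by (simp add: g_def t_def distrib_left pderiv_add)
  also have "pderiv (k * monom 1 t) = monom 1 t * pderiv k"
    using pderiv_monom_q[OF s_def i_less] by (simp add: pderiv_mult t_def)
  finally have der: "[:c:] = monom 1 t * pderiv k + pderiv (k * g)" .
  \<comment> \<open>The factor \<open>s (s - 1)\<close> clears the denominators in
    \<open>degree g = degree h / s\<close> and in the bound on \<open>degree h\<close>. The strict
    inequality comes down to \<open>t (s - 3) + 2 s > 0\<close>, which is where \<open>s3\<close>
    enters and why \<open>u = s - 3\<close> is substituted.\<close>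
  have "(degree k + degree g) * (s * (s - 1)) < (t + 1) * (s * (s - 1))"
  proof -
    have "(degree k + degree g) * (s * (s - 1)) + t * (s * (s - 1)) = (s * degree h + s * degree g) * (s - 1)"
      by (simp add: dh algebra_simps)
    also have "\<dots> = (s + 1) * (degree h * (s - 1))" unfolding dg
      by (simp only: mult.assoc add_mult_distrib mult_1)
    also have "\<dots> \<le> (s + 1) * (q - s)" using deg by (intro mult_le_mono) auto
    also have "\<dots> < (2 * t + 1) * (s * (s - 1))"
    proof -
      obtain u where u: "s = u + 3" using s3 by (metis add.commute le_Suc_ex)
      have "int (q - s) = int s * (int t - 1)" using st by (auto simp flip: st(1) simp: of_nat_diff right_diff_distrib)
      then have "int ((s + 1) * (q - s)) = (int u + 4) * ((int u + 3) * (int t - 1))"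
        unfolding of_nat_mult by (simp add: u)
      also have "\<dots> < (2 * int t + 1) * ((int u + 3) * (int u + 2))"
      proof -
        have "(2 * int t + 1) * ((int u + 3) * (int u + 2)) - (int u + 4) * ((int u + 3) * (int t - 1))
          = (int u + 3) * (int t * int u + 2 * int u + 6)"
          by (simp add: algebra_simps)
        moreover have "(int u + 3) * (int t * int u + 2 * int u + 6) > 0"
          by (intro mult_pos_pos add_nonneg_pos) auto
        ultimately show ?thesis by linarith
      qed
      also have "\<dots> = int ((2 * t + 1) * (s * (s - 1)))" by (simp add: u algebra_simps)
      finally show ?thesis by linarith
    qed
    finally show ?thesis by (simp add: algebra_simps)
  qed
  then have "degree k + degree g < t + 1" by (simp only: mult_less_cancel2)
  then have kg: "degree k + degree g \<le> t" by simp
  \<comment> \<open>Otherwise \<open>X^t k'\<close> has degree at least \<open>t\<close> and cannot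
    be cancelled to a constant by \<open>(k g)'\<close>, whose degree is at most
    \<open>t - 1\<close>.\<close>
  have "pderiv k = 0"
  proof (rule ccontr)
    assume nz: "pderiv k \<noteq> 0"
    have "degree (pderiv (k * g)) \<le> degree (k * g) - 1" by (rule degree_pderiv_le)
    also have "\<dots> \<le> t - 1" using kg degree_mult_le[of k g] by linarith
    also have "\<dots> < t" using st by simp
    also have "t \<le> degree (monom 1 t * pderiv k)"
      using nz by (simp add: degree_mult_eq degree_monom_eq)
    finally have "degree [:c:] = degree (monom 1 t * pderiv k)"
      unfolding der by (rule degree_add_eq_left)
    moreover have "t \<le> degree (monom 1 t * pderiv k)"
      using nz by (simp add: degree_mult_eq degree_monom_eq)
    ultimately show False using st by simp
  qed
  then have "[:c:] = k * pderiv g" using der by (simp add: pderiv_mult)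
  then have "degree k + degree (pderiv g) = 0"
    using degree_mult_eq[of k "pderiv g"] c_nonzero k(1) by (metis degree_pCons_0 mult_zero_right pCons_eq_0_iff)
  then have "degree k = 0" by simp
  then obtain k' where k': "k = [:k':]" "k' \<noteq> 0" using k(1) degree_eq_zeroE by (metis pCons_0_0)
  \<comment> \<open>Now \<open>degree g = t / s < s\<close> by \<open>cube\<close>, and the only
    exponent strictly between \<open>0\<close> and \<open>s\<close> allowed by
    \<open>coeff_rest\<close> is \<open>1\<close>. So \<open>degree g = 1\<close>, that is
    \<open>t = s\<close>.\<close>
  have sdg: "s * degree g = t" using dg dh \<open>degree k = 0\<close> by simp
  have "s * (s * degree g) < s * (s * s)" using sdg st cube by (simp add: power3_eq_cube)
  then have lt: "degree g < s" by simp
  have pos: "degree g > 0" using sdg st by (cases "degree g") auto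
  have "degree g = 1"
  proof (rule ccontr)
    assume "degree g \<noteq> 1"
    moreover have "degree g < q div s" using lt sdg pos t_def s_facts(1) by (metis degree_root_poly(2) g_def s_props)
    moreover have "\<not> s dvd degree g" using lt pos by (auto dest: dvd_imp_le)
    ultimately have "coeff g (degree g) = 0"
      using coeff_rest[OF k'(2), of "degree g"] k k'(1) by (simp add: g_def)
    then show False using pos by auto
  qed
  then show ?thesis using sdg st by (simp add: power2_eq_square)
qed

end

end

section \<open>The Redei polynomial of a set with few directions\<close>

definition dirs :: "nat \<Rightarrow> 'a::field set \<Rightarrow> 'a set" where
  "dirs q A = {dir q (x - y) | x y. x \<in> A \<and> y \<in> A \<and> x \<noteq> y}"

text \<open>A polynomial over polynomials is read as bivariate, with outer variable \<open>X\<close>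
  and the direction as inner variable; this substitutes \<open>z\<close> for the direction and keeps
  \<open>X\<close>.\<close>

definition eval_coeffs :: "'a::comm_semiring_0 \<Rightarrow> 'a poly poly \<Rightarrow> 'a poly" where
  "eval_coeffs z P = map_poly (\<lambda>p. poly p z) P"

lemma coeff_eval_coeffs: "coeff (eval_coeffs z P) j = poly (coeff P j) z"
  by (simp add: eval_coeffs_def coeff_map_poly)

lemma eval_coeffs_mult:
  "eval_coeffs z (P * Q) = eval_coeffs z P * eval_coeffs z (Q :: 'a::comm_ring_1 poly poly)"
  by (rule poly_eqI) (simp add: coeff_eval_coeffs coeff_mult poly_sum)

lemma eval_coeffs_1: "eval_coeffs z (1 :: 'a::comm_ring_1 poly poly) = 1"
  by (rule poly_eqI) (simp add: coeff_eval_coeffs)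

lemma eval_coeffs_linear: "eval_coeffs z [:- f, 1:] = [:- poly f z, 1 :: 'a::comm_ring_1:]"
  by (rule poly_eqI) (simp add: coeff_eval_coeffs coeff_pCons split: nat.split)

lemma eval_coeffs_prod:
  "eval_coeffs z (\<Prod>u\<in>A. f u) = (\<Prod>u\<in>A. eval_coeffs z (f u :: 'a::comm_ring_1 poly poly))"
  by (induction A rule: infinite_finite_induct) (auto simp: eval_coeffs_mult eval_coeffs_1)

text \<open>Up to sign, the coefficient of \<open>X^j\<close> is the elementary symmetric polynomial
  of degree \<open>card A - j\<close> in the linear polynomials \<open>l u\<close>.\<close>

lemma degree_coeff_prod_linear:
  fixes l :: "'b \<Rightarrow> 'a::idom poly"
  assumes "finite A" "\<And>u. u \<in> A \<Longrightarrow> degree (l u) \<le> 1"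
  shows "degree (coeff (\<Prod>u\<in>A. [:- l u, 1:]) j) \<le> card A - j"
    and "j > card A \<Longrightarrow> coeff (\<Prod>u\<in>A. [:- l u, 1:]) j = 0"
proof -
  have "\<forall>j. degree (coeff (\<Prod>u\<in>A. [:- l u, 1:]) j) \<le> card A - j \<and>
    (j > card A \<longrightarrow> coeff (\<Prod>u\<in>A. [:- l u, 1:]) j = 0)"
    using assms
  proof (induction A)
    case empty
    then show ?case by (auto simp: coeff_1 split: if_splits)
  next
    case (insert u A)
    define P where "P = (\<Prod>u\<in>A. [:- l u, 1:])"
    have IH: "degree (coeff P j) \<le> card A - j" "j > card A \<Longrightarrow> coeff P j = 0" for j
      using insert by (auto simp: P_def)
    have c: "coeff (\<Prod>u\<in>insert u A. [:- l u, 1:]) j = - (l u * coeff P j) + (case j of 0 \<Rightarrow> 0 | Suc i \<Rightarrow> coeff P i)" for j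
      using insert.hyps by (simp add: P_def coeff_pCons split: nat.split)
    have "degree (l u * coeff P j) \<le> Suc (card A) - j" for j
    proof (cases "j > card A")
      case True
      then show ?thesis using IH(2) by simp
    next
      case False
      have "degree (l u * coeff P j) \<le> degree (l u) + degree (coeff P j)" by (rule degree_mult_le)
      also have "\<dots> \<le> 1 + (card A - j)" using IH(1)[of j] insert.prems[of u] by auto
      finally show ?thesis using False by simp
    qed
    moreover have "degree (case j of 0 \<Rightarrow> 0 | Suc i \<Rightarrow> coeff P i) \<le> Suc (card A) - j" for j
      using IH(1) by (cases j) auto
    ultimately have "degree (coeff (\<Prod>u\<in>insert u A. [:- l u, 1:]) j) \<le> Suc (card A) - j" for j
      unfolding c by (intro degree_add_le) auto
    moreover have "coeff (\<Prod>u\<in>insert u A. [:- l u, 1:]) j = 0" if "j > Suc (card A)" for j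
      unfolding c using that IH(2) by (auto split: nat.split)
    ultimately show ?case using insert.hyps by simp
  qed
  then show "degree (coeff (\<Prod>u\<in>A. [:- l u, 1:]) j) \<le> card A - j"
    and "j > card A \<Longrightarrow> coeff (\<Prod>u\<in>A. [:- l u, 1:]) j = 0" by auto
qed

lemma monic_prod_linear:
  fixes f :: "'b \<Rightarrow> 'a::idom"
  assumes "finite A"
  shows "degree (\<Prod>u\<in>A. [:- f u, 1:]) = card A" and "coeff (\<Prod>u\<in>A. [:- f u, 1:]) (card A) = 1"
proof -
  show deg: "degree (\<Prod>u\<in>A. [:- f u, 1:]) = card A"
    by (subst degree_prod_eq_sum_degree) auto
  have "lead_coeff (\<Prod>u\<in>A. [:- f u, 1:]) = 1" by (simp add: lead_coeff_prod)
  then show "coeff (\<Prod>u\<in>A. [:- f u, 1:]) (card A) = 1" using deg by simp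
qed

lemma order_prod:
  fixes f :: "'b \<Rightarrow> 'a::idom poly"
  assumes "finite A" "\<And>u. u \<in> A \<Longrightarrow> f u \<noteq> 0"
  shows "order z (\<Prod>u\<in>A. f u) = (\<Sum>u\<in>A. order z (f u))"
  using assms by (induction A) (auto simp: order_mult)

lemma prod_fibres:
  fixes g :: "'b \<Rightarrow> 'c::comm_monoid_mult"
  assumes "finite A"
  shows "(\<Prod>u\<in>A. g (f u)) = (\<Prod>v\<in>f ` A. g v ^ card {u \<in> A. f u = v})"
proof -
  have "(\<Prod>u\<in>A. g (f u)) = (\<Prod>v\<in>f ` A. \<Prod>u\<in>{u \<in> A. f u = v}. g (f u))"
    by (rule prod.image_gen[OF assms])
  also have "\<dots> = (\<Prod>v\<in>f ` A. g v ^ card {u \<in> A. f u = v})"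
    by (intro prod.cong refl) simp
  finally show ?thesis .
qed

lemma poly_eq_0_of_roots:
  fixes f :: "'a::idom poly"
  assumes "finite A" "\<And>x. x \<in> A \<Longrightarrow> poly f x = 0" "degree f < card A"
  shows "f = 0"
proof (rule ccontr)
  assume f: "f \<noteq> 0"
  have "card A \<le> card {x. poly f x = 0}"
    by (rule card_mono) (use assms f poly_roots_finite in auto)
  then show False using card_poly_roots_bound[OF f] assms(3) by simp
qed

section \<open>Directions and projections in the affine plane over \<open>K\<close>\<close>

context cubic_field
begin

text \<open>\<open>dir q u\<close> determines the line \<open>K u\<close>, and \<open>proj z\<close> is a projection along the lines of direction
  \<open>z\<close> onto a line over \<open>K\<close>. In contrast to slopes in affine coordinates, this treats all \<open>q + 1\<close>
  directions alike, with no direction at infinity.\<close>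

definition proj :: "'a \<Rightarrow> 'a \<Rightarrow> 'a" where
  "proj z u = u ^ q - u * z"

definition all_dirs :: "'a set" where
  "all_dirs = dir q ` (- {0})"

lemma proj_diff: "proj z (u - v) = proj z u - proj z v"
  by (simp add: proj_def power_q_diff algebra_simps)

lemma proj_add: "proj z (u + v) = proj z u + proj z v"
  by (simp add: proj_def power_q_add algebra_simps)

lemma proj_0 [simp]: "proj z 0 = 0"
  using q_gt_1 by (simp add: proj_def)

lemma proj_scale: "k \<in> K \<Longrightarrow> proj z (k * u) = k * proj z u"
  by (simp add: proj_def power_mult_distrib K_iff algebra_simps)

lemma power_q_dir: "u ^ q = u * dir q u"
  using q_gt_1 by (simp add: dir_def flip: power_Suc)

lemma proj_eq_0_iff: "proj z u = 0 \<longleftrightarrow> u = 0 \<or> dir q u = z"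
proof -
  have "proj z u = u * (dir q u - z)" by (simp add: proj_def power_q_dir algebra_simps)
  then show ?thesis by simp
qed

lemma dir_scale: "k \<in> K \<Longrightarrow> k \<noteq> 0 \<Longrightarrow> dir q (k * u) = dir q u"
proof -
  assume k: "k \<in> K" "k \<noteq> 0"
  then have "k * k ^ (q - 1) = k * 1" using q_gt_1 by (simp add: K_iff flip: power_Suc)
  then have "k ^ (q - 1) = 1" using k by simp
  then show ?thesis by (simp add: dir_def power_mult_distrib)
qed

lemma dir_eq_iff:
  assumes "u \<noteq> 0" "v \<noteq> 0"
  shows "dir q u = dir q v \<longleftrightarrow> u / v \<in> K"
proof
  assume "dir q u = dir q v"
  then have "(u / v) ^ q = u / v"
    using assms by (simp add: power_divide power_q_dir dir_def)
  then show "u / v \<in> K" by (simp add: K_iff)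
next
  assume "u / v \<in> K"
  then show "dir q u = dir q v" using dir_scale[of "u / v" v] assms by simp
qed

lemma card_nonzero_K: "card (K - {0}) = q - 1"
  by (simp add: card_K card_Diff_subset)

lemma card_all_dirs: "card all_dirs = q + 1"
proof -
  have "card (- {0::'a}) = card all_dirs * (q - 1)"
    unfolding all_dirs_def
  proof (rule card_eq_card_image_times_fibre)
    fix x :: 'a assume x: "x \<in> - {0}"
    have "bij_betw (\<lambda>k. k * x) (K - {0}) {y \<in> - {0}. dir q y = dir q x}"
      by (rule bij_betwI[where g = "\<lambda>y. y / x"]) (use x dir_eq_iff dir_scale in auto)
    then show "card {y \<in> - {0}. dir q y = dir q x} = q - 1"
      using bij_betw_same_card card_nonzero_K by fastforce
  qed simp
  moreover have "card (- {0::'a}) = q ^ 2 - 1" by (simp add: Compl_eq_Diff_UNIV card_Diff_subset card_UNIV)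
  moreover have "q ^ 2 - 1 = (q + 1) * (q - 1)" by (simp add: algebra_simps power2_eq_square)
  ultimately have "card all_dirs * (q - 1) = (q + 1) * (q - 1)" by metis
  then show ?thesis using q_gt_1 by (simp only: mult_cancel2) simp
qed

lemma dir_power: "u \<noteq> 0 \<Longrightarrow> dir q (u :: 'a) ^ (q + 1) = 1"
proof -
  assume u: "u \<noteq> (0 :: 'a)"
  define d where "d = dir q u"
  have ud: "u ^ q = u * d" unfolding d_def by (rule power_q_dir)
  have "u = (u * d) ^ q" using power_q_q[of u] unfolding ud by simp
  also have "\<dots> = u * (d * d ^ q)" by (simp add: power_mult_distrib ud)
  finally have "u * (d ^ (q + 1)) = u * 1" by simp
  then show ?thesis using u by (simp add: d_def)
qed

lemma all_dirs_nonzero: "z \<in> all_dirs \<Longrightarrow> z \<noteq> 0"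
  using dir_power q_gt_1 by (force simp: all_dirs_def)

text \<open>A direction has norm one, so \<open>z ^ q = inverse z\<close>. The image of
  \<open>proj z\<close> thus lies on the line \<open>v^q = - v / z\<close> over \<open>K\<close>,
  which supplies the assumption \<open>root\<close> of \<open>lacunary_split\<close> with
  \<open>c = - inverse z\<close>.\<close>

lemma proj_power_q:
  assumes "z \<in> all_dirs"
  shows "proj z u ^ q = - inverse z * proj z u"
proof -
  have "z * z ^ q = 1" using assms dir_power by (auto simp: all_dirs_def)
  then have "z ^ q = inverse z" using inverse_unique by metis
  then show ?thesis using all_dirs_nonzero[OF assms]
    by (simp add: proj_def power_q_diff power_q_q power_mult_distrib field_simps)
qed

lemma dirs_subset: "dirs q A \<subseteq> all_dirs"
  by (auto simp: dirs_def all_dirs_def)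

lemma dirs_iff:
  "z \<in> dirs q A \<longleftrightarrow> z \<in> all_dirs \<and> \<not> inj_on (proj z) A"
proof
  assume "z \<in> dirs q A"
  then obtain x y where "x \<in> A" "y \<in> A" "x \<noteq> y" "z = dir q (x - y)" by (auto simp: dirs_def)
  then show "z \<in> all_dirs \<and> \<not> inj_on (proj z) A"
    using proj_eq_0_iff[of z "x - y"] by (auto simp: proj_diff inj_on_def all_dirs_def)
next
  assume "z \<in> all_dirs \<and> \<not> inj_on (proj z) A"
  then obtain x y where "x \<in> A" "y \<in> A" "x \<noteq> y" "proj z x = proj z y" by (auto simp: inj_on_def)
  then show "z \<in> dirs q A"
    using proj_eq_0_iff[of z "x - y"] by (auto simp: proj_diff dirs_def)
qed

text \<open>The projection \<open>proj z u\<close> as a polynomial in \<open>z\<close>, so that the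
  Redei polynomial treats all directions at once.\<close>

definition lin :: "'a \<Rightarrow> 'a poly" where
  "lin u = [:u ^ q, - u:]"

lemma poly_lin: "poly (lin u) z = proj z u"
  by (simp add: lin_def proj_def algebra_simps)

lemma lin_diff: "lin u - lin v = lin (u - v)"
  by (simp add: lin_def power_q_diff)

lemma order_lin:
  assumes "u \<noteq> 0"
  shows "order z (lin u) = (if dir q u = z then 1 else 0)"
proof (cases "dir q u = z")
  case True
  then have "lin u = smult (- u) [:- z, 1:]" by (simp add: lin_def power_q_dir)
  then show ?thesis using assms True order_power_n_n[of z 1] by (simp add: order_smult del: smult_pCons)
next
  case False
  then have "poly (lin u) z \<noteq> 0" using assms by (simp add: poly_lin proj_eq_0_iff)
  then show ?thesis using False by (simp add: order_0I)
qed

end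

text \<open>A set of \<open>q\<close> points with a single direction is a line, so
  \<open>many\<close> says that \<open>U\<close> is not a line.\<close>

locale few_directions = cubic_field K q r
  for K :: "'a::{field,finite} set" and q r :: nat +
  fixes U :: "'a set"
  assumes card_U: "card U = q" and few: "card (dirs q U) \<le> r ^ 2 + 1" and many: "card (dirs q U) \<ge> 2"
begin

definition redei :: "'a poly poly" where
  "redei = (\<Prod>u\<in>U. [:- lin u, 1:])"

abbreviation "N \<equiv> card (dirs q U)"

definition redei_at :: "'a \<Rightarrow> 'a poly" where
  "redei_at z = (\<Prod>u\<in>U. [:- proj z u, 1:])"

lemma coeff_redei_at: "coeff (redei_at z) j = poly (coeff redei j) z"
  by (simp add: redei_def redei_at_def eval_coeffs_prod eval_coeffs_linear poly_lin
      flip: coeff_eval_coeffs)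

lemma degree_coeff_redei: "degree (coeff redei j) \<le> q - j"
proof -
  have "degree (coeff redei j) \<le> card U - j"
    unfolding redei_def by (rule degree_coeff_prod_linear) (auto simp: lin_def)
  then show ?thesis by (simp add: card_U)
qed

lemma N_less_q: "N < q"
proof -
  have "r ^ 2 + r ^ 2 \<le> r * r ^ 2" using mult_le_mono1[of 2 r "r ^ 2"] r_gt_1 by (simp add: mult_2)
  moreover have "r ^ 2 > 1" using r_less_r2 r_gt_1 by linarith
  ultimately show ?thesis using few q_eq by (simp add: power2_eq_square power3_eq_cube)
qed

text \<open>Here \<open>proj z\<close> is injective on \<open>U\<close>, so its \<open>q\<close>
  values are all the solutions of \<open>v^q = - v / z\<close>; both sides are monic of degree
  \<open>q\<close> with the same roots.\<close>

lemma redei_at_undetermined: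
  assumes "z \<in> all_dirs - dirs q U"
  shows "redei_at z = monom 1 q + monom (inverse z) 1"
proof -
  have inj: "inj_on (proj z) U" using assms dirs_iff by auto
  define f where "f = monom 1 q + monom (inverse z) 1 - redei_at z"
  have c: "coeff f j = 0" if "j \<ge> q" for j
  proof (cases "j = q")
    case True
    then show ?thesis using monic_prod_linear(2)[of U "proj z"] q_gt_1 card_U
      by (simp add: f_def redei_at_def)
  next
    case False
    then have "coeff (redei_at z) j = 0"
      using monic_prod_linear(1)[of U "proj z"] card_U that by (intro coeff_eq_0) (simp add: redei_at_def)
    then show ?thesis using False that q_gt_1 by (simp add: f_def)
  qed
  have "degree f < q"
  proof (rule ccontr)
    assume "\<not> degree f < q"
    then have "lead_coeff f = 0" using c by simp
    then have "f = 0" by simp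
    then show False using \<open>\<not> degree f < q\<close> q_gt_1 by simp
  qed
  moreover have "card (proj z ` U) = q" using inj card_U by (simp add: card_image)
  moreover have "poly f v = 0" if v: "v \<in> proj z ` U" for v
  proof -
    have "poly (redei_at z) v = 0" using v by (auto simp: redei_at_def poly_prod intro!: bexI)
    moreover have "v ^ q = - inverse z * v" using v proj_power_q assms by auto
    ultimately show ?thesis by (simp add: f_def poly_monom)
  qed
  ultimately have "f = 0" using poly_eq_0_of_roots[of "proj z ` U" f] by simp
  then show ?thesis by (simp add: f_def)
qed

text \<open>As a polynomial in the direction, this coefficient has degree at most
  \<open>q - j\<close> but vanishes at all \<open>q + 1 - N\<close> undetermined directions.\<close>

lemma coeff_redei_high:
  assumes "N \<le> j" "j < q"
  shows "coeff redei j = 0"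
proof (rule poly_eq_0_of_roots[of "all_dirs - dirs q U"])
  have "card (all_dirs - dirs q U) = q + 1 - N"
    using card_all_dirs dirs_subset by (simp add: card_Diff_subset)
  then show "degree (coeff redei j) < card (all_dirs - dirs q U)"
    using degree_coeff_redei[of j] assms by linarith
  \<comment> \<open>Since \<open>N\<close> is at least \<open>2\<close>, the exponent
    \<open>j\<close> is never \<open>1\<close>, where \<open>redei_at_undetermined\<close> has the
    nonzero coefficient \<open>inverse z\<close>.\<close>
  show "poly (coeff redei j) z = 0" if "z \<in> all_dirs - dirs q U" for z
    using that assms many by (simp add: redei_at_undetermined flip: coeff_redei_at)
qed simp

definition redei_tail :: "'a \<Rightarrow> 'a poly" where
  "redei_tail z = redei_at z - monom 1 q"

lemma degree_redei_tail: "degree (redei_tail z) \<le> N - 1"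
proof (rule degree_le, safe)
  fix j assume j: "j > N - 1"
  consider "j < q" | "j = q" | "j > q" by linarith
  then show "coeff (redei_tail z) j = 0"
  proof cases
    case 1
    then show ?thesis using coeff_redei_high[of j] j by (simp add: redei_tail_def coeff_redei_at)
  next
    case 2
    then show ?thesis using monic_prod_linear(2)[of U "proj z"] card_U
      by (simp add: redei_tail_def redei_at_def)
  next
    case 3
    then have "coeff (redei_at z) j = 0"
      using monic_prod_linear(1)[of U "proj z"] card_U by (intro coeff_eq_0) (simp add: redei_at_def)
    then show ?thesis using 3 by (simp add: redei_tail_def)
  qed
qed

definition mult_at :: "'a \<Rightarrow> 'a \<Rightarrow> nat" where
  "mult_at z v = card {u \<in> U. proj z u = v}"

definition q_exponent :: nat where
  "q_exponent = (SOME e. q = CHAR('a) ^ e)"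

lemma q_power: "q = CHAR('a) ^ q_exponent"
proof -
  obtain k where "r = CHAR('a) ^ k" using r_prime_power by auto
  then have "q = CHAR('a) ^ (k * 3)" using q_eq by (simp add: power_mult)
  then show ?thesis unfolding q_exponent_def by (rule someI)
qed

lemma lacunary_split_at:
  assumes "z \<in> all_dirs"
  shows "lacunary_split (proj z ` U) (mult_at z) (- inverse z) q q_exponent (redei_tail z)"
proof
  show "q = CHAR('a) ^ q_exponent" by (rule q_power)
  show "mult_at z v > 0" if "v \<in> proj z ` U" for v
    using that by (auto simp: mult_at_def card_gt_0_iff)
  show "(\<Prod>v\<in>proj z ` U. [:- v, 1:] ^ mult_at z v) = monom 1 q + redei_tail z"
    using prod_fibres[of U "\<lambda>v. [:- v, 1:]" "proj z"] by (simp add: redei_tail_def redei_at_def mult_at_def)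
  show "degree (redei_tail z) < q" using degree_redei_tail[of z] N_less_q by linarith
  show "- inverse z \<noteq> 0" using all_dirs_nonzero[OF assms] by simp
  show "v ^ q = - inverse z * v" if "v \<in> proj z ` U" for v
    using that proj_power_q[OF assms] by auto
qed

text \<open>Two points of \<open>U\<close> with the same projection give a multiplicity above one,
  so the tail is not the exceptional one of \<open>multiplicity_one\<close> and
  \<open>multiplicity_dvd\<close> applies.\<close>

lemma mult_at_dvd:
  assumes z: "z \<in> dirs q U" and v: "v \<in> proj z ` U"
  shows "r dvd mult_at z v"
proof -
  have z': "z \<in> all_dirs" "\<not> inj_on (proj z) U" using z dirs_iff by auto
  interpret lacunary_split "proj z ` U" "mult_at z" "- inverse z" q q_exponent "redei_tail z"
    by (rule lacunary_split_at[OF z'(1)])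
  obtain k where k: "r = CHAR('a) ^ k" "k > 0" using r_prime_power by auto
  have "q_exponent > 0" using q_power q_gt_1 by (metis gr0I nat_less_le power_0)
  obtain x y where xy: "x \<in> U" "y \<in> U" "x \<noteq> y" "proj z x = proj z y"
    using z'(2) by (auto simp: inj_on_def)
  have "card {x, y} \<le> mult_at z (proj z x)"
    unfolding mult_at_def by (rule card_mono) (use xy in auto)
  then have "mult_at z (proj z x) \<noteq> 1" using xy by simp
  then have "redei_tail z \<noteq> - [:0, - inverse z:]"
    using multiplicity_one[of "proj z x"] xy \<open>q_exponent > 0\<close> by auto
  moreover have "degree (redei_tail z) \<le> r ^ 2" using degree_redei_tail[of z] few by simp
  ultimately show ?thesis using multiplicity_dvd[OF k q_eq _ _ v] by simp
qed

text \<open>In a determined direction the specialised polynomial is an \<open>r\<close>-th power, in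
  any other it has only the exponents \<open>q\<close> and \<open>1\<close>. So the coefficient
  vanishes in all \<open>q + 1\<close> directions, more than its degree allows.\<close>

lemma coeff_redei_not_dvd:
  assumes "\<not> r dvd j" "j \<noteq> 1"
  shows "coeff redei j = 0"
proof (rule poly_eq_0_of_roots[of all_dirs])
  show "degree (coeff redei j) < card all_dirs"
    using degree_coeff_redei[of j] card_all_dirs by linarith
next
  fix z assume z: "z \<in> all_dirs"
  have "coeff (redei_at z) j = 0"
  proof (cases "z \<in> dirs q U")
    case False
    have "j \<noteq> q" using assms q_eq by auto
    then show ?thesis using False z assms by (simp add: redei_at_undetermined)
  next
    case True
    obtain k where k: "r = CHAR('a) ^ k" using r_prime_power by auto
    have "redei_at z = (\<Prod>v\<in>proj z ` U. [:- v, 1:] ^ mult_at z v)"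
      using prod_fibres[of U "\<lambda>v. [:- v, 1:]" "proj z"] by (simp add: redei_at_def mult_at_def)
    also have "\<dots> = (\<Prod>v\<in>proj z ` U. [:- v, 1:] ^ (mult_at z v div r)) ^ r"
      using mult_at_dvd[OF True] by (auto simp: prod_power_distrib simp flip: power_mult intro!: prod.cong)
    finally show ?thesis
      using coeff_power_CHAR_power[OF prime_CHAR_finite k] assms(1) by simp
  qed
  then show "poly (coeff redei j) z = 0" by (simp add: coeff_redei_at)
qed simp

text \<open>The \<open>X\<close>-derivative of the Redei polynomial is free of \<open>X\<close>; evaluating it at each of its
  roots shows that all points of \<open>U\<close> see the same number of points in a given direction.\<close>

lemma pderiv_redei: "pderiv redei = [:coeff redei 1:]"
proof (rule poly_eqI)
  fix n
  show "coeff (pderiv redei) n = coeff [:coeff redei 1:] n"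
  proof (cases n)
    case 0
    then show ?thesis by (simp add: coeff_pderiv)
  next
    case (Suc m)
    have "of_nat (Suc n) * coeff redei (Suc n) = 0"
    proof (cases "r dvd Suc n")
      case True
      obtain k where "r = CHAR('a) ^ k" "k > 0" using r_prime_power by auto
      then have "CHAR('a) dvd Suc n" using True by (meson dvd_power dvd_trans)
      then have "of_nat (Suc n) = (0 :: 'a poly)"
        using of_nat_eq_0_iff_char_dvd[where 'a = "'a poly"] by (simp del: of_nat_Suc)
      then show ?thesis by (simp only: mult_zero_left)
    next
      case False
      then show ?thesis using coeff_redei_not_dvd[of "Suc n"] Suc by simp
    qed
    then show ?thesis using Suc by (simp add: coeff_pderiv coeff_pCons)
  qed
qed

lemma coeff_redei_1:
  assumes "u \<in> U"
  shows "coeff redei 1 = (\<Prod>v\<in>U - {u}. lin (u - v))"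
proof -
  have "redei = [:- lin u, 1:] * (\<Prod>v\<in>U - {u}. [:- lin v, 1:])"
    unfolding redei_def using assms by (intro prod.remove) auto
  then have "pderiv redei = [:- lin u, 1:] * pderiv (\<Prod>v\<in>U - {u}. [:- lin v, 1:]) + (\<Prod>v\<in>U - {u}. [:- lin v, 1:])"
    by (simp only: pderiv_mult) (simp add: pderiv_pCons)
  then have "poly (pderiv redei) (lin u) = (\<Prod>v\<in>U - {u}. lin u - lin v)"
    by (simp add: poly_prod)
  then show ?thesis by (simp add: pderiv_redei lin_diff)
qed

text \<open>The number of points of \<open>U\<close> on every line of direction \<open>z\<close>
  that meets \<open>U\<close>. Defined as an order of vanishing, it visibly does not depend on the
  line; the added \<open>1\<close> accounts for the base point of the product in
  \<open>coeff_redei_1\<close>.\<close>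

definition weight :: "'a \<Rightarrow> nat" where
  "weight z = order z (coeff redei 1) + 1"

lemma card_same_direction:
  assumes "u \<in> U"
  shows "card {v \<in> U - {u}. dir q (u - v) = z} = weight z - 1"
proof -
  have "order z (coeff redei 1) = (\<Sum>v\<in>U - {u}. order z (lin (u - v)))"
    unfolding coeff_redei_1[OF assms] by (rule order_prod) (auto simp: lin_def)
  also have "\<dots> = (\<Sum>v\<in>U - {u}. if dir q (u - v) = z then 1 else 0)"
    by (rule sum.cong) (auto simp: order_lin)
  also have "\<dots> = card {v \<in> U - {u}. dir q (u - v) = z}"
    by (simp add: sum.If_cases Int_def)
  finally show ?thesis by (simp add: weight_def)
qed

lemma mult_at_eq_weight:
  assumes "v \<in> proj z ` U"
  shows "mult_at z v = weight z"
proof -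
  obtain u where u: "u \<in> U" "v = proj z u" using assms by auto
  have "{w \<in> U. proj z w = v} = insert u {w \<in> U - {u}. dir q (u - w) = z}"
  proof -
    have "proj z w = proj z u \<longleftrightarrow> w = u \<or> dir q (u - w) = z" for w
      using proj_eq_0_iff[of z "u - w"] proj_diff[of z u w] by auto
    then show ?thesis using u by auto
  qed
  then have "mult_at z v = Suc (card {w \<in> U - {u}. dir q (u - w) = z})"
    by (simp add: mult_at_def)
  then show ?thesis using card_same_direction[OF u(1)] by (simp add: weight_def)
qed

lemma U_nonempty: "U \<noteq> {}"
  using card_U q_gt_1 by auto

lemma q_eq_card_proj: "q = card (proj z ` U) * weight z"
proof -
  have "card U = card (proj z ` U) * weight z"
    by (rule card_eq_card_image_times_fibre) (use mult_at_eq_weight in \<open>auto simp: mult_at_def\<close>)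
  then show ?thesis by (simp add: card_U)
qed

lemma weight_power: "\<exists>i\<le>q_exponent. weight z = CHAR('a) ^ i"
proof -
  have "weight z dvd CHAR('a) ^ q_exponent" using q_eq_card_proj[of z] q_power by (metis dvd_triv_right)
  then show ?thesis using divides_primepow_nat[OF prime_CHAR_finite] by blast
qed

lemma weight_dvd: "z \<in> dirs q U \<Longrightarrow> r dvd weight z"
  using mult_at_dvd[of z] mult_at_eq_weight[of _ z] U_nonempty by fastforce

lemma weight_ge: "z \<in> dirs q U \<Longrightarrow> weight z \<ge> r"
  using weight_dvd dvd_imp_le by (auto simp: weight_def)

lemma weight_gt: "z \<in> dirs q U \<Longrightarrow> weight z \<noteq> r \<Longrightarrow> weight z \<ge> 2 * r"
proof -
  assume z: "z \<in> dirs q U" "weight z \<noteq> r"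
  obtain k where k: "weight z = r * k" using weight_dvd[OF z(1)] by auto
  moreover have "weight z > 0" by (simp add: weight_def)
  ultimately have "k \<noteq> 0" "k \<noteq> 1" using z by auto
  then have "k \<ge> 2" by simp
  then show ?thesis using k by (metis mult.commute mult_le_mono1)
qed

section \<open>Distribution of the weights over the determined directions\<close>

lemma sum_weights: "(\<Sum>z\<in>dirs q U. weight z - 1) = q - 1"
proof -
  obtain u where u: "u \<in> U" using U_nonempty by auto
  have "card (U - {u}) = (\<Sum>z\<in>dirs q U. card {v \<in> U - {u}. dir q (u - v) = z})"
  proof -
    have "(\<lambda>v. dir q (u - v)) ` (U - {u}) \<subseteq> dirs q U" using u by (auto simp: dirs_def)
    then show ?thesis
      using sum.group[of "U - {u}" "dirs q U" "\<lambda>v. dir q (u - v)" "\<lambda>_. 1::nat"] by simp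
  qed
  also have "card (U - {u}) = q - 1" using u card_U by simp
  finally show ?thesis using card_same_direction[OF u] by simp
qed

lemma sum_weights_int: "(\<Sum>z\<in>dirs q U. int (weight z) - 1) = int q - 1"
proof -
  have "int (\<Sum>z\<in>dirs q U. weight z - 1) = (\<Sum>z\<in>dirs q U. int (weight z) - 1)"
    by (simp add: weight_def)
  moreover have "int (q - 1) = int q - 1" using q_gt_1 by simp
  ultimately show ?thesis unfolding sum_weights by metis
qed

lemma r_cubed_not_square: "r ^ 3 \<noteq> s ^ 2"
proof
  assume eq: "r ^ 3 = s ^ 2"
  have "r ^ 2 dvd s ^ 2" by (metis eq dvd_triv_left mult.commute power2_eq_square power3_eq_cube)
  then obtain t where t: "s = r * t" by (auto simp: elim: dvdE)
  have "r ^ 2 * r = r ^ 2 * t ^ 2" using eq t by (simp add: power2_eq_square power3_eq_cube algebra_simps)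
  then have "r = t ^ 2" using r_gt_1 by simp
  then show False using not_square_r by (auto simp: is_nth_power_def)
qed

text \<open>Otherwise the least weight \<open>s\<close> is a power of the characteristic with
  \<open>s\<close> at least \<open>2 r\<close>, so \<open>s ^ 3 > q\<close>. Counting the points
  seen from one point of \<open>U\<close> gives \<open>N (s - 1) <= q - 1\<close>, the degree bound
  needed for \<open>square_of_few_directions\<close>; but \<open>r ^ 3\<close> is not a
  square.\<close>

lemma min_weight: "\<exists>z\<in>dirs q U. weight z = r"
proof (rule ccontr)
  assume none: "\<not> ?thesis"
  have ne: "dirs q U \<noteq> {}" using many by auto
  define s where "s = Min (weight ` dirs q U)"
  have "s \<in> weight ` dirs q U" unfolding s_def using ne by (intro Min_in) auto
  then obtain z where z: "z \<in> dirs q U" "weight z = s" by auto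
  have le: "s \<le> weight y" if "y \<in> dirs q U" for y
    unfolding s_def using that by (intro Min_le) auto
  have s2r: "s \<ge> 2 * r" using weight_gt[OF z(1)] none z by auto
  have "N * (s - 1) \<le> (\<Sum>z\<in>dirs q U. weight z - 1)"
    using sum_bounded_below[of "dirs q U" "s - 1" "\<lambda>z. weight z - 1"] le diff_le_mono by fastforce
  then have Ns: "N * (s - 1) \<le> q - 1" using sum_weights by simp
  have s1: "s > 1" using s2r r_gt_1 by linarith
  have sq: "s < q"
  proof -
    have "2 * (s - 1) \<le> N * (s - 1)" using many by (rule mult_le_mono1)
    then show ?thesis using Ns s1 by linarith
  qed
  interpret lacunary_split "proj z ` U" "mult_at z" "- inverse z" q q_exponent "redei_tail z"
    by (rule lacunary_split_at) (use z dirs_subset in auto)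
  obtain i where i: "i \<le> q_exponent" "s = CHAR('a) ^ i" using weight_power[of z] z by auto
  have "0 < i" using i s1 by (cases i) auto
  moreover have "i < q_exponent" using i sq q_power by (cases "i = q_exponent") auto
  moreover have "mult_at z v = s" if "v \<in> proj z ` U" for v
    using mult_at_eq_weight[OF that] z by simp
  moreover have "s \<ge> 3" using s2r r_gt_1 by linarith
  moreover have "degree (redei_tail z) * (s - 1) \<le> q - s"
  proof -
    have "degree (redei_tail z) * (s - 1) \<le> (N - 1) * (s - 1)" using degree_redei_tail by (rule mult_le_mono1)
    also have "\<dots> = N * (s - 1) - (s - 1)" by (simp add: diff_mult_distrib)
    also have "\<dots> \<le> q - s" using Ns s1 by linarith
    finally show ?thesis .
  qed
  moreover have "q < s ^ 3" using s2r r_gt_1 unfolding q_eq by (intro power_strict_mono) auto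
  ultimately have "q = s ^ 2" using square_of_few_directions[OF i(2)] by blast
  then show False using r_cubed_not_square q_eq by simp
qed

text \<open>For \<open>s = r\<close> the number \<open>q div s\<close> is \<open>s ^ 2\<close>,
  exactly the bound that \<open>few\<close> puts on the tail, so
  \<open>additive_of_small_degree\<close> applies. The degree then yields the lower bound on
  \<open>N\<close>.\<close>

lemma weight_r_split:
  assumes "z \<in> dirs q U" "weight z = r"
  shows "degree (redei_tail z) = r ^ 2"
    and "\<exists>x y c. (\<Prod>v\<in>proj z ` U. [:- v, 1:]) = monom 1 (r ^ 2) + monom x r + [:c, y:]"
proof -
  interpret lacunary_split "proj z ` U" "mult_at z" "- inverse z" q q_exponent "redei_tail z"
    by (rule lacunary_split_at) (use assms dirs_subset in auto)
  obtain k where k: "r = CHAR('a) ^ k" "k > 0" using r_prime_power by auto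
  have "CHAR('a) ^ k < CHAR('a) ^ q_exponent"
    using k q_power q_eq r_gt_1 power_strict_increasing[of 1 3 r] by simp
  then have "k < q_exponent" using p_gt_1 by (simp add: power_strict_increasing_iff)
  have qr: "q div r = r ^ 2" using q_eq r_gt_1 by (simp add: power2_eq_square power3_eq_cube)
  have deg: "degree (redei_tail z) \<le> q div r" using degree_redei_tail[of z] few qr by simp
  have m: "mult_at z v = r" if "v \<in> proj z ` U" for v
    using mult_at_eq_weight[OF that] assms by simp
  show "degree (redei_tail z) = r ^ 2"
    by (rule additive_of_small_degree(1)[OF k \<open>k < q_exponent\<close> m deg qr])
  show "\<exists>x y c. (\<Prod>v\<in>proj z ` U. [:- v, 1:]) = monom 1 (r ^ 2) + monom x r + [:c, y:]"
    by (rule additive_of_small_degree(2)[OF k \<open>k < q_exponent\<close> m deg qr])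
qed

lemma N_eq: "N = r ^ 2 + 1"
proof -
  obtain z where "z \<in> dirs q U" "weight z = r" using min_weight by auto
  then have "r ^ 2 \<le> N - 1" using weight_r_split(1) degree_redei_tail by metis
  moreover have "r ^ 2 > 0" using r_gt_1 by simp
  ultimately show ?thesis using few by linarith
qed

lemma N_q_int: "int N = int r ^ 2 + 1" "int q = int r ^ 3"
  using N_eq by (simp_all add: q_eq)

text \<open>This is \<open>(r^3 - 1) - (r - 1) (r^2 + 1)\<close>.\<close>

lemma sum_excess: "(\<Sum>z\<in>dirs q U. int (weight z) - int r) = int r * (int r - 1)"
proof -
  have "(\<Sum>z\<in>dirs q U. int (weight z) - int r) = (\<Sum>z\<in>dirs q U. int (weight z) - 1) - (int r - 1) * int N"
    by (simp add: sum_subtractf algebra_simps)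
  also have "\<dots> = int r * (int r - 1)"
    unfolding sum_weights_int N_q_int by (simp add: algebra_simps power2_eq_square power3_eq_cube)
  finally show ?thesis .
qed

lemma card_heavy: "card {z \<in> dirs q U. weight z \<noteq> r} \<le> r - 1"
proof -
  define B where "B = {z \<in> dirs q U. weight z \<noteq> r}"
  have "int r * int (card B) = (\<Sum>z\<in>B. int r)" by simp
  also have "\<dots> \<le> (\<Sum>z\<in>B. int (weight z) - int r)"
    using weight_gt by (intro sum_mono) (force simp: B_def)
  also have "\<dots> \<le> (\<Sum>z\<in>dirs q U. int (weight z) - int r)"
    by (rule sum_mono2) (use weight_ge in \<open>auto simp: B_def\<close>)
  finally have "int (card B) \<le> int r - 1" using sum_excess r_gt_1 by simp
  then show ?thesis using r_gt_1 by (simp add: B_def)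
qed

text \<open>A heavy direction has excess at least \<open>r\<close> out of \<open>r (r - 1)\<close>,
  so at most \<open>r - 1\<close> directions are heavy. The bound \<open>r + 2\<close> is the number
  of directions required by \<open>card_le_of_plane_projections\<close>.\<close>

lemma card_light: "card {z \<in> dirs q U. weight z = r} \<ge> r + 2"
proof -
  have "dirs q U = {z \<in> dirs q U. weight z = r} \<union> {z \<in> dirs q U. weight z \<noteq> r}" by auto
  then have "N = card {z \<in> dirs q U. weight z = r} + card {z \<in> dirs q U. weight z \<noteq> r}"
    by (metis (no_types, lifting) card_Un_disjoint disjoint_iff finite mem_Collect_eq)
  then have "r ^ 2 + 1 \<le> card {z \<in> dirs q U. weight z = r} + (r - 1)" using N_eq card_heavy by simp
  moreover have "r ^ 2 \<ge> 2 * r" using r_gt_1 by (simp add: power2_eq_square)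
  ultimately show ?thesis using r_gt_1 by linarith
qed

lemma heavy_exists: "\<exists>z\<in>dirs q U. weight z > r"
proof (rule ccontr)
  assume "\<not> ?thesis"
  then have "weight z = r" if "z \<in> dirs q U" for z using weight_ge[OF that] that by force
  then have "(\<Sum>z\<in>dirs q U. int (weight z) - int r) = 0" by simp
  then show False using sum_excess r_gt_1 by simp
qed

lemma weight_le:
  assumes z: "z \<in> dirs q U"
  shows "weight z \<le> r ^ 2"
proof -
  have "int (weight z) - int r \<le> (\<Sum>z\<in>dirs q U. int (weight z) - int r)"
    by (rule member_le_sum[OF z]) (use weight_ge in auto)
  also have "\<dots> = int (r ^ 2) - int r"
    unfolding sum_excess by (simp add: power2_eq_square algebra_simps)
  finally show ?thesis by simp
qed

text \<open>For a direction of weight \<open>r\<close> the polynomial with root set \<open>proj z ` U\<close> is a linearised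
  polynomial over \<open>F\<close>.\<close>

lemma subspace_proj:
  assumes U0: "0 \<in> U" and z: "z \<in> dirs q U" "weight z = r"
  shows "subspace_F (proj z ` U)" and "card (proj z ` U) = r ^ 2"
proof -
  obtain x y c where f: "(\<Prod>v\<in>proj z ` U. [:- v, 1:]) = monom 1 (r ^ 2) + monom x r + [:c, y:]"
    using weight_r_split(2)[OF z] by auto
  have root: "v \<in> proj z ` U \<longleftrightarrow> v ^ r ^ 2 + x * v ^ r + c + v * y = 0" for v
  proof -
    have "v \<in> proj z ` U \<longleftrightarrow> poly (\<Prod>v\<in>proj z ` U. [:- v, 1:]) v = 0"
      by (auto simp: poly_prod)
    then show ?thesis unfolding f by (simp add: poly_monom algebra_simps)
  qed
  \<comment> \<open>The constant term is the only obstruction to linearity; it vanishes because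
    \<open>0\<close> is a root.\<close>
  have "0 \<in> proj z ` U" using U0 by force
  then have c: "c = 0" using root[of 0] r_gt_1 by (simp add: power_0_left)
  have root: "v \<in> proj z ` U \<longleftrightarrow> (v ^ r) ^ r + x * v ^ r + v * y = 0" for v
    using root[of v] c by (simp add: power_r2)
  show "subspace_F (proj z ` U)"
    unfolding subspace_F_def root
  proof (intro conjI ballI)
    show "((0::'a) ^ r) ^ r + x * 0 ^ r + 0 * y = 0" using r_gt_1 by (simp add: power_0_left)
  next
    fix v w assume "v \<in> proj z ` U" "w \<in> proj z ` U"
    then have "(v ^ r) ^ r + x * v ^ r + v * y = 0" "(w ^ r) ^ r + x * w ^ r + w * y = 0"
      using root by auto
    moreover have "((v + w) ^ r) ^ r + x * (v + w) ^ r + (v + w) * y =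
      ((v ^ r) ^ r + x * v ^ r + v * y) + ((w ^ r) ^ r + x * w ^ r + w * y)"
      by (simp only: power_r_add algebra_simps)
    ultimately show "((v + w) ^ r) ^ r + x * (v + w) ^ r + (v + w) * y = 0" by simp
  next
    fix a v assume "a \<in> F" "v \<in> proj z ` U"
    then have a: "a ^ r = a" and "(v ^ r) ^ r + x * v ^ r + v * y = 0"
      using root by (auto simp: F_def)
    moreover have "((a * v) ^ r) ^ r + x * (a * v) ^ r + (a * v) * y = a * ((v ^ r) ^ r + x * v ^ r + v * y)"
      unfolding power_mult_distrib a by (simp only: algebra_simps)
    ultimately show "((a * v) ^ r) ^ r + x * (a * v) ^ r + (a * v) * y = 0" by simp
  qed
  have "r ^ 3 = card (proj z ` U) * r" using q_eq_card_proj[of z] z(2) q_eq by simp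
  then show "card (proj z ` U) = r ^ 2" using r_gt_1 by (simp add: power2_eq_square power3_eq_cube)
qed

end

section \<open>Sets with few directions are linear\<close>

context cubic_field
begin

definition indep_K :: "'a \<Rightarrow> 'a \<Rightarrow> bool" where
  "indep_K v u \<longleftrightarrow> (\<forall>a\<in>K. \<forall>b\<in>K. a * v + b * u = 0 \<longrightarrow> a = 0 \<and> b = 0)"

text \<open>For independent \<open>v\<close> and \<open>u\<close>, the line \<open>K v\<close> meets
  this space in a plane over \<open>F\<close>, and every other line \<open>K x\<close> meets it in
  at most \<open>r\<close> points.\<close>

definition club_space :: "'a \<Rightarrow> 'a \<Rightarrow> 'a set" where
  "club_space v u = (\<lambda>(w, f). w * v + f * u) ` (trace_zero \<times> F)"

lemma trace_zero_subset_K: "trace_zero \<subseteq> K"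
  by (auto simp: trace_zero_def)

lemma indep_K_D:
  assumes "indep_K v u" "a * v + b * u = a' * v + b' * u" "a \<in> K" "b \<in> K" "a' \<in> K" "b' \<in> K"
  shows "a = a'" "b = b'"
proof -
  have "(a - a') * v + (b - b') * u = 0" using assms(2) by (simp add: algebra_simps)
  then have "a - a' = 0 \<and> b - b' = 0" using assms K_diff unfolding indep_K_def by blast
  then show "a = a'" "b = b'" by auto
qed

lemma indep_K_nonzero: "indep_K v u \<Longrightarrow> v \<noteq> 0 \<and> u \<noteq> 0"
  unfolding indep_K_def using one_in_K zero_in_K by (metis add_0 mult_1 mult_zero_left one_neq_zero add.right_neutral)

lemma indep_K_iff: "v \<noteq> 0 \<Longrightarrow> indep_K v u \<longleftrightarrow> u \<notin> (\<lambda>k. k * v) ` K"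
proof
  assume v: "v \<noteq> 0" and i: "indep_K v u"
  show "u \<notin> (\<lambda>k. k * v) ` K"
  proof
    assume "u \<in> (\<lambda>k. k * v) ` K"
    then obtain k where "k \<in> K" "u = k * v" by auto
    then have "k * v + (- 1) * u = 0" by simp
    then show False using i \<open>k \<in> K\<close> K_uminus[of 1] unfolding indep_K_def by fastforce
  qed
next
  assume v: "v \<noteq> 0" and n: "u \<notin> (\<lambda>k. k * v) ` K"
  show "indep_K v u"
    unfolding indep_K_def
  proof (intro ballI impI)
    fix a b assume ab: "a \<in> K" "b \<in> K" "a * v + b * u = 0"
    have "b = 0"
    proof (rule ccontr)
      assume b: "b \<noteq> 0"
      have "b * u = - a * v" using ab(3) by (simp add: eq_neg_iff_add_eq_0 add.commute)
      then have "u = (- a / b) * v" using b by (simp add: field_simps)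
      moreover have "- a / b \<in> K" using ab K_divide K_uminus by blast
      ultimately show False using n by blast
    qed
    then show "a = 0 \<and> b = 0" using ab v by simp
  qed
qed

lemma card_club_space:
  assumes "indep_K v u"
  shows "card (club_space v u) = q"
proof -
  have "inj_on (\<lambda>(w, f). w * v + f * u) (trace_zero \<times> F)"
  proof (rule inj_onI, clarify)
    fix w f w' f' assume "w \<in> trace_zero" "f \<in> F" "w' \<in> trace_zero" "f' \<in> F"
      "w * v + f * u = w' * v + f' * u"
    then show "w = w' \<and> f = f'"
      using indep_K_D[OF assms, of w f w' f'] trace_zero_subset_K F_subset_K by auto
  qed
  then show ?thesis unfolding club_space_def
    by (simp add: card_image card_cartesian_product card_trace_zero card_F q_eq
        power2_eq_square power3_eq_cube)
qed

lemma kernel_eq: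
  assumes "e \<noteq> 0" "proj z e = 0"
  shows "{a \<in> A. proj z a = 0} = (\<lambda>c. c * e) ` {c \<in> K. c * e \<in> A}"
proof (intro set_eqI iffI)
  fix a assume a: "a \<in> {a \<in> A. proj z a = 0}"
  show "a \<in> (\<lambda>c. c * e) ` {c \<in> K. c * e \<in> A}"
  proof (cases "a = 0")
    case True
    then show ?thesis using a by (intro image_eqI[of _ _ 0]) auto
  next
    case False
    then have "a / e \<in> K" using dir_eq_iff[OF False assms(1)] a assms by (auto simp: proj_eq_0_iff)
    then show ?thesis using a assms(1) by (intro image_eqI[of _ _ "a / e"]) auto
  qed
next
  fix a assume "a \<in> (\<lambda>c. c * e) ` {c \<in> K. c * e \<in> A}"
  then show "a \<in> {a \<in> A. proj z a = 0}" using assms by (auto simp: proj_scale)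
qed

lemma card_kernel:
  assumes "e \<noteq> 0" "proj z e = 0"
  shows "card {a \<in> A. proj z a = 0} = card {c \<in> K. c * e \<in> A}"
  unfolding kernel_eq[OF assms] using assms(1) by (simp add: card_image inj_on_def)

lemma subspace_F_coeffs:
  assumes "subspace_F A"
  shows "subspace_F {c \<in> K. c * e \<in> A}"
  using subspace_FD[OF assms] F_subset_K
  by (auto simp: subspace_F_def K_add K_mult distrib_right mult.assoc subsetD)

lemma subspace_F_kernel:
  assumes "subspace_F A"
  shows "subspace_F {a \<in> A. proj z a = 0}"
  using subspace_FD[OF assms] F_subset_K
  by (auto simp: subspace_F_def proj_add proj_scale subsetD)

lemma proj_both_zero: "y \<noteq> z \<Longrightarrow> proj y a = 0 \<Longrightarrow> proj z a = 0 \<Longrightarrow> a = 0"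
  by (auto simp: proj_eq_0_iff)

lemma card_sum_kernels:
  assumes A: "subspace_F A" and yz: "y \<noteq> z"
  shows "card ((\<lambda>(a, b). a + b) ` ({a \<in> A. proj y a = 0} \<times> {a \<in> A. proj z a = 0})) =
    card {a \<in> A. proj y a = 0} * card {a \<in> A. proj z a = 0}"
proof -
  have "inj_on (\<lambda>(a, b). a + b) ({a \<in> A. proj y a = 0} \<times> {a \<in> A. proj z a = 0})"
  proof (rule inj_onI, clarify)
    fix a b a' b'
    assume *: "proj y a = 0" "proj z b = 0" "proj y a' = 0" "proj z b' = 0" "a + b = a' + b'"
    have eq: "a - a' = b' - b" using *(5) by (metis add_diff_cancel_left add_diff_eq diff_add_cancel add.commute)
    have "proj y (a - a') = 0" using * by (simp add: proj_diff)
    moreover have "proj z (a - a') = 0" unfolding eq using * by (simp add: proj_diff)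
    ultimately have "a - a' = 0" using proj_both_zero[OF yz] by blast
    then show "a = a' \<and> b = b'" using *(5) by simp
  qed
  then show ?thesis by (simp add: card_image card_cartesian_product)
qed

text \<open>If many directions see an \<open>F\<close>-subspace \<open>A\<close> as a plane, then \<open>A\<close> has dimension three:
  in dimension four, \<open>A\<close> would be \<open>W e\<^sub>1 + W e\<^sub>2\<close>, in which only the directions of
  \<open>e\<^sub>1 + m e\<^sub>2\<close> with \<open>m W \<subseteq> W\<close>, i.e. \<open>m \<in> F\<close>, and of \<open>e\<^sub>2\<close> qualify.\<close>

lemma card_le_of_plane_projections:
  assumes A: "subspace_F A" and plane: "\<And>z. z \<in> M \<Longrightarrow> card (proj z ` A) = r ^ 2"
    and M: "card M \<ge> r + 2"
  shows "card A \<le> q"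
proof (rule ccontr)
  assume gt: "\<not> card A \<le> q"
  define ker where "ker = (\<lambda>z. {a \<in> A. proj z a = 0})"
  have cardA: "card A = r ^ 2 * card (ker z)" if "z \<in> M" for z
    unfolding ker_def plane[OF that, symmetric]
    by (rule card_additive_image) (auto simp: proj_diff subspace_FD(3)[OF A])
  \<comment> \<open>More than \<open>r ^ 3\<close> points projecting onto \<open>r ^ 2\<close> leave
    kernels with more than \<open>r\<close> elements, hence planes at least.\<close>
  have ker_ge: "card (ker z) \<ge> r ^ 2" if z: "z \<in> M" for z
  proof -
    have "r ^ 2 * r < r ^ 2 * card (ker z)"
      using gt cardA[OF z] q_eq by (simp add: power2_eq_square power3_eq_cube)
    then have "r < card (ker z)" by simp
    then show ?thesis using subspace_F_kernel[OF A] unfolding ker_def by (intro subspace_F_card_ge)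
  qed
  have sum_sub: "(\<lambda>(a, b). a + b) ` (ker y \<times> ker z) \<subseteq> A" for y z
    using subspace_FD(2)[OF A] by (auto simp: ker_def)
  \<comment> \<open>Kernels of two directions meet only in \<open>0\<close>, so their direct sum
    fits into \<open>A\<close>, which has \<open>r ^ 2\<close> times as many elements as
    \<open>ker y\<close>.\<close>
  have ker_le: "card (ker z) \<le> r ^ 2" if z: "z \<in> M" for z
  proof -
    have "\<not> M \<subseteq> {z}" using card_mono[of "{z}" M] M by auto
    then obtain y where y: "y \<in> M" "y \<noteq> z" by auto
    have "card (ker y) * card (ker z) \<le> card A"
      using card_mono[OF _ sum_sub[of y z]] card_sum_kernels[OF A y(2)] by (simp add: ker_def)
    then have "card (ker y) * card (ker z) \<le> card (ker y) * r ^ 2" using cardA[OF y(1)] by (simp add: mult.commute)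
    moreover have "card (ker y) > 0" using ker_ge[OF y(1)] r_gt_1 by (metis less_le_trans zero_less_power order_less_trans zero_less_one)
    ultimately show ?thesis by simp
  qed
  have ker: "card (ker z) = r ^ 2" if "z \<in> M" for z using ker_ge[OF that] ker_le[OF that] by simp
  have sum_eq: "(\<lambda>(a, b). a + b) ` (ker y \<times> ker z) = A" if "y \<in> M" "z \<in> M" "y \<noteq> z" for y z
  proof (rule card_subset_eq[OF _ sum_sub])
    show "card ((\<lambda>(a, b). a + b) ` (ker y \<times> ker z)) = card A"
      using card_sum_kernels[OF A that(3)] ker that cardA[OF that(1)] by (simp add: ker_def)
  qed simp
  have "card M \<ge> 3" using M r_gt_1 by simp
  have avoid: "\<exists>z\<in>M. z \<notin> B" if "card B < 3" for B
    using that \<open>card M \<ge> 3\<close> card_mono[of B M] by fastforce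
  obtain z1 where "z1 \<in> M" using avoid[of "{}"] by auto
  moreover obtain z2 where "z2 \<in> M" "z2 \<noteq> z1" using avoid[of "{z1}"] by auto
  moreover obtain z3 where "z3 \<in> M" "z3 \<noteq> z1" "z3 \<noteq> z2"
  proof -
    have "card {z1, z2} < 3" by (cases "z1 = z2") auto
    then show ?thesis using avoid[of "{z1, z2}"] that by blast
  qed
  ultimately have z: "z1 \<in> M" "z2 \<in> M" "z3 \<in> M" "z1 \<noteq> z2" "z1 \<noteq> z3" "z2 \<noteq> z3" by auto
  have split: "\<exists>a\<in>ker z1. \<exists>b\<in>ker z2. x = a + b" if "x \<in> A" for x
  proof -
    have "x \<in> (\<lambda>(a, b). a + b) ` (ker z1 \<times> ker z2)" unfolding sum_eq[OF z(1,2,4)] by (rule that)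
    then show ?thesis by auto
  qed
  have decomp: "a1 \<in> A \<and> a2 \<in> A" if "a1 + a2 \<in> A" "proj z1 a1 = 0" "proj z2 a2 = 0" for a1 a2
  proof -
    obtain b1 b2 where b: "b1 \<in> ker z1" "b2 \<in> ker z2" "a1 + a2 = b1 + b2"
      using split \<open>a1 + a2 \<in> A\<close> by blast
    have eq: "a1 - b1 = b2 - a2" using b(3) by (simp add: algebra_simps)
    have "proj z1 (a1 - b1) = 0" using that b by (simp add: proj_diff ker_def)
    moreover have "proj z2 (a1 - b1) = 0" unfolding eq using that b by (simp add: proj_diff ker_def)
    ultimately have "a1 - b1 = 0" using proj_both_zero z(4) by blast
    then show ?thesis using b by (auto simp: ker_def)
  qed
  have nonzero: "\<exists>e\<in>ker z. e \<noteq> 0" if "z \<in> M" for z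
  proof (rule ccontr)
    assume "\<not> ?thesis"
    then have "ker z \<subseteq> {0}" by auto
    then have "card (ker z) \<le> 1" using card_mono[of "{0}" "ker z"] by simp
    then show False using ker[OF that] r_less_r2 r_gt_1 by simp
  qed
  \<comment> \<open>Choosing \<open>e1\<close> and \<open>e2\<close> as the components of a point in
    a third direction makes their coefficient planes \<open>W e1\<close> and \<open>W e2\<close>
    coincide.\<close>
  obtain e3 where e3: "e3 \<in> ker z3" "e3 \<noteq> 0" using nonzero z by blast
  then have "e3 \<in> A" by (simp add: ker_def)
  then obtain e1 e2 where e: "e1 \<in> ker z1" "e2 \<in> ker z2" "e3 = e1 + e2"
    using split by blast
  have e1: "e1 \<noteq> 0" and e2: "e2 \<noteq> 0"
    using e e3 proj_both_zero[OF z(6), of e3] proj_both_zero[OF z(5), of e3] by (auto simp: ker_def)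
  have p: "proj z1 e1 = 0" "proj z2 e2 = 0" "proj z3 e3 = 0" using e e3 by (auto simp: ker_def)
  define W where "W = (\<lambda>e. {c \<in> K. c * e \<in> A})"
  have cardW: "card (W x) = r ^ 2" if "z \<in> M" "x \<noteq> 0" "proj z x = 0" for x z
    using ker[OF that(1)] card_kernel[OF that(2,3)] by (simp add: W_def ker_def)
  have Wsub: "W (e1 + m * e2) \<subseteq> {c \<in> K. c * e1 \<in> A \<and> (c * m) * e2 \<in> A}" if "m \<in> K" for m
  proof
    fix c assume "c \<in> W (e1 + m * e2)"
    then have c: "c \<in> K" "c * e1 + (c * m) * e2 \<in> A" by (auto simp: W_def algebra_simps)
    then show "c \<in> {c \<in> K. c * e1 \<in> A \<and> (c * m) * e2 \<in> A}"
      using decomp[of "c * e1" "(c * m) * e2"] p that by (simp add: proj_scale K_mult)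
  qed
  have W3: "W (e1 + 1 * e2) = W e1" "W (e1 + 1 * e2) = W e2"
  proof -
    have "W (e1 + 1 * e2) \<subseteq> W e1" "W (e1 + 1 * e2) \<subseteq> W e2"
      using Wsub[of 1] by (auto simp: W_def)
    moreover have "card (W (e1 + 1 * e2)) = r ^ 2" using cardW[OF z(3) e3(2) p(3)] e(3) by simp
    ultimately show "W (e1 + 1 * e2) = W e1" "W (e1 + 1 * e2) = W e2"
      using card_subset_eq[OF finite] cardW[OF z(1) e1 p(1)] cardW[OF z(2) e2 p(2)] by metis+
  qed
  have dirs_M: "z \<in> {z1, z2} \<union> (\<lambda>m. dir q (e1 + m * e2)) ` (F - {0})" if zM: "z \<in> M" for z
  proof (rule ccontr)
    assume not: "z \<notin> {z1, z2} \<union> (\<lambda>m. dir q (e1 + m * e2)) ` (F - {0})"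
    obtain x where x: "x \<in> ker z" "x \<noteq> 0" using nonzero zM by blast
    then have "x \<in> A" by (simp add: ker_def)
    then obtain x1 x2 where x12: "x1 \<in> ker z1" "x2 \<in> ker z2" "x = x1 + x2"
      using split by blast
    have "x1 \<noteq> 0" "x2 \<noteq> 0"
      using x12 x not proj_both_zero[of z z1 x] proj_both_zero[of z z2 x] by (auto simp: ker_def)
    obtain c1 where c1: "c1 \<in> K" "x1 = c1 * e1"
      using x12(1) kernel_eq[OF e1 p(1)] unfolding ker_def by auto
    obtain c2 where c2: "c2 \<in> K" "x2 = c2 * e2"
      using x12(2) kernel_eq[OF e2 p(2)] unfolding ker_def by auto
    define m where "m = c2 / c1"
    have mK: "m \<in> K" using c1 c2 K_divide by (simp add: m_def)
    have c10: "c1 \<noteq> 0" using c1 \<open>x1 \<noteq> 0\<close> by auto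
    have m0: "m \<noteq> 0" using c2 \<open>x2 \<noteq> 0\<close> c10 by (auto simp: m_def)
    have xm: "x = c1 * (e1 + m * e2)" using c1 c2 x12 c10 by (simp add: m_def distrib_left)
    then have "e1 + m * e2 \<noteq> 0" using x by auto
    moreover have pz: "proj z (e1 + m * e2) = 0"
      using x c10 proj_scale[OF c1(1), of z "e1 + m * e2"] by (simp add: ker_def xm)
    ultimately have "card (W (e1 + m * e2)) = r ^ 2" using cardW[OF zM] by simp
    moreover have "W (e1 + m * e2) \<subseteq> W e1" using Wsub[OF mK] by (auto simp: W_def)
    ultimately have "W (e1 + m * e2) = W e1"
      using card_subset_eq[OF finite] cardW[OF z(1) e1 p(1)] by metis
    then have "c * m \<in> W e2" if "c \<in> W e1" for c
      using that Wsub[OF mK] mK by (auto simp: W_def K_mult)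
    then have "(\<lambda>c. m * c) ` W e1 \<subseteq> W e1" using W3 by (auto simp: mult.commute)
    moreover have "subspace_F (W e1)" unfolding W_def by (rule subspace_F_coeffs[OF A])
    ultimately have "m \<in> F" using plane_stabilizer cardW[OF z(1) e1 p(1)] mK by blast
    moreover have "z = dir q (e1 + m * e2)"
      using pz \<open>e1 + m * e2 \<noteq> 0\<close> by (simp add: proj_eq_0_iff)
    ultimately show False using not m0 by auto
  qed
  have "card M \<le> card ({z1, z2} \<union> (\<lambda>m. dir q (e1 + m * e2)) ` (F - {0}))"
    by (rule card_mono) (use dirs_M in auto)
  also have "\<dots> \<le> card {z1, z2} + card ((\<lambda>m. dir q (e1 + m * e2)) ` (F - {0}))"
    by (rule card_Un_le)
  also have "\<dots> \<le> 2 + card (F - {0})"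
    by (intro add_mono card_image_le) (auto simp: card_insert_if)
  also have "card (F - {0}) = r - 1" by (simp add: card_F card_Diff_subset)
  finally show False using M r_gt_1 by simp
qed

end

section \<open>Classification of the sets with few directions\<close>

context few_directions
begin

text \<open>\<open>A\<close> is the largest set with the same projections as \<open>U\<close> in the
  light directions. It is a subspace because those projections are, and
  \<open>card_le_of_plane_projections\<close> leaves no room for points outside
  \<open>U\<close>.\<close>

lemma subspace_U:
  assumes U0: "0 \<in> U"
  shows "subspace_F U"
proof -
  define M where "M = {z \<in> dirs q U. weight z = r}"
  define A where "A = {a. \<forall>z\<in>M. proj z a \<in> proj z ` U}"
  have sub: "subspace_F (proj z ` U)" "card (proj z ` U) = r ^ 2" if "z \<in> M" for z
    using subspace_proj[OF U0] that by (auto simp: M_def)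
  have "subspace_F A"
    unfolding subspace_F_def
  proof (intro conjI ballI)
    show "0 \<in> A" using sub subspace_FD(1) by (auto simp: A_def)
    show "x + y \<in> A" if "x \<in> A" "y \<in> A" for x y
      using that sub subspace_FD(2) by (auto simp: A_def proj_add)
    show "a * x \<in> A" if "a \<in> F" "x \<in> A" for a x
    proof -
      have "a \<in> K" using that F_subset_K by auto
      then show ?thesis using that subspace_FD(4)[OF sub(1)] by (auto simp: A_def proj_scale)
    qed
  qed
  moreover have UA: "U \<subseteq> A" by (auto simp: A_def)
  moreover have "card (proj z ` A) = r ^ 2" if "z \<in> M" for z
  proof -
    have "proj z ` A = proj z ` U" using UA that by (auto simp: A_def)
    then show ?thesis using sub(2)[OF that] by simp
  qed
  moreover have "card M \<ge> r + 2" using card_light by (simp add: M_def)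
  ultimately have "card A \<le> card U" unfolding card_U by (rule_tac card_le_of_plane_projections)
  then have "U = A" using UA by (intro card_seteq) auto
  then show ?thesis using \<open>subspace_F A\<close> by simp
qed

text \<open>In a heavy direction the points of \<open>U\<close> on the line through \<open>0\<close>
  form a subspace with more than \<open>r\<close> elements, hence exactly \<open>r ^ 2\<close> by
  \<open>weight_le\<close>. Its coefficients are \<open>a\<close> times \<open>trace_zero\<close>,
  which makes \<open>a * e\<close> the head; any point \<open>u\<close> of \<open>U\<close> off this
  line completes the basis, and cardinalities agree.\<close>

lemma U_eq_club_space:
  assumes U0: "0 \<in> U"
  shows "\<exists>v u. indep_K v u \<and> U = club_space v u"
proof -
  note U = subspace_U[OF U0]
  obtain z where z: "z \<in> dirs q U" "weight z > r" using heavy_exists by auto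
  define L where "L = {a \<in> U. proj z a = 0}"
  have "card L = weight z"
    using mult_at_eq_weight[of 0 z] U0 by (force simp: mult_at_def L_def)
  then have "card L > r" using z by simp
  moreover have "subspace_F L" unfolding L_def by (rule subspace_F_kernel[OF U])
  ultimately have "card L \<ge> r ^ 2" by (intro subspace_F_card_ge)
  then have cardL: "card L = r ^ 2" using \<open>card L = weight z\<close> weight_le[OF z(1)] by simp
  then have "\<not> L \<subseteq> {0}" using card_mono[of "{0}" L] r_less_r2 r_gt_1 by auto
  then obtain e where e: "e \<in> L" "e \<noteq> 0" by auto
  then have pe: "proj z e = 0" by (simp add: L_def)
  define W where "W = {c \<in> K. c * e \<in> U}"
  have L_eq: "L = (\<lambda>c. c * e) ` W" unfolding L_def W_def by (rule kernel_eq[OF e(2) pe])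
  have "subspace_F W" "W \<subseteq> K" unfolding W_def by (rule subspace_F_coeffs[OF U]) auto
  moreover have "card W = r ^ 2" using cardL card_kernel[OF e(2) pe] by (simp add: L_def W_def)
  ultimately obtain a where a: "a \<in> K" "a \<noteq> 0" "W = (\<lambda>x. a * x) ` trace_zero"
    using plane_eq_scaled_trace_zero by blast
  have "r ^ 2 < q" using q_eq r_gt_1 power_strict_increasing[of 2 3 r] by simp
  then have "\<not> U \<subseteq> L" using card_mono[of L U] cardL card_U by auto
  then obtain u where u: "u \<in> U" "proj z u \<noteq> 0" by (auto simp: L_def)
  have ind: "indep_K (a * e) u"
  proof (subst indep_K_iff)
    show "u \<notin> (\<lambda>k. k * (a * e)) ` K" using u pe a(1) by (auto simp: proj_scale)
  qed (use a e in auto)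
  have "club_space (a * e) u \<subseteq> U"
  proof
    fix x assume "x \<in> club_space (a * e) u"
    then obtain w f where wf: "w \<in> trace_zero" "f \<in> F" "x = w * (a * e) + f * u"
      by (auto simp: club_space_def)
    have "(a * w) * e \<in> L" using wf a L_eq by blast
    then have "w * (a * e) \<in> U" by (simp add: L_def mult_ac)
    then show "x \<in> U" using wf u subspace_FD(2,4)[OF U] by auto
  qed
  then have "club_space (a * e) u = U"
    by (intro card_subset_eq) (auto simp: card_club_space[OF ind] card_U)
  then show ?thesis using ind by blast
qed

end

section \<open>Clubs and extremal graphs\<close>

text \<open>The neighbourhood of \<open>0\<close> recovers the connection set, so counting graphs is
  counting connection sets.\<close>

lemma inj_cayley_graph: "inj cayley_graph"
proof (rule injI)
  fix S T :: "'a set" assume "cayley_graph S = cayley_graph T"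
  then have "parcs (cayley_graph S) = parcs (cayley_graph T)" by simp
  then have "(x, 0) \<in> {(g, h). g - h \<in> S} \<longleftrightarrow> (x, 0) \<in> {(g, h). g - h \<in> T}" for x
    by (simp add: cayley_graph_def)
  then show "S = T" by auto
qed

lemma digraph_iso_cayley_graph:
  fixes T :: "'a::ab_group_add \<Rightarrow> 'a"
  assumes "bij T" "\<And>x y. T (x - y) = T x - T y" "\<And>x. T x \<in> B \<longleftrightarrow> x \<in> A"
  shows "digraph_iso (with_proj (cayley_graph A)) (with_proj (cayley_graph B))"
proof -
  define h where "h = \<lparr>iso_verts = T, iso_arcs = map_prod T T, iso_head = snd, iso_tail = fst\<rparr>"
  have "inj T" "surj T" using assms(1) by (auto simp: bij_def)
  interpret pre_digraph "with_proj (cayley_graph A)" .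
  have "digraph_isomorphism h"
    unfolding digraph_isomorphism_def
  proof (intro conjI)
    show "wf_digraph (with_proj (cayley_graph A))"
      by unfold_locales (auto simp: cayley_graph_def)
    show "inj_on (iso_verts h) (verts (with_proj (cayley_graph A)))"
      using \<open>inj T\<close> by (auto simp: h_def inj_on_def)
    show "inj_on (iso_arcs h) (arcs (with_proj (cayley_graph A)))"
      using \<open>inj T\<close> by (auto simp: h_def inj_on_def)
  qed (auto simp: h_def)
  moreover have "with_proj (cayley_graph B) = app_iso h (with_proj (cayley_graph A))"
  proof -
    have "map_prod T T ` {(g, h). g - h \<in> A} = {(g, h). g - h \<in> B}"
    proof
      show "map_prod T T ` {(g, h). g - h \<in> A} \<subseteq> {(g, h). g - h \<in> B}"
        using assms(2,3) by (auto simp flip: assms(2))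
      show "{(g, h). g - h \<in> B} \<subseteq> map_prod T T ` {(g, h). g - h \<in> A}"
      proof clarify
        fix g h assume gh: "g - h \<in> B"
        obtain x y where "g = T x" "h = T y" using \<open>surj T\<close> by (meson surjD)
        then show "(g, h) \<in> map_prod T T ` {(g, h). g - h \<in> A}"
          using gh assms(3)[of "x - y"] by (intro image_eqI[of _ _ "(x, y)"]) (auto simp: assms(2))
      qed
    qed
    then show ?thesis using \<open>surj T\<close> by (simp add: app_iso_def h_def with_proj_def cayley_graph_def)
  qed
  ultimately show ?thesis unfolding digraph_iso_def by blast
qed

section \<open>Translation of graphs and cliques into sets of directions\<close>

context cubic_field
begin

definition conn_set :: "'a set \<Rightarrow> 'a set" where
  "conn_set Z = {x. x \<noteq> 0 \<and> dir q x \<in> Z}"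

definition indep_pairs :: "('a \<times> 'a) set" where
  "indep_pairs = {(v, u). indep_K v u}"

definition club_dirs :: "'a \<times> 'a \<Rightarrow> 'a set" where
  "club_dirs = (\<lambda>(v, u). dirs q (club_space v u))"

lemma unit_coset_eq: "c \<noteq> 0 \<Longrightarrow> unit_coset K c = conn_set {dir q c}"
proof
  assume c: "c \<noteq> 0"
  show "unit_coset K c \<subseteq> conn_set {dir q c}"
    using c dir_scale by (auto simp: unit_coset_def conn_set_def mult.commute)
  show "conn_set {dir q c} \<subseteq> unit_coset K c"
  proof
    fix x assume "x \<in> conn_set {dir q c}"
    then have "x \<noteq> 0" "x / c \<in> K" using dir_eq_iff[of x c] c by (auto simp: conn_set_def)
    then show "x \<in> unit_coset K c"
      unfolding unit_coset_def using c by (intro image_eqI[of _ _ "x / c"]) auto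
  qed
qed

lemma dir_conn_set: "Z \<subseteq> all_dirs \<Longrightarrow> dir q ` conn_set Z = Z"
  by (auto simp: conn_set_def all_dirs_def subset_iff)

lemma peisert_type_iff:
  "peisert_type K m S \<longleftrightarrow> 1 \<le> m \<and> m \<le> q \<and> (\<exists>Z\<subseteq>all_dirs. card Z = m \<and> S = conn_set Z)"
proof -
  have cosets: "unit_coset K ` (- {0}) = (\<lambda>z. conn_set {z}) ` all_dirs"
    unfolding all_dirs_def image_image by (rule image_cong) (auto simp: unit_coset_eq)
  have inj: "inj_on (\<lambda>z. conn_set {z}) all_dirs"
  proof (rule inj_onI)
    fix y z assume yz: "y \<in> all_dirs" "z \<in> all_dirs" and eq: "conn_set {y} = conn_set {z}"
    have "dir q ` conn_set {y} = {y}" "dir q ` conn_set {z} = {z}" using yz by (auto intro!: dir_conn_set)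
    then show "y = z" unfolding eq by blast
  qed
  have un: "\<Union>((\<lambda>z. conn_set {z}) ` Z) = conn_set Z" for Z by (auto simp: conn_set_def)
  have "(\<exists>C. C \<subseteq> unit_coset K ` (- {0}) \<and> card C = m \<and> S = \<Union>C) \<longleftrightarrow>
    (\<exists>Z\<subseteq>all_dirs. card Z = m \<and> S = conn_set Z)"
  proof
    assume "\<exists>C. C \<subseteq> unit_coset K ` (- {0}) \<and> card C = m \<and> S = \<Union>C"
    then obtain C where C: "C \<subseteq> (\<lambda>z. conn_set {z}) ` all_dirs" "card C = m" "S = \<Union>C"
      unfolding cosets by auto
    then obtain Z where Z: "Z \<subseteq> all_dirs" "C = (\<lambda>z. conn_set {z}) ` Z" by (auto simp: subset_image_iff)
    then have "card Z = m" using C(2) card_image[OF inj_on_subset[OF inj Z(1)]] by simp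
    then show "\<exists>Z\<subseteq>all_dirs. card Z = m \<and> S = conn_set Z" using Z C(3) un by auto
  next
    assume "\<exists>Z\<subseteq>all_dirs. card Z = m \<and> S = conn_set Z"
    then obtain Z where Z: "Z \<subseteq> all_dirs" "card Z = m" "S = conn_set Z" by auto
    then show "\<exists>C. C \<subseteq> unit_coset K ` (- {0}) \<and> card C = m \<and> S = \<Union>C"
      unfolding cosets using card_image[OF inj_on_subset[OF inj Z(1)]] un
      by (intro exI[of _ "(\<lambda>z. conn_set {z}) ` Z"]) auto
  qed
  then show ?thesis unfolding peisert_type_def card_K by simp
qed

lemma clique_iff: "clique (cayley_graph (conn_set Z)) A \<longleftrightarrow> dirs q A \<subseteq> Z"
  by (auto simp: clique_def cayley_graph_def conn_set_def dirs_def)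

lemma line_eq: "c \<noteq> 0 \<Longrightarrow> (\<lambda>k. x + c * k) ` K = {y. proj (dir q c) (y - x) = 0}"
proof -
  assume c: "c \<noteq> 0"
  have "y \<in> (\<lambda>k. x + c * k) ` K \<longleftrightarrow> (y - x) / c \<in> K" for y
  proof
    assume "(y - x) / c \<in> K"
    then show "y \<in> (\<lambda>k. x + c * k) ` K" using c by (intro image_eqI[of _ _ "(y - x) / c"]) auto
  qed (use c in auto)
  moreover have "(y - x) / c \<in> K \<longleftrightarrow> proj (dir q c) (y - x) = 0" for y
    using dir_eq_iff[of "y - x" c] c by (cases "y = x") (auto simp: proj_eq_0_iff)
  ultimately show ?thesis by blast
qed

lemma card_line: "c \<noteq> 0 \<Longrightarrow> card ((\<lambda>k. x + c * k) ` K) = q"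
  by (simp add: card_image inj_on_def card_K)

lemma dirs_line: "c \<noteq> 0 \<Longrightarrow> dirs q ((\<lambda>k. x + c * k) ` K) = {dir q c}"
proof
  assume c: "c \<noteq> 0"
  show "dirs q ((\<lambda>k. x + c * k) ` K) \<subseteq> {dir q c}"
  proof
    fix z assume "z \<in> dirs q ((\<lambda>k. x + c * k) ` K)"
    then obtain k l where "k \<in> K" "l \<in> K" "k \<noteq> l" "z = dir q ((k - l) * c)"
      by (auto simp: dirs_def algebra_simps)
    then show "z \<in> {dir q c}" using dir_scale[of "k - l" c] K_diff by simp
  qed
  show "{dir q c} \<subseteq> dirs q ((\<lambda>k. x + c * k) ` K)"
  proof -
    have "x + c * 1 \<in> (\<lambda>k. x + c * k) ` K" by (rule image_eqI[of _ _ 1]) auto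
    moreover have "x + c * 0 \<in> (\<lambda>k. x + c * k) ` K" by (rule image_eqI[of _ _ 0]) auto
    moreover have "dir q c = dir q ((x + c * 1) - (x + c * 0))" "x + c * 1 \<noteq> x + c * 0" using c by auto
    ultimately show ?thesis unfolding dirs_def by blast
  qed
qed

text \<open>Among the \<open>q + 1\<close> directions one is missing from \<open>Z\<close>;
  projecting along it is injective on the clique, with values among the roots of
  \<open>X^q + X / z\<close>.\<close>

lemma clique_card_le:
  assumes "card Z \<le> q" "dirs q A \<subseteq> (Z :: 'a set)"
  shows "card A \<le> q"
proof -
  have "\<not> all_dirs \<subseteq> Z" using card_mono[of Z all_dirs] card_all_dirs assms(1) by auto
  then obtain z where z: "z \<in> all_dirs" "z \<notin> dirs q A" using assms(2) by auto
  then have "inj_on (proj z) A" using dirs_iff by auto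
  then have "card A = card (proj z ` A)" by (simp add: card_image)
  define f :: "'a poly" where "f = monom 1 q + monom (inverse z) 1"
  have "coeff f q = 1" using q_gt_1 by (simp add: f_def)
  then have "f \<noteq> 0" by auto
  have "degree f \<le> q"
    unfolding f_def using q_gt_1 by (intro degree_add_le) (auto intro: order.trans[OF degree_monom_le])
  moreover have "card (proj z ` A) \<le> degree f"
    using \<open>f \<noteq> 0\<close> proj_power_q[OF z(1)]
    by (intro card_roots_le) (auto simp: f_def poly_monom)
  ultimately show ?thesis using \<open>card A = card (proj z ` A)\<close> by simp
qed

lemma maximum_clique_iff:
  assumes "Z \<subseteq> all_dirs" "Z \<noteq> {}" "card Z \<le> q"
  shows "maximum_clique (cayley_graph (conn_set Z)) A \<longleftrightarrow> dirs q A \<subseteq> Z \<and> card A = q"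
proof -
  obtain c where c: "c \<noteq> 0" "dir q c \<in> Z" using assms(1,2) by (auto simp: all_dirs_def subset_iff)
  have "dirs q ((\<lambda>k. 0 + c * k) ` K) \<subseteq> Z" unfolding dirs_line[OF c(1)] using c(2) by simp
  moreover have "card ((\<lambda>k. 0 + c * k) ` K) = q" by (rule card_line[OF c(1)])
  ultimately show ?thesis
    unfolding maximum_clique_def clique_iff using clique_card_le[OF assms(3)]
    by (metis le_antisym)
qed

lemma canonical_clique_iff:
  "canonical_clique K (conn_set Z) A \<longleftrightarrow> (\<exists>x c. c \<noteq> 0 \<and> dir q c \<in> Z \<and> A = (\<lambda>k. x + c * k) ` K)"
proof -
  have "unit_coset K c \<subseteq> conn_set Z \<longleftrightarrow> dir q c \<in> Z" if "c \<noteq> 0" for c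
    unfolding unit_coset_eq[OF that] using that by (auto simp: conn_set_def)
  then show ?thesis unfolding canonical_clique_def by blast
qed

lemma dirs_nonempty: "card (A :: 'a set) = q \<Longrightarrow> dirs q A \<noteq> {}"
proof
  assume A: "card A = q" "dirs q (A :: 'a set) = {}"
  then obtain a where a: "a \<in> A" using q_gt_1 by fastforce
  have "A \<subseteq> {a}" using A(2) a by (auto simp: dirs_def)
  then show False using card_mono[of "{a}" A] A(1) q_gt_1 by simp
qed

text \<open>A set of \<open>q\<close> points with a single direction lies on a line and therefore
  fills it.\<close>

lemma noncanonical_clique_iff:
  assumes "Z \<subseteq> all_dirs" "Z \<noteq> {}" "card Z \<le> q"
  shows "noncanonical_clique K (conn_set Z) A \<longleftrightarrow> dirs q A \<subseteq> Z \<and> card A = q \<and> card (dirs q A) \<ge> 2"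
proof (cases "dirs q A \<subseteq> Z \<and> card A = q")
  case False
  then show ?thesis unfolding noncanonical_clique_def maximum_clique_iff[OF assms] by auto
next
  case True
  have "canonical_clique K (conn_set Z) A \<longleftrightarrow> card (dirs q A) < 2"
  proof
    assume "canonical_clique K (conn_set Z) A"
    then show "card (dirs q A) < 2" unfolding canonical_clique_iff using dirs_line by auto
  next
    assume "card (dirs q A) < 2"
    moreover have "card (dirs q A) > 0" using dirs_nonempty True by (simp add: card_gt_0_iff)
    ultimately have "card (dirs q A) = 1" by linarith
    then obtain z where z: "dirs q A = {z}" by (auto simp: card_1_singleton_iff)
    then obtain a b where ab: "a \<in> A" "b \<in> A" "a \<noteq> b" "z = dir q (b - a)"
      unfolding dirs_def by (auto simp: set_eq_iff) blast
    have "A \<subseteq> (\<lambda>k. a + (b - a) * k) ` K"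
    proof
      fix x assume x: "x \<in> A"
      have "proj z (x - a) = 0"
      proof (cases "x = a")
        case False
        then have "dir q (x - a) \<in> dirs q A" using x ab by (auto simp: dirs_def)
        then show ?thesis using z by (simp add: proj_eq_0_iff)
      qed simp
      then show "x \<in> (\<lambda>k. a + (b - a) * k) ` K" using ab line_eq[of "b - a" a] by auto
    qed
    then have "A = (\<lambda>k. a + (b - a) * k) ` K"
      using card_line[of "b - a" a] ab True by (intro card_subset_eq) auto
    then show "canonical_clique K (conn_set Z) A"
      unfolding canonical_clique_iff using ab z True by (intro exI[of _ a] exI[of _ "b - a"]) auto
  qed
  then show ?thesis unfolding noncanonical_clique_def maximum_clique_iff[OF assms] using True by auto
qed

lemma dirs_translate: "dirs q ((\<lambda>x. x - a) ` A) = dirs q (A :: 'a set)"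
proof -
  have "z \<in> dirs q ((\<lambda>x. x - a) ` A) \<longleftrightarrow> z \<in> dirs q A" for z
    unfolding dirs_iff by (simp add: inj_on_def proj_diff)
  then show ?thesis by blast
qed

lemma card_dirs_few_directions:
  assumes "card (A :: 'a set) = q" "card (dirs q A) \<ge> 2" "card (dirs q A) \<le> r ^ 2 + 1"
  shows "card (dirs q A) = r ^ 2 + 1"
proof -
  interpret few_directions K q r A by unfold_locales (use assms in auto)
  show ?thesis by (rule N_eq)
qed

lemma club_space_of_few_directions:
  assumes "card (A :: 'a set) = q" "card (dirs q A) \<ge> 2" "card (dirs q A) \<le> r ^ 2 + 1" "0 \<in> A"
  shows "\<exists>(v, u)\<in>indep_pairs. A = club_space v u"
proof -
  interpret few_directions K q r A by unfold_locales (use assms in auto)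
  show ?thesis using U_eq_club_space[OF assms(4)] by (auto simp: indep_pairs_def)
qed

section \<open>Clubs in coordinates\<close>

lemma dir_combination:
  assumes "indep_K v u" "a \<in> K" "b \<in> K" "b \<noteq> 0"
  shows "dir q (a * v + b * u) = dir q (u + (a / b) * v)"
  using dir_scale[OF assms(3,4), of "u + (a / b) * v"] assms(4) by (simp add: algebra_simps)

lemma indep_sum_nonzero: "indep_K v u \<Longrightarrow> a \<in> K \<Longrightarrow> u + a * v \<noteq> 0"
  using one_in_K zero_neq_one unfolding indep_K_def by (metis add.commute mult_1)

lemma dir_sum_eq_iff:
  assumes i: "indep_K v u" and ab: "a \<in> K" "b \<in> K"
  shows "dir q (u + a * v) = dir q (u + b * v) \<longleftrightarrow> a = b" and "dir q (u + a * v) \<noteq> dir q v"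
proof -
  show "dir q (u + a * v) = dir q (u + b * v) \<longleftrightarrow> a = b"
  proof
    assume "dir q (u + a * v) = dir q (u + b * v)"
    then obtain k where k: "k \<in> K" "u + a * v = k * (u + b * v)"
      using dir_eq_iff[OF indep_sum_nonzero indep_sum_nonzero, OF i ab(1) i ab(2)]
        indep_sum_nonzero[OF i ab(2)] by (metis nonzero_divide_eq_eq)
    then have "a * v + 1 * u = (k * b) * v + k * u" by (simp add: algebra_simps)
    then have "a = k * b" "1 = k"
      using indep_K_D[OF i] k ab K_mult one_in_K by blast+
    then show "a = b" by simp
  qed simp
  show "dir q (u + a * v) \<noteq> dir q v"
  proof
    assume "dir q (u + a * v) = dir q v"
    then obtain k where k: "k \<in> K" "u + a * v = k * v"
      using dir_eq_iff[OF indep_sum_nonzero[OF i ab(1)]] indep_K_nonzero[OF i] by (metis nonzero_divide_eq_eq)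
    then have "a * v + 1 * u = k * v + 0 * u" by (simp add: algebra_simps)
    then have "1 = (0::'a)" by (rule indep_K_D(2)[OF i]) (use k ab in auto)
    then show False by simp
  qed
qed

lemma subspace_club_space: "subspace_F (club_space v u)"
  unfolding subspace_F_def
proof (intro conjI ballI)
  note tz = subspace_FD[OF subspace_F_trace_zero]
  show "0 \<in> club_space v u" unfolding club_space_def using tz(1) by (intro image_eqI[of _ _ "(0, 0)"]) auto
  show "x + y \<in> club_space v u" if xy: "x \<in> club_space v u" "y \<in> club_space v u" for x y
  proof -
    obtain w f w' f' where *: "w \<in> trace_zero" "f \<in> F" "x = w * v + f * u"
      "w' \<in> trace_zero" "f' \<in> F" "y = w' * v + f' * u"
      using xy by (auto simp: club_space_def)
    then have "x + y = (w + w') * v + (f + f') * u" by (simp add: algebra_simps)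
    then show ?thesis unfolding club_space_def
      by (intro image_eqI[of _ _ "(w + w', f + f')"]) (use * tz(2) F_add in auto)
  qed
  show "a * x \<in> club_space v u" if ax: "a \<in> F" "x \<in> club_space v u" for a x
  proof -
    obtain w f where *: "w \<in> trace_zero" "f \<in> F" "x = w * v + f * u"
      using ax(2) by (auto simp: club_space_def)
    then have "a * x = (a * w) * v + (a * f) * u" by (simp add: algebra_simps)
    then show ?thesis unfolding club_space_def
      by (intro image_eqI[of _ _ "(a * w, a * f)"]) (use * ax tz(4) F_mult in auto)
  qed
qed

lemma dirs_subspace: "subspace_F A \<Longrightarrow> dirs q A = dir q ` (A - {0})"
proof
  assume A: "subspace_F A"
  show "dirs q A \<subseteq> dir q ` (A - {0})" using subspace_FD(3)[OF A] by (auto simp: dirs_def)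
  show "dir q ` (A - {0}) \<subseteq> dirs q A" using subspace_FD(1)[OF A] by (force simp: dirs_def)
qed

lemma trace_zero_nonzero: "\<exists>w\<in>trace_zero. w \<noteq> 0"
  using subspace_F_card_gt[OF subspace_F_trace_zero] card_trace_zero r_less_r2 by auto

text \<open>Since \<open>trace_zero\<close> is closed under scaling by \<open>F\<close>, a nonzero
  coefficient of \<open>u\<close> can be normalised to \<open>1\<close>.\<close>

lemma club_dirs_eq:
  assumes i: "indep_K v u"
  shows "club_dirs (v, u) = insert (dir q v) ((\<lambda>w. dir q (u + w * v)) ` trace_zero)"
proof -
  note tz = subspace_FD[OF subspace_F_trace_zero]
  have tK: "w \<in> trace_zero \<Longrightarrow> w \<in> K" and FK: "f \<in> F \<Longrightarrow> f \<in> K" for w f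
    using trace_zero_subset_K F_subset_K by auto
  have "club_dirs (v, u) = dir q ` (club_space v u - {0})"
    by (simp add: club_dirs_def dirs_subspace[OF subspace_club_space])
  also have "\<dots> = insert (dir q v) ((\<lambda>w. dir q (u + w * v)) ` trace_zero)"
  proof
    show "dir q ` (club_space v u - {0}) \<subseteq> insert (dir q v) ((\<lambda>w. dir q (u + w * v)) ` trace_zero)"
    proof
      fix z assume "z \<in> dir q ` (club_space v u - {0})"
      then obtain w f where wf: "w \<in> trace_zero" "f \<in> F" "z = dir q (w * v + f * u)" "w * v + f * u \<noteq> 0"
        by (auto simp: club_space_def)
      show "z \<in> insert (dir q v) ((\<lambda>w. dir q (u + w * v)) ` trace_zero)"
      proof (cases "f = 0")
        case True
        then show ?thesis using wf dir_scale[of w v] tK by auto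
      next
        case False
        then have "z = dir q (u + (w / f) * v)" using dir_combination[OF i tK[OF wf(1)] FK[OF wf(2)]] wf(3) by simp
        moreover have "w / f \<in> trace_zero"
          using tz(4)[OF F_inverse[OF wf(2)] wf(1)] by (simp add: divide_inverse mult.commute)
        ultimately show ?thesis by blast
      qed
    qed
    show "insert (dir q v) ((\<lambda>w. dir q (u + w * v)) ` trace_zero) \<subseteq> dir q ` (club_space v u - {0})"
    proof
      fix z assume "z \<in> insert (dir q v) ((\<lambda>w. dir q (u + w * v)) ` trace_zero)"
      then consider "z = dir q v" | w where "w \<in> trace_zero" "z = dir q (u + w * v)" by auto
      then show "z \<in> dir q ` (club_space v u - {0})"
      proof cases
        case 1
        obtain w where w: "w \<in> trace_zero" "w \<noteq> 0" using trace_zero_nonzero by auto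
        have "w * v \<in> club_space v u" unfolding club_space_def using w by (intro image_eqI[of _ _ "(w, 0)"]) auto
        moreover have "z = dir q (w * v)" using 1 w dir_scale tK by simp
        ultimately show ?thesis using w indep_K_nonzero[OF i] by auto
      next
        case 2
        have "u + w * v \<in> club_space v u" unfolding club_space_def
          using 2 by (intro image_eqI[of _ _ "(w, 1)"]) auto
        then show ?thesis using 2 indep_sum_nonzero[OF i tK] by auto
      qed
    qed
  qed
  finally show ?thesis .
qed

lemma card_club_dirs:
  assumes i: "indep_K v u"
  shows "card (club_dirs (v, u)) = r ^ 2 + 1"
proof -
  have tK: "w \<in> trace_zero \<Longrightarrow> w \<in> K" for w using trace_zero_subset_K by auto
  have "inj_on (\<lambda>w. dir q (u + w * v)) trace_zero"
    by (rule inj_onI) (use dir_sum_eq_iff(1)[OF i] tK in blast)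
  then have "card ((\<lambda>w. dir q (u + w * v)) ` trace_zero) = r ^ 2"
    by (simp add: card_image card_trace_zero)
  moreover have "dir q v \<notin> (\<lambda>w. dir q (u + w * v)) ` trace_zero"
    using dir_sum_eq_iff(2)[OF i tK tK] by (auto simp: eq_commute)
  ultimately show ?thesis unfolding club_dirs_eq[OF i] by simp
qed

lemma dir_in_club_dirs_iff:
  assumes i: "indep_K v u" and a: "a \<in> K"
  shows "dir q (u + a * v) \<in> club_dirs (v, u) \<longleftrightarrow> a \<in> trace_zero"
  using dir_sum_eq_iff[OF i a] trace_zero_subset_K a unfolding club_dirs_eq[OF i] by auto

text \<open>The right-hand side mentions neither \<open>v\<close> nor \<open>u\<close>: in
  coordinates all clubs give the same connection set.\<close>

lemma combination_in_conn_set_iff: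
  assumes i: "indep_K v u" and ab: "a \<in> K" "b \<in> K"
  shows "a * v + b * u \<in> conn_set (club_dirs (v, u)) \<longleftrightarrow>
    (if b = 0 then a \<noteq> 0 else a / b \<in> trace_zero)"
proof (cases "b = 0")
  case True
  then show ?thesis using ab indep_K_nonzero[OF i] dir_scale[of a v]
    by (auto simp: conn_set_def club_dirs_eq[OF i])
next
  case False
  then have "a * v + b * u \<noteq> 0" using i ab unfolding indep_K_def by blast
  then show ?thesis
    using False dir_combination[OF i ab] dir_in_club_dirs_iff[OF i K_divide[OF ab]] by (simp add: conn_set_def)
qed

lemma bij_combination:
  assumes i: "indep_K v u"
  shows "bij_betw (\<lambda>(a, b). a * v + b * u) (K \<times> K) UNIV"
proof -
  have inj: "inj_on (\<lambda>(a, b). a * v + b * u) (K \<times> K)"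
    by (rule inj_onI, clarify) (use indep_K_D[OF i] in blast)
  then have "card ((\<lambda>(a, b). a * v + b * u) ` (K \<times> K)) = CARD('a)"
    by (simp add: card_image card_cartesian_product card_K card_UNIV power2_eq_square)
  then have "(\<lambda>(a, b). a * v + b * u) ` (K \<times> K) = UNIV"
    by (intro card_subset_eq) auto
  then show ?thesis using inj by (simp add: bij_betw_def)
qed

lemma combination_obtain:
  assumes "indep_K v u"
  obtains a b where "a \<in> K" "b \<in> K" "x = a * v + b * u"
proof -
  have "x \<in> (\<lambda>(a, b). a * v + b * u) ` (K \<times> K)"
    using bij_combination[OF assms] by (simp add: bij_betw_def)
  then show ?thesis using that by auto
qed

text \<open>The isomorphism is the \<open>K\<close>-linear map taking one basis to the
  other.\<close>

lemma digraph_iso_clubs: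
  assumes i: "indep_K v u" "indep_K v' u'"
  shows "digraph_iso (with_proj (cayley_graph (conn_set (club_dirs (v, u)))))
    (with_proj (cayley_graph (conn_set (club_dirs (v', u')))))"
proof -
  define g where "g = (\<lambda>(a, b). a * v + b * u)"
  define g' where "g' = (\<lambda>(a, b). a * v' + b * u')"
  have bij: "bij_betw g (K \<times> K) UNIV" "bij_betw g' (K \<times> K) UNIV"
    using bij_combination i unfolding g_def g'_def by blast+
  define T where "T = g' \<circ> inv_into (K \<times> K) g"
  have T: "T (a * v + b * u) = a * v' + b * u'" if "a \<in> K" "b \<in> K" for a b
  proof -
    have "inv_into (K \<times> K) g (g (a, b)) = (a, b)"
      using that bij(1) by (intro inv_into_f_f) (auto simp: bij_betw_def)
    then show ?thesis by (simp add: T_def g_def g'_def)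
  qed
  show ?thesis
  proof (rule digraph_iso_cayley_graph)
    show "bij T" unfolding T_def using bij bij_betw_inv_into bij_betw_trans by blast
    show "T (x - y) = T x - T y" for x y
    proof -
      obtain a b where x: "a \<in> K" "b \<in> K" "x = a * v + b * u" by (rule combination_obtain[OF i(1)])
      obtain c d where y: "c \<in> K" "d \<in> K" "y = c * v + d * u" by (rule combination_obtain[OF i(1)])
      have "x - y = (a - c) * v + (b - d) * u" using x y by (simp add: algebra_simps)
      then have "T (x - y) = (a - c) * v' + (b - d) * u'" using T x y K_diff by simp
      then show ?thesis using T x y by (simp add: algebra_simps)
    qed
    show "T x \<in> conn_set (club_dirs (v', u')) \<longleftrightarrow> x \<in> conn_set (club_dirs (v, u))" for x
    proof -
      obtain a b where x: "a \<in> K" "b \<in> K" "x = a * v + b * u" by (rule combination_obtain[OF i(1)])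
      then show ?thesis using T combination_in_conn_set_iff i by simp
    qed
  qed
qed

text \<open>The head \<open>v\<close> of a club is determined by its set of directions, because in the coordinate
  around any other point the club would be \<open>{0}\<close> together with the reciprocals of a plane.\<close>

lemma club_head_unique:
  assumes i: "indep_K v u" "indep_K v' u'" and eq: "club_dirs (v, u) = club_dirs (v', u')"
  shows "dir q v' = dir q v"
proof (rule ccontr)
  assume ne: "dir q v' \<noteq> dir q v"
  note tz = subspace_FD[OF subspace_F_trace_zero]
  have tK: "w \<in> trace_zero \<Longrightarrow> w \<in> K" for w using trace_zero_subset_K by auto
  have nz: "v \<noteq> 0" "v' \<noteq> 0" using indep_K_nonzero i by blast+
  have "dir q v' \<in> club_dirs (v, u)" unfolding eq club_dirs_eq[OF i(2)] by simp
  then obtain w0 where w0: "w0 \<in> trace_zero" "dir q v' = dir q (u + w0 * v)"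
    using ne unfolding club_dirs_eq[OF i(1)] by auto
  define k where "k = v' / (u + w0 * v)"
  have k: "k \<in> K" "k \<noteq> 0" "v' = k * (u + w0 * v)"
    using dir_eq_iff[OF nz(2) indep_sum_nonzero[OF i(1) tK]] w0 nz indep_sum_nonzero[OF i(1) tK]
    by (auto simp: k_def)
  have "dir q v \<in> club_dirs (v', u')" unfolding eq[symmetric] club_dirs_eq[OF i(1)] by simp
  then obtain w1 where w1: "w1 \<in> trace_zero" "dir q v = dir q (u' + w1 * v')"
    using ne unfolding club_dirs_eq[OF i(2)] by auto
  define l where "l = v / (u' + w1 * v')"
  have l: "l \<in> K" "l \<noteq> 0" "v = l * (u' + w1 * v')"
    using dir_eq_iff[OF nz(1) indep_sum_nonzero[OF i(2) tK]] w1 nz indep_sum_nonzero[OF i(2) tK]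
    by (auto simp: l_def)
  \<comment> \<open>The point of the second club with parameter \<open>w1 + w\<close> has parameter
    \<open>inverse (l * k) / w + w0\<close> in the first. Thus \<open>w\<close> is chosen so that
    this falls outside \<open>trace_zero\<close>.\<close>
  have "inverse (l * k) \<noteq> 0" using k l by simp
  then obtain w where w: "w \<in> trace_zero" "w \<noteq> 0" "inverse (l * k) / w \<notin> trace_zero"
    using plane_not_inverse_closed[OF subspace_F_trace_zero trace_zero_subset_K card_trace_zero] by blast
  have wK: "w * k \<in> K" "w * k \<noteq> 0" using w k tK K_mult by auto
  have e: "u' + (w1 + w) * v' = (inverse l + w * k * w0) * v + (w * k) * u"
  proof -
    have "u' + (w1 + w) * v' = (u' + w1 * v') + w * v'" by (simp add: algebra_simps)
    also have "u' + w1 * v' = inverse l * v" using l by simp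
    also have "w * v' = w * k * u + w * k * w0 * v" unfolding k(3) by (simp add: algebra_simps)
    finally show ?thesis by (simp add: algebra_simps)
  qed
  have c: "inverse l + w * k * w0 \<in> K" by (rule K_add[OF K_inverse[OF l(1)] K_mult[OF wK(1) tK[OF w0(1)]]])
  have "dir q (u' + (w1 + w) * v') \<in> club_dirs (v, u)"
    unfolding eq club_dirs_eq[OF i(2)] using tz(2) w w1 by blast
  then have "dir q (u + ((inverse l + w * k * w0) / (w * k)) * v) \<in> club_dirs (v, u)"
    unfolding e dir_combination[OF i(1) c wK] .
  then have "(inverse l + w * k * w0) / (w * k) \<in> trace_zero"
    unfolding dir_in_club_dirs_iff[OF i(1) K_divide[OF c wK(1)]] .
  moreover have "(inverse l + w * k * w0) / (w * k) = inverse (l * k) / w + w0"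
  proof -
    have "(inverse l + w * k * w0) / (w * k) = inverse l / (w * k) + w0"
      unfolding add_divide_distrib nonzero_mult_div_cancel_left[OF wK(2)] ..
    also have "inverse l / (w * k) = inverse (l * k) / w"
      by (simp add: divide_inverse mult_ac)
    finally show ?thesis .
  qed
  ultimately have "inverse (l * k) / w + w0 - w0 \<in> trace_zero" using tz(3) w0 by metis
  then show False using w(3) by simp
qed

section \<open>Counting the bases that give the same club\<close>

lemma club_space_scale:
  assumes "f \<in> F" "f \<noteq> 0" "w \<in> trace_zero"
  shows "club_space (l * (f * v)) (l * (u + w * v)) = (\<lambda>x. l * x) ` club_space v u"
proof
  note tz = subspace_FD[OF subspace_F_trace_zero]
  show "club_space (l * (f * v)) (l * (u + w * v)) \<subseteq> (\<lambda>x. l * x) ` club_space v u"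
  proof
    fix x assume "x \<in> club_space (l * (f * v)) (l * (u + w * v))"
    then obtain w' f' where *: "w' \<in> trace_zero" "f' \<in> F" "x = w' * (l * (f * v)) + f' * (l * (u + w * v))"
      by (auto simp: club_space_def)
    have "x = l * ((f * w' + f' * w) * v + f' * u)" unfolding *(3) by (simp add: algebra_simps)
    moreover have "(f * w' + f' * w) * v + f' * u \<in> club_space v u"
      unfolding club_space_def by (rule image_eqI[of _ _ "(f * w' + f' * w, f')"]) (use assms * tz in auto)
    ultimately show "x \<in> (\<lambda>x. l * x) ` club_space v u" by blast
  qed
  show "(\<lambda>x. l * x) ` club_space v u \<subseteq> club_space (l * (f * v)) (l * (u + w * v))"
  proof
    fix x assume "x \<in> (\<lambda>x. l * x) ` club_space v u"
    then obtain w' f' where *: "w' \<in> trace_zero" "f' \<in> F" "x = l * (w' * v + f' * u)"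
      by (auto simp: club_space_def)
    define w2 where "w2 = inverse f * (w' - f' * w)"
    have "f * w2 = w' - f' * w" using assms by (simp add: w2_def)
    then have "l * (w' * v + f' * u) = l * ((f * w2 + f' * w) * v + f' * u)" by simp
    then have "x = w2 * (l * (f * v)) + f' * (l * (u + w * v))"
      unfolding *(3) by (simp add: algebra_simps)
    moreover have "w2 \<in> trace_zero" unfolding w2_def using assms * tz(3,4) F_inverse by blast
    ultimately show "x \<in> club_space (l * (f * v)) (l * (u + w * v))"
      unfolding club_space_def using * by (intro image_eqI[of _ _ "(w2, f')"]) auto
  qed
qed

lemma dirs_scale:
  assumes "l \<in> K" "l \<noteq> 0"
  shows "dirs q ((\<lambda>x. l * x) ` A) = dirs q A"
proof -
  have "z \<in> dirs q ((\<lambda>x. l * x) ` A) \<longleftrightarrow> z \<in> dirs q A" for z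
    unfolding dirs_iff using assms by (simp add: inj_on_def proj_scale)
  then show ?thesis by blast
qed

lemma indep_K_transform:
  assumes i: "indep_K v u" and l: "l \<in> K - {0}" "f \<in> F - {0}" "w \<in> trace_zero"
  shows "indep_K (l * (f * v)) (l * (u + w * v))"
  unfolding indep_K_def
proof (intro ballI impI)
  fix a b assume ab: "a \<in> K" "b \<in> K" "a * (l * (f * v)) + b * (l * (u + w * v)) = 0"
  have K: "f \<in> K" "w \<in> K" using l F_subset_K trace_zero_subset_K by auto
  have "(a * l * f + b * l * w) * v + (b * l) * u = 0"
    using ab(3) by (simp add: algebra_simps)
  moreover have "a * l * f + b * l * w \<in> K" "b * l \<in> K" using ab K l by (auto intro!: K_add K_mult)
  ultimately have "a * l * f + b * l * w = 0 \<and> b * l = 0" using i unfolding indep_K_def by blast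
  then show "a = 0 \<and> b = 0" using l by auto
qed

text \<open>By \<open>club_head_unique\<close>, \<open>v' = al v\<close>; write
  \<open>u' = be v + la u\<close>. The points \<open>u' + w v'\<close> have parameter
  \<open>(be + w al) / la\<close> in the old basis. Taking \<open>w = 0\<close> puts
  \<open>be / la\<close> into \<open>trace_zero\<close>; subtracting it shows that
  \<open>al / la\<close> stabilises \<open>trace_zero\<close>, hence lies in
  \<open>F\<close>.\<close>

lemma club_dirs_fibre:
  assumes i: "indep_K v u"
  shows "{x \<in> indep_pairs. club_dirs x = club_dirs (v, u)} =
    (\<lambda>(l, f, w). (l * (f * v), l * (u + w * v))) ` ((K - {0}) \<times> (F - {0}) \<times> trace_zero)"
    (is "?L = ?R")
proof
  note tz = subspace_FD[OF subspace_F_trace_zero]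
  have tK: "w \<in> trace_zero \<Longrightarrow> w \<in> K" for w using trace_zero_subset_K by auto
  show "?R \<subseteq> ?L"
  proof
    fix x assume "x \<in> ?R"
    then obtain l f w where *: "l \<in> K" "l \<noteq> 0" "f \<in> F" "f \<noteq> 0" "w \<in> trace_zero"
      and x: "x = (l * (f * v), l * (u + w * v))" by auto
    have "club_dirs x = club_dirs (v, u)"
      using dirs_scale[OF *(1,2)] club_space_scale[OF *(3-5)] by (simp add: club_dirs_def x)
    then show "x \<in> ?L" using indep_K_transform[OF i] * by (simp add: indep_pairs_def x)
  qed
  show "?L \<subseteq> ?R"
  proof clarify
    fix v' u' assume "(v', u') \<in> indep_pairs" and eq: "club_dirs (v', u') = club_dirs (v, u)"
    then have i': "indep_K v' u'" by (simp add: indep_pairs_def)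
    have nz: "v \<noteq> 0" "v' \<noteq> 0" using indep_K_nonzero i i' by blast+
    have "v' / v \<in> K" using club_head_unique[OF i i' eq[symmetric]] dir_eq_iff[OF nz(2,1)] by simp
    then obtain al where al: "al \<in> K" "al \<noteq> 0" "v' = al * v" using nz by (metis divide_eq_0_iff nonzero_divide_eq_eq)
    obtain be la where bl: "be \<in> K" "la \<in> K" "u' = be * v + la * u" by (rule combination_obtain[OF i])
    have la: "la \<noteq> 0"
    proof
      assume "la = 0"
      then have "be * v' + (- al) * u' = 0" using bl al by (simp add: algebra_simps)
      then have "be = 0 \<and> - al = 0"
        using i'[unfolded indep_K_def, rule_format, OF bl(1) K_uminus[OF al(1)]] by blast
      then show False using al(2) by simp
    qed
    have mem: "(be + w * al) / la \<in> trace_zero" if w: "w \<in> trace_zero" for w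
    proof -
      have K: "be + w * al \<in> K" using w tK bl al by (intro K_add K_mult) auto
      have "dir q (u' + w * v') \<in> club_dirs (v, u)"
        using w unfolding eq[symmetric] club_dirs_eq[OF i'] by auto
      moreover have "u' + w * v' = (be + w * al) * v + la * u" using bl al by (simp add: algebra_simps)
      ultimately have "dir q (u + ((be + w * al) / la) * v) \<in> club_dirs (v, u)"
        using dir_combination[OF i K bl(2) la] by simp
      then show ?thesis unfolding dir_in_club_dirs_iff[OF i K_divide[OF K bl(2)]] .
    qed
    have w0: "be / la \<in> trace_zero" using mem[of 0] tz(1) by simp
    have "(\<lambda>x. (al / la) * x) ` trace_zero \<subseteq> trace_zero"
    proof clarify
      fix w assume "w \<in> trace_zero"
      then have "(be + w * al) / la - be / la \<in> trace_zero" using mem w0 tz(3) by blast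
      then show "(al / la) * w \<in> trace_zero" by (simp add: add_divide_distrib mult.commute)
    qed
    then have "al / la \<in> F"
      using plane_stabilizer[OF subspace_F_trace_zero card_trace_zero] K_divide al bl by blast
    moreover have "v' = la * ((al / la) * v)" "u' = la * (u + (be / la) * v)"
      using al bl la by (simp_all add: algebra_simps)
    ultimately show "(v', u') \<in> ?R"
      using al bl la w0 by (intro image_eqI[of _ _ "(la, al / la, be / la)"]) auto
  qed
qed

lemma card_club_dirs_fibre:
  assumes i: "indep_K v u"
  shows "card {x \<in> indep_pairs. club_dirs x = club_dirs (v, u)} = (q - 1) * ((r - 1) * r ^ 2)"
proof -
  have tK: "w \<in> trace_zero \<Longrightarrow> w \<in> K" for w using trace_zero_subset_K by auto
  have "inj_on (\<lambda>(l, f, w). (l * (f * v), l * (u + w * v))) ((K - {0}) \<times> (F - {0}) \<times> trace_zero)"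
    (is "inj_on ?g ?A")
  proof (rule inj_onI)
    fix x y assume mem: "x \<in> ?A" "y \<in> ?A" and g: "?g x = ?g y"
    obtain l f w l' f' w' where xy: "x = (l, f, w)" "y = (l', f', w')" by (cases x, cases y) auto
    then have *: "l \<in> K" "l \<noteq> 0" "l' \<in> K" "w \<in> trace_zero" "w' \<in> trace_zero"
      using mem by auto
    have eq: "l * (f * v) = l' * (f' * v)" "l * (u + w * v) = l' * (u + w' * v)"
      using g xy by (simp_all del: mult_cancel_left mult_cancel_right)
    have "(l * w) * v + l * u = (l' * w') * v + l' * u" using eq(2) by (simp add: algebra_simps)
    then have "l * w = l' * w'" "l = l'"
      using indep_K_D[OF i, of "l * w" l "l' * w'" l'] * tK K_mult by blast+
    then show "x = y" using eq(1) * indep_K_nonzero[OF i] xy by simp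
  qed
  then show ?thesis unfolding club_dirs_fibre[OF i]
    by (simp add: card_image card_cartesian_product card_nonzero_K card_trace_zero card_F card_Diff_subset)
qed

lemma card_indep_pairs: "card indep_pairs = (q ^ 2 - 1) * (q ^ 2 - q)"
proof -
  have "indep_pairs = (SIGMA v:- {0}. - (\<lambda>k. k * v) ` K)"
  proof (intro set_eqI iffI)
    fix x assume "x \<in> indep_pairs"
    then show "x \<in> (SIGMA v:- {0}. - (\<lambda>k. k * v) ` K)"
      using indep_K_iff[of "fst x" "snd x"] indep_K_nonzero[of "fst x" "snd x"] by (cases x) (simp add: indep_pairs_def)
  next
    fix x assume "x \<in> (SIGMA v:- {0}. - (\<lambda>k. k * v) ` K)"
    then show "x \<in> indep_pairs"
      using indep_K_iff[of "fst x" "snd x"] by (cases x) (simp add: indep_pairs_def)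
  qed
  moreover have "card (- (\<lambda>k. k * v) ` K) = q ^ 2 - q" if "v \<noteq> 0" for v
    using that by (simp add: Compl_eq_Diff_UNIV card_Diff_subset card_UNIV card_image inj_on_def card_K)
  moreover have "card (- {0::'a}) = q ^ 2 - 1"
    by (simp add: Compl_eq_Diff_UNIV card_Diff_subset card_UNIV)
  ultimately show ?thesis by (simp add: card_SigmaI)
qed

lemma card_all_clubs: "card (club_dirs ` indep_pairs) = r * (r^5 + r^4 + r^3 + r^2 + r + 1)"
proof -
  have "card indep_pairs = card (club_dirs ` indep_pairs) * ((q - 1) * ((r - 1) * r ^ 2))"
  proof (rule card_eq_card_image_times_fibre)
    fix x assume "x \<in> indep_pairs"
    then obtain v u where "x = (v, u)" "indep_K v u" by (auto simp: indep_pairs_def)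
    then show "card {y \<in> indep_pairs. club_dirs y = club_dirs x} = (q - 1) * ((r - 1) * r ^ 2)"
      using card_club_dirs_fibre by simp
  qed simp
  moreover define R where "R = r^5 + r^4 + r^3 + r^2 + r + 1"
  moreover have "(q ^ 2 - 1) * (q ^ 2 - q) = (r * R) * ((q - 1) * ((r - 1) * r ^ 2))"
  proof -
    obtain s where s: "r = Suc s" using r_gt_1 by (cases r) auto
    have "q ^ 2 = (r - 1) * R + 1"
      unfolding q_eq s R_def by (simp add: algebra_simps power2_eq_square eval_nat_numeral)
    then have 1: "q ^ 2 - 1 = (r - 1) * R" by simp
    have "q ^ 2 - q = q * (q - 1)" by (simp add: power2_eq_square diff_mult_distrib2)
    moreover have "q = r * r ^ 2" using q_eq by (simp add: power2_eq_square power3_eq_cube)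
    ultimately have 2: "q ^ 2 - q = (r * r ^ 2) * (q - 1)" by simp
    show ?thesis unfolding 1 2 by (simp only: ac_simps)
  qed
  moreover have pos: "(q - 1) * ((r - 1) * r ^ 2) > 0" using q_gt_1 r_gt_1 by simp
  ultimately have "card (club_dirs ` indep_pairs) * ((q - 1) * ((r - 1) * r ^ 2)) = (r * R) * ((q - 1) * ((r - 1) * r ^ 2))"
    using card_indep_pairs by simp
  then have "card (club_dirs ` indep_pairs) = r * R" using pos by (simp only: mult_cancel2) simp
  then show ?thesis by (simp add: R_def)
qed

lemma indep_pairs_nonempty: "indep_pairs \<noteq> {}"
proof -
  have "q < q ^ 2" using q_gt_1 by (simp add: power2_eq_square)
  then have "card indep_pairs > 0" unfolding card_indep_pairs using q_gt_1 by simp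
  then show ?thesis by auto
qed

lemma club_dirs_subset: "club_dirs x \<subseteq> all_dirs"
  using dirs_subset by (simp add: club_dirs_def split: prod.split)

lemma r2_less_q: "r ^ 2 + 1 \<le> q"
  using q_eq r_gt_1 power_strict_increasing[of 2 3 r] by (simp add: Suc_le_eq)

lemma club_noncanonical:
  assumes x: "(v, u) \<in> indep_pairs" and Z: "Z \<subseteq> all_dirs" "card Z \<le> q" "club_dirs (v, u) \<subseteq> Z"
  shows "noncanonical_clique K (conn_set Z) (club_space v u)"
proof -
  have i: "indep_K v u" using x by (simp add: indep_pairs_def)
  have c: "card (dirs q (club_space v u)) = r ^ 2 + 1"
    using card_club_dirs[OF i] by (simp add: club_dirs_def)
  moreover have "Z \<noteq> {}" using Z(3) club_dirs_eq[OF i] by auto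
  moreover have "r ^ 2 + 1 \<ge> 2" using r_gt_1 by simp
  ultimately show ?thesis
    using noncanonical_clique_iff[of Z "club_space v u"] Z card_club_space[OF i] by (simp add: club_dirs_def)
qed

lemma noncanonical_few:
  assumes Z: "Z \<subseteq> all_dirs" "Z \<noteq> {}" "card Z \<le> r ^ 2 + 1" and A: "noncanonical_clique K (conn_set Z) A"
  shows "card Z = r ^ 2 + 1" "dirs q A = Z"
proof -
  have A': "dirs q A \<subseteq> Z" "card A = q" "card (dirs q A) \<ge> 2"
    using A noncanonical_clique_iff[of Z A] Z r2_less_q by auto
  have le: "card (dirs q A) \<le> card Z" using A'(1) by (intro card_mono) auto
  then have "card (dirs q A) = r ^ 2 + 1" using card_dirs_few_directions A' Z(3) by simp
  then show Z': "card Z = r ^ 2 + 1" using le Z(3) by simp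
  show "dirs q A = Z"
    using card_subset_eq[OF finite A'(1)] Z' \<open>card (dirs q A) = r ^ 2 + 1\<close> by simp
qed

lemma not_strict_EKR_iff: "\<not> strict_EKR K S \<longleftrightarrow> (\<exists>A. noncanonical_clique K S A)"
  by (auto simp: strict_EKR_def noncanonical_clique_def)

lemma extremal_iff: "extremal K S \<longleftrightarrow> S \<in> conn_set ` club_dirs ` indep_pairs"
proof
  assume "extremal K S"
  then obtain m where m: "peisert_type K m S" "\<not> strict_EKR K S"
    "\<And>T. peisert_type K (m - 1) T \<Longrightarrow> strict_EKR K T"
    by (auto simp: extremal_def extremal_of_type_def)
  obtain Z where Z: "Z \<subseteq> all_dirs" "card Z = m" "S = conn_set Z" "1 \<le> m" "m \<le> q"
    using m(1) peisert_type_iff by auto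
  have "Z \<noteq> {}" using Z by auto
  obtain A where A: "noncanonical_clique K (conn_set Z) A" using m(2) not_strict_EKR_iff Z(3) by auto
  have "m \<le> r ^ 2 + 1"
  proof (rule ccontr)
    assume "\<not> m \<le> r ^ 2 + 1"
    then have big: "r ^ 2 + 1 \<le> m - 1" by simp
    obtain v u where x: "(v, u) \<in> indep_pairs" using indep_pairs_nonempty by auto
    have "card (club_dirs (v, u)) \<le> m - 1" using big card_club_dirs x by (simp add: indep_pairs_def)
    moreover have "m - 1 \<le> card all_dirs" using Z card_all_dirs by simp
    ultimately obtain Z' where Z': "club_dirs (v, u) \<subseteq> Z'" "Z' \<subseteq> all_dirs" "card Z' = m - 1"
      using exists_subset_between[OF _ _ club_dirs_subset finite] by metis
    have "peisert_type K (m - 1) (conn_set Z')" unfolding peisert_type_iff using Z' Z big by auto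
    then have "strict_EKR K (conn_set Z')" by (rule m(3))
    moreover have "noncanonical_clique K (conn_set Z') (club_space v u)"
      using club_noncanonical[OF x Z'(2) _ Z'(1)] Z' Z by simp
    ultimately show False using not_strict_EKR_iff by blast
  qed
  then have "dirs q A = Z" using noncanonical_few[OF Z(1) \<open>Z \<noteq> {}\<close> _ A] Z(2) by simp
  have A': "card A = q" "card (dirs q A) \<ge> 2"
    using A noncanonical_clique_iff[OF Z(1) \<open>Z \<noteq> {}\<close>] Z by auto
  then obtain a where a: "a \<in> A" using q_gt_1 by fastforce
  define B where "B = (\<lambda>x. x - a) ` A"
  have B: "dirs q B = Z" "card B = q" "0 \<in> B"
    using dirs_translate \<open>dirs q A = Z\<close> A'(1) a by (auto simp: B_def card_image inj_on_def)
  then obtain v u where "(v, u) \<in> indep_pairs" "B = club_space v u"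
    using club_space_of_few_directions[of B] A' \<open>dirs q A = Z\<close> Z(2) \<open>m \<le> r ^ 2 + 1\<close> by auto
  then show "S \<in> conn_set ` club_dirs ` indep_pairs"
    using Z(3) B(1) by (auto simp: club_dirs_def intro!: image_eqI[of _ _ "(v, u)"])
next
  assume "S \<in> conn_set ` club_dirs ` indep_pairs"
  then obtain v u where x: "(v, u) \<in> indep_pairs" "S = conn_set (club_dirs (v, u))" by auto
  have card: "card (club_dirs (v, u)) = r ^ 2 + 1" using card_club_dirs x by (simp add: indep_pairs_def)
  have "extremal_of_type K (r ^ 2 + 1) S"
    unfolding extremal_of_type_def
  proof (intro conjI allI impI)
    show "peisert_type K (r ^ 2 + 1) S"
      unfolding peisert_type_iff using x card r2_less_q club_dirs_subset by auto
    show "\<not> strict_EKR K S"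
      unfolding not_strict_EKR_iff x(2)
      using club_noncanonical[OF x(1) club_dirs_subset _ subset_refl] card r2_less_q by auto
  next
    fix T assume "peisert_type K (r ^ 2 + 1 - 1) T"
    then obtain Z where Z: "Z \<subseteq> all_dirs" "card Z = r ^ 2" "T = conn_set Z" using peisert_type_iff by auto
    have "Z \<noteq> {}" using Z r_gt_1 by auto
    show "strict_EKR K T"
    proof (rule ccontr)
      assume "\<not> strict_EKR K T"
      then obtain A where "noncanonical_clique K (conn_set Z) A" using not_strict_EKR_iff Z(3) by auto
      then show False using noncanonical_few(1)[OF Z(1) \<open>Z \<noteq> {}\<close>] Z(2) by simp
    qed
  qed
  then show "extremal K S" by (auto simp: extremal_def)
qed

lemma card_extremal: "card {S. extremal K S} = r * (r^5 + r^4 + r^3 + r^2 + r + 1)"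
proof -
  have "inj_on conn_set (club_dirs ` indep_pairs)"
  proof (rule inj_onI)
    fix Y Z assume YZ: "Y \<in> club_dirs ` indep_pairs" "Z \<in> club_dirs ` indep_pairs" and eq: "conn_set Y = conn_set Z"
    obtain y where "Y = club_dirs y" using YZ(1) by (rule imageE)
    then have Y: "Y \<subseteq> all_dirs" by (simp only: club_dirs_subset)
    obtain z where "Z = club_dirs z" using YZ(2) by (rule imageE)
    then have Z: "Z \<subseteq> all_dirs" by (simp only: club_dirs_subset)
    show "Y = Z" by (rule box_equals[OF _ dir_conn_set[OF Y] dir_conn_set[OF Z]]) (simp only: eq)
  qed
  moreover have "{S. extremal K S} = conn_set ` (club_dirs ` indep_pairs)" using extremal_iff by auto
  ultimately show ?thesis using card_all_clubs by (simp add: card_image)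
qed

lemma card_canonical:
  assumes Z: "Z \<subseteq> all_dirs"
  shows "card {A. canonical_clique K (conn_set Z) A \<and> 0 \<in> A} = card Z"
proof -
  have line: "canonical_clique K (conn_set Z) A \<and> 0 \<in> A \<longleftrightarrow> (\<exists>z\<in>Z. A = {y. proj z y = 0})" for A
  proof
    assume "canonical_clique K (conn_set Z) A \<and> 0 \<in> A"
    then obtain x c where xc: "c \<noteq> 0" "dir q c \<in> Z" "A = (\<lambda>k. x + c * k) ` K" and "0 \<in> A"
      unfolding canonical_clique_iff by blast
    then have c: "c \<noteq> 0" "dir q c \<in> Z" "A = {y. proj (dir q c) (y - x) = 0}" "0 \<in> A"
      unfolding xc(3) line_eq[OF xc(1)] by auto
    then have "proj (dir q c) x = 0" by (simp add: proj_diff)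
    then show "\<exists>z\<in>Z. A = {y. proj z y = 0}" using c by (auto simp: proj_diff)
  next
    assume "\<exists>z\<in>Z. A = {y. proj z y = 0}"
    then obtain z where z: "z \<in> Z" "A = {y. proj z y = 0}" by auto
    then obtain c where c: "c \<noteq> 0" "z = dir q c" using Z by (auto simp: all_dirs_def)
    then have "A = (\<lambda>k. 0 + c * k) ` K" unfolding line_eq[OF c(1)] using z by simp
    then show "canonical_clique K (conn_set Z) A \<and> 0 \<in> A"
      unfolding canonical_clique_iff using c z
      by (intro conjI exI[of _ 0] exI[of _ c]) auto
  qed
  have "inj_on (\<lambda>z. {y. proj z y = 0}) Z"
  proof (rule inj_onI)
    fix y z assume yz: "y \<in> Z" "z \<in> Z" "{x. proj y x = 0} = {x. proj z x = 0}"
    obtain c where c: "c \<noteq> 0" "y = dir q c" using yz Z by (auto simp: all_dirs_def)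
    then have "proj y c = 0" by (simp add: proj_eq_0_iff)
    then have "proj z c = 0" using yz(3) by auto
    then show "y = z" using c by (simp add: proj_eq_0_iff)
  qed
  then have "card ((\<lambda>z. {y. proj z y = 0}) ` Z) = card Z" by (rule card_image)
  moreover have "{A. canonical_clique K (conn_set Z) A \<and> 0 \<in> A} = (\<lambda>z. {y. proj z y = 0}) ` Z"
    using line by auto
  ultimately show ?thesis by simp
qed

lemma club_space_stabilizer:
  assumes i: "indep_K v u" and m: "m \<in> K" "m \<noteq> 0"
  shows "(\<lambda>x. m * x) ` club_space v u = club_space v u \<longleftrightarrow> m \<in> F"
proof
  assume eq: "(\<lambda>x. m * x) ` club_space v u = club_space v u"
  have "(\<lambda>x. m * x) ` trace_zero \<subseteq> trace_zero"
  proof clarify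
    fix w assume w: "w \<in> trace_zero"
    have "w * v \<in> club_space v u" unfolding club_space_def using w by (intro image_eqI[of _ _ "(w, 0)"]) auto
    then have "m * (w * v) \<in> club_space v u" using eq by blast
    then obtain w' f where wf: "w' \<in> trace_zero" "f \<in> F" "m * (w * v) = w' * v + f * u"
      by (auto simp: club_space_def)
    have "(m * w) * v + 0 * u = w' * v + f * u" using wf(3) by (simp add: algebra_simps)
    then have "m * w = w'"
      by (rule indep_K_D[OF i]) (use wf w m trace_zero_subset_K F_subset_K K_mult in auto)
    then show "m * w \<in> trace_zero" using wf by simp
  qed
  then show "m \<in> F" using plane_stabilizer[OF subspace_F_trace_zero card_trace_zero m(1)] by blast
next
  assume mF: "m \<in> F"
  have "(\<lambda>x. m * x) ` club_space v u \<subseteq> club_space v u"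
    using subspace_FD(4)[OF subspace_club_space mF] by blast
  moreover have "card ((\<lambda>x. m * x) ` club_space v u) = card (club_space v u)"
    using m(2) by (simp add: card_image inj_on_def)
  ultimately show "(\<lambda>x. m * x) ` club_space v u = club_space v u"
    by (intro card_subset_eq) auto
qed

lemma noncanonical_cliques_eq:
  assumes x: "(v, u) \<in> indep_pairs"
  shows "{A. noncanonical_clique K (conn_set (club_dirs (v, u))) A \<and> 0 \<in> A} =
    (\<lambda>l. (\<lambda>x. l * x) ` club_space v u) ` (K - {0})" (is "?L = ?R")
proof
  have i: "indep_K v u" using x by (simp add: indep_pairs_def)
  have card: "card (club_dirs (v, u)) = r ^ 2 + 1" by (rule card_club_dirs[OF i])
  then have ne: "club_dirs (v, u) \<noteq> {}" by auto
  have iff: "noncanonical_clique K (conn_set (club_dirs (v, u))) A \<longleftrightarrow>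
    dirs q A \<subseteq> club_dirs (v, u) \<and> card A = q \<and> card (dirs q A) \<ge> 2" for A
    using noncanonical_clique_iff[OF club_dirs_subset ne] card r2_less_q by simp
  show "?L \<subseteq> ?R"
  proof clarify
    fix A assume A: "noncanonical_clique K (conn_set (club_dirs (v, u))) A" "0 \<in> A"
    then have eq: "dirs q A = club_dirs (v, u)"
      using noncanonical_few(2)[OF club_dirs_subset ne _ A(1)] card by simp
    then obtain v' u' where x': "(v', u') \<in> indep_pairs" "A = club_space v' u'"
      using club_space_of_few_directions[of A] A iff card by auto
    then have "(v', u') \<in> {x \<in> indep_pairs. club_dirs x = club_dirs (v, u)}"
      using eq by (simp add: club_dirs_def)
    then obtain l f w where "l \<in> K - {0}" "f \<in> F - {0}" "w \<in> trace_zero"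
      "v' = l * (f * v)" "u' = l * (u + w * v)"
      unfolding club_dirs_fibre[OF i] by auto
    then show "A \<in> ?R" using club_space_scale[of f w l v u] x'(2) by auto
  qed
  show "?R \<subseteq> ?L"
  proof
    fix A assume "A \<in> ?R"
    then obtain l where l: "l \<in> K" "l \<noteq> 0" and A: "A = (\<lambda>x. l * x) ` club_space v u" by auto
    have "dirs q ((\<lambda>x. l * x) ` club_space v u) = club_dirs (v, u)"
      using dirs_scale[OF l] by (simp add: club_dirs_def)
    moreover have "card ((\<lambda>x. l * x) ` club_space v u) = q"
      using l card_club_space[OF i] by (simp add: card_image inj_on_def)
    moreover have "0 \<in> (\<lambda>x. l * x) ` club_space v u"
      using subspace_FD(1)[OF subspace_club_space] by force
    moreover have "r ^ 2 + 1 \<ge> 2" using r_gt_1 by simp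
    ultimately show "A \<in> ?L"
      using iff card by (simp add: A)
  qed
qed

lemma card_noncanonical:
  assumes x: "(v, u) \<in> indep_pairs"
  shows "card {A. noncanonical_clique K (conn_set (club_dirs (v, u))) A \<and> 0 \<in> A} = r ^ 2 + r + 1"
proof -
  have i: "indep_K v u" using x by (simp add: indep_pairs_def)
  define g where "g = (\<lambda>l. (\<lambda>x. l * x) ` club_space v u)"
  have "card (K - {0}) = card (g ` (K - {0})) * (r - 1)"
  proof (rule card_eq_card_image_times_fibre)
    fix l assume l: "l \<in> K - {0}"
    have "g (m * l) = g l \<longleftrightarrow> m \<in> F" if m: "m \<in> K" "m \<noteq> 0" for m
    proof -
      have gm: "g (m * l) = (\<lambda>x. l * x) ` ((\<lambda>x. m * x) ` club_space v u)"
        by (simp add: g_def image_image mult_ac)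
      have "inj (\<lambda>x. l * x)" using l by (simp add: inj_on_def)
      then have "g (m * l) = g l \<longleftrightarrow> (\<lambda>x. m * x) ` club_space v u = club_space v u"
        unfolding gm unfolding g_def by (rule inj_image_eq_iff)
      then show ?thesis using club_space_stabilizer[OF i m] by simp
    qed
    then have "bij_betw (\<lambda>m. m * l) (F - {0}) {k \<in> K - {0}. g k = g l}"
    proof (intro bij_betwI[where g = "\<lambda>k. k / l"])
      assume *: "\<And>m. m \<in> K \<Longrightarrow> m \<noteq> 0 \<Longrightarrow> g (m * l) = g l \<longleftrightarrow> m \<in> F"
      show "(\<lambda>m. m * l) \<in> F - {0} \<rightarrow> {k \<in> K - {0}. g k = g l}"
        using * l F_subset_K K_mult by auto
      show "(\<lambda>k. k / l) \<in> {k \<in> K - {0}. g k = g l} \<rightarrow> F - {0}"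
        using *[of "_ / l"] l K_divide by auto
    qed (use l in auto)
    then show "card {k \<in> K - {0}. g k = g l} = r - 1"
      using bij_betw_same_card card_F by (fastforce simp: card_Diff_subset)
  qed simp
  moreover have "card (K - {0}) = (r ^ 2 + r + 1) * (r - 1)"
  proof -
    obtain s where s: "r = Suc s" using r_gt_1 by (cases r) auto
    have "q = (r ^ 2 + r + 1) * (r - 1) + 1"
      unfolding q_eq s by (simp add: algebra_simps power2_eq_square power3_eq_cube)
    then show ?thesis by (simp add: card_nonzero_K)
  qed
  ultimately have "card (g ` (K - {0})) = r ^ 2 + r + 1" using r_gt_1 by (metis mult_cancel2 zero_less_diff less_numeral_extra(3))
  then show ?thesis unfolding noncanonical_cliques_eq[OF x] g_def .
qed

end

theorem theorem1p5:
  fixes K :: "'a::{field,finite} set" and q r :: nat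
  assumes "primepow r" and "\<not> is_square r" and "q = r ^ 3"
    and "CARD('a) = q ^ 2" and "is_subfield K" and "card K = q"
  shows "card (cayley_graph ` {S. extremal K S}) = r * (r^5 + r^4 + r^3 + r^2 + r + 1) \<and>
    (\<forall>S T. extremal K S \<longrightarrow> extremal K T \<longrightarrow>
       digraph_iso (with_proj (cayley_graph S)) (with_proj (cayley_graph T))) \<and>
    (\<forall>S. extremal K S \<longrightarrow>
       card {A. canonical_clique K S A \<and> 0 \<in> A} = r^2 + 1 \<and>
       card {A. noncanonical_clique K S A \<and> 0 \<in> A} = r^2 + r + 1)"
proof -
  interpret cubic_field K q r by unfold_locales (use assms in auto)
  have ex: "\<exists>v u. indep_K v u \<and> S = conn_set (club_dirs (v, u))" if "extremal K S" for S
    using that extremal_iff by (auto simp: indep_pairs_def)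
  have "card (cayley_graph ` {S. extremal K S}) = r * (r^5 + r^4 + r^3 + r^2 + r + 1)"
    by (simp only: card_image[OF inj_on_subset[OF inj_cayley_graph subset_UNIV]] card_extremal)
  moreover have "digraph_iso (with_proj (cayley_graph S)) (with_proj (cayley_graph T))"
    if "extremal K S" "extremal K T" for S T
    using ex[OF that(1)] ex[OF that(2)] digraph_iso_clubs by auto
  moreover have "card {A. canonical_clique K S A \<and> 0 \<in> A} = r^2 + 1"
    "card {A. noncanonical_clique K S A \<and> 0 \<in> A} = r^2 + r + 1" if "extremal K S" for S
    using ex[OF that] card_canonical[OF club_dirs_subset] card_club_dirs card_noncanonical
    by (auto simp: indep_pairs_def)
  ultimately show ?thesis by blast
qed

end
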